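(* Let $\mathcal F$ be an $f$-triangle of size $n$ (the $f$-triangle of some uniform triangulation of an $(n-1)$-dimensional simplicial complex), let $V$ be a set with $|V|=n$, and let $\Gamma$ be any triangulation of the $(n-1)$-dimensional simplex $2^V$. For $k,j\in\{0,1,\dots,n\}$ with $k+j\le n$ put $$c_{k,j}(\Gamma)=\sum_{F\subseteq V:\,|F|=n-k}[x^j]\,\ell_F(\Gamma_F,x).$$ Then the $c_{k,j}(\Gamma)$ are nonnegative integers, and $$\ell_V(\Delta,x)=\sum_{k=0}^n\sum_{j=0}^{n-k}c_{k,j}(\Gamma)\,\ell_{\mathcal F,n,k,j}(x)$$ for every $\mathcal F$-uniform triangulation $\Delta$ of $\Gamma$.
   Context: Triangulation means geometric triangulation: $\Delta$ triangulates $\Gamma$ if a geometric realization of $\Delta$ subdivides one of $\Gamma$. The carrier of a face of $\Delta$ is the smallest face of $\Gamma$ whose realization contains it; for $F\in\Gamma$, the restriction $\Delta_F$ consists of the faces of $\Delta$ with carrier contained in $F$ (it triangulates $2^F$). For $\Gamma$ a triangulation of $2^V$, $\Gamma_F$ for $F\subseteq V$ is defined likewise with respect to $2^V$. The $h$-polynomial of a $(d-1)$-dimensional complex $K$ is $h(K,x)=\sum_{i=0}^d f_{i-1}(K)x^i(1-x)^{d-i}$, $f_i$ = number of $i$-dimensional faces, $f_{-1}=1$ (so the empty complex has $h=1$). For a triangulation $\Delta$ of $2^F$ its local $h$-polynomial is $\ell_F(\Delta,x)=\sum_{G\subseteq F}(-1)^{|F|-|G|}h(\Delta_G,x)$ (so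 $\ell_\varnothing=1$). A triangulation $\Delta$ of an $(n-1)$-dimensional complex $\Gamma$ is uniform, with $f$-triangle $\mathcal F=(f(i,j))_{0\le i\le j\le n}$ (an "$\mathcal F$-uniform triangulation"), if for every $(j-1)$-dimensional face $F$ of $\Gamma$ the number of $(i-1)$-dimensional faces of $\Delta_F$ equals $f(i,j)$. For $0\le m\le n$, $h_{\mathcal F}(\sigma_m,x)$ denotes the $h$-polynomial of any $\mathcal F$-uniform triangulation of the $(m-1)$-dimensional simplex $\sigma_m$ (it depends only on $\mathcal F$ and $m$). Define $p_{\mathcal F,m,k}(x)=\sum_{i=0}^k\binom{k}{i}(x-1)^i h_{\mathcal F}(\sigma_{m-i},x)$ for $0\le k\le m\le n$, and $\ell_{\mathcal F,m,k,j}(x)=\sum_{i=0}^k(-1)^i\binom{k}{i}p_{\mathcal F,m-i,j}(x)$ for $k,j\ge0$ with $k+j\le m\le n$. $[x^j]f$ denotes the coefficient of $x^j$ in $f$. *)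

theory Defs
  imports "HOL-Analysis.Analysis" "HOL-Computational_Algebra.Polynomial"
begin

section \<open>Geometric triangulations\<close>

definition abstract_complex :: "'v set set \<Rightarrow> bool" where
  "abstract_complex K \<longleftrightarrow>
     finite K \<and> {} \<in> K \<and> (\<forall>F\<in>K. finite F) \<and> (\<forall>F\<in>K. \<forall>G. G \<subseteq> F \<longrightarrow> G \<in> K)"

definition cell :: "('v \<Rightarrow> 'a::euclidean_space) \<Rightarrow> 'v set \<Rightarrow> 'a set" where
  "cell \<rho> F = convex hull (\<rho> ` F)"

definition geometric_realization :: "'v set set \<Rightarrow> ('v \<Rightarrow> 'a::euclidean_space) \<Rightarrow> bool" where
  "geometric_realization K \<rho> \<longleftrightarrow>
     inj_on \<rho> (\<Union>K) \<and> (\<forall>F\<in>K. \<not> affine_dependent (\<rho> ` F)) \<and> simplicial_complex (cell \<rho> ` K)"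

definition triangulates ::
  "'u set set \<Rightarrow> ('u \<Rightarrow> 'a::euclidean_space) \<Rightarrow> 'v set set \<Rightarrow> ('v \<Rightarrow> 'a) \<Rightarrow> bool" where
  "triangulates \<Delta> \<delta> \<Gamma> \<gamma> \<longleftrightarrow>
     abstract_complex \<Delta> \<and> abstract_complex \<Gamma> \<and>
     geometric_realization \<Delta> \<delta> \<and> geometric_realization \<Gamma> \<gamma> \<and>
     \<Union>(cell \<delta> ` \<Delta>) = \<Union>(cell \<gamma> ` \<Gamma>) \<and>
     (\<forall>G\<in>\<Delta>. \<exists>F\<in>\<Gamma>. cell \<delta> G \<subseteq> cell \<gamma> F)"

definition carrier_face ::
  "('u \<Rightarrow> 'a::euclidean_space) \<Rightarrow> 'v set set \<Rightarrow> ('v \<Rightarrow> 'a) \<Rightarrow> 'u set \<Rightarrow> 'v set" where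
  "carrier_face \<delta> \<Gamma> \<gamma> G =
     (THE F. F \<in> \<Gamma> \<and> cell \<delta> G \<subseteq> cell \<gamma> F \<and>
        (\<forall>F'\<in>\<Gamma>. cell \<delta> G \<subseteq> cell \<gamma> F' \<longrightarrow> F \<subseteq> F'))"

text \<open>
  The notions below see a triangulation \<open>\<Delta>\<close> of \<open>\<Gamma>\<close> only through its carrier map \<open>c\<close>.
  In particular, if \<open>\<Delta>\<close> triangulates \<open>\<Gamma>\<close> with carrier map \<open>c\<close> and \<open>\<Gamma>\<close> triangulates
  \<open>Pow V\<close> with carrier map \<open>c'\<close>, then \<open>\<Delta>\<close> triangulates \<open>Pow V\<close> with carrier map \<open>c' \<circ> c\<close>.
  This makes sense even when the two triangulations use different realizations of \<open>\<Gamma>\<close>;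
  \<open>carrier_face_trans\<close> confirms it when they use the same one.
\<close>

definition restriction :: "'u set set \<Rightarrow> ('u set \<Rightarrow> 'v set) \<Rightarrow> 'v set \<Rightarrow> 'u set set" where
  "restriction \<Delta> c F = {G\<in>\<Delta>. c G \<subseteq> F}"

section \<open>h-polynomials and local h-polynomials\<close>

text \<open>To avoid negative indices, faces are counted by cardinality:
  \<open>face_num K i\<close> is $f_{i-1}(K)$, and a complex \<open>K\<close> has dimension \<open>rank_cpx K - 1\<close>.\<close>

definition face_num :: "'v set set \<Rightarrow> nat \<Rightarrow> nat" where
  "face_num K i = card {F\<in>K. card F = i}"

definition rank_cpx :: "'v set set \<Rightarrow> nat" where
  "rank_cpx K = Max (card ` K)"

definition h_of_f :: "nat \<Rightarrow> (nat \<Rightarrow> nat) \<Rightarrow> int poly" where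
  "h_of_f d f = (\<Sum>i\<le>d. of_nat (f i) * [:0, 1:] ^ i * [:1, -1:] ^ (d - i))"

definition h_poly :: "'v set set \<Rightarrow> int poly" where
  "h_poly K = h_of_f (rank_cpx K) (face_num K)"

definition local_h :: "'v set \<Rightarrow> 'u set set \<Rightarrow> ('u set \<Rightarrow> 'v set) \<Rightarrow> int poly" where
  "local_h F \<Delta> c = (\<Sum>G\<in>Pow F. (-1) ^ (card F - card G) * h_poly (restriction \<Delta> c G))"

definition c_coeff :: "'v set \<Rightarrow> 'w set set \<Rightarrow> ('w set \<Rightarrow> 'v set) \<Rightarrow> nat \<Rightarrow> nat \<Rightarrow> int" where
  "c_coeff V \<Gamma> c k j =
     (\<Sum>F | F \<subseteq> V \<and> card F = card V - k. coeff (local_h F (restriction \<Gamma> c F) c) j)"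

section \<open>Uniform triangulations\<close>

definition uniform_triangulation ::
  "(nat \<Rightarrow> nat \<Rightarrow> nat) \<Rightarrow> 'u set set \<Rightarrow> ('u \<Rightarrow> 'a::euclidean_space) \<Rightarrow> 'v set set \<Rightarrow> ('v \<Rightarrow> 'a) \<Rightarrow> bool" where
  "uniform_triangulation f \<Delta> \<delta> \<Gamma> \<gamma> \<longleftrightarrow>
     triangulates \<Delta> \<delta> \<Gamma> \<gamma> \<and>
     (\<forall>F\<in>\<Gamma>. \<forall>i\<le>card F.
        face_num (restriction \<Delta> (carrier_face \<delta> \<Gamma> \<gamma>) F) i = f i (card F))"

text \<open>\<open>h_simplex f m\<close> is the h-polynomial of any \<open>f\<close>-uniform triangulation of the
  \<open>(m-1)\<close>-dimensional simplex, written in terms of the f-triangle;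
  see \<open>h_poly_uniform_simplex\<close>.\<close>

definition h_simplex :: "(nat \<Rightarrow> nat \<Rightarrow> nat) \<Rightarrow> nat \<Rightarrow> int poly" where
  "h_simplex f m = h_of_f m (\<lambda>i. f i m)"

definition p_poly :: "(nat \<Rightarrow> nat \<Rightarrow> nat) \<Rightarrow> nat \<Rightarrow> nat \<Rightarrow> int poly" where
  "p_poly f m k = (\<Sum>i\<le>k. of_nat (k choose i) * [:-1, 1:] ^ i * h_simplex f (m - i))"

definition l_poly :: "(nat \<Rightarrow> nat \<Rightarrow> nat) \<Rightarrow> nat \<Rightarrow> nat \<Rightarrow> nat \<Rightarrow> int poly" where
  "l_poly f m k j = (\<Sum>i\<le>k. (-1) ^ i * of_nat (k choose i) * p_poly f (m - i) j)"

section \<open>Well-definedness\<close>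

lemma cell_Int:
  assumes r: "geometric_realization K \<rho>" and "F \<in> K" "G \<in> K"
  shows "cell \<rho> F \<inter> cell \<rho> G = cell \<rho> (F \<inter> G)"
proof
  have sc: "simplicial_complex (cell \<rho> ` K)"
    and aff: "\<not> affine_dependent (\<rho> ` F)" "\<not> affine_dependent (\<rho> ` G)"
    and inj: "inj_on \<rho> (\<Union>K)"
    using assms by (auto simp: geometric_realization_def)
  have "cell \<rho> F \<inter> cell \<rho> G face_of cell \<rho> F" "cell \<rho> G \<inter> cell \<rho> F face_of cell \<rho> G"
    using sc assms(2,3) unfolding simplicial_complex_def by blast+
  then obtain A B where A: "A \<subseteq> \<rho> ` F" "cell \<rho> F \<inter> cell \<rho> G = convex hull A"
    and B: "B \<subseteq> \<rho> ` G" "cell \<rho> F \<inter> cell \<rho> G = convex hull B"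
    using aff_independent_finite[OF aff(1)] aff_independent_finite[OF aff(2)]
    by (metis face_of_convex_hull_subset finite_imp_compact Int_commute cell_def)
  have "\<not> affine_dependent A" "\<not> affine_dependent B"
    using aff A(1) B(1) affine_independent_subset by blast+
  note this[THEN extreme_point_of_convex_hull_affine_independent]
  moreover have "convex hull A = convex hull B" using A(2) B(2) by simp
  ultimately have "A = B" by (intro set_eqI) metis
  then have "A \<subseteq> \<rho> ` F \<inter> \<rho> ` G" using A B by blast
  also have "\<dots> = \<rho> ` (F \<inter> G)"
    by (rule inj_on_image_Int[OF inj, symmetric]) (use assms(2,3) in auto)
  finally show "cell \<rho> F \<inter> cell \<rho> G \<subseteq> cell \<rho> (F \<inter> G)"
    using A(2) hull_mono[of A "\<rho> ` (F \<inter> G)" convex] by (simp add: cell_def)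
  show "cell \<rho> (F \<inter> G) \<subseteq> cell \<rho> F \<inter> cell \<rho> G"
    unfolding cell_def by (simp add: hull_mono image_mono)
qed

lemma carrier_face_props:
  assumes t: "triangulates \<Delta> \<delta> \<Gamma> \<gamma>" and G: "G \<in> \<Delta>"
  defines "c \<equiv> carrier_face \<delta> \<Gamma> \<gamma> G"
  shows "c \<in> \<Gamma>" "cell \<delta> G \<subseteq> cell \<gamma> c"
    and "\<And>F. F \<in> \<Gamma> \<Longrightarrow> cell \<delta> G \<subseteq> cell \<gamma> F \<Longrightarrow> c \<subseteq> F"
proof -
  define S where "S = {F\<in>\<Gamma>. cell \<delta> G \<subseteq> cell \<gamma> F}"
  let ?P = "\<lambda>F. F \<in> \<Gamma> \<and> cell \<delta> G \<subseteq> cell \<gamma> F \<and>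
        (\<forall>F'\<in>\<Gamma>. cell \<delta> G \<subseteq> cell \<gamma> F' \<longrightarrow> F \<subseteq> F')"
  have ac: "abstract_complex \<Gamma>" and r: "geometric_realization \<Gamma> \<gamma>"
    and "S \<noteq> {}" using t G by (auto simp: triangulates_def S_def)
  then obtain F where F: "F \<in> S" and min: "\<And>F'. F' \<in> S \<Longrightarrow> card F \<le> card F'"
    using ex_has_least_nat[of "\<lambda>F. F \<in> S" _ card] by (metis ex_in_conv)
  have "F \<subseteq> F'" if F': "F' \<in> S" for F'
  proof -
    have "F \<inter> F' \<in> \<Gamma>" "finite F"
      using F ac by (auto simp: S_def abstract_complex_def)
    then have "F \<inter> F' \<in> S"
      using F F' cell_Int[OF r, of F F'] by (auto simp: S_def)
    then have "F \<inter> F' = F"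
      by (intro card_seteq[OF \<open>finite F\<close>] min) auto
    then show ?thesis by blast
  qed
  then have "?P F" using F by (auto simp: S_def)
  then have "?P c" unfolding c_def carrier_face_def
    by (rule theI) (use \<open>?P F\<close> in blast)
  then show "c \<in> \<Gamma>" "cell \<delta> G \<subseteq> cell \<gamma> c"
    "\<And>F. F \<in> \<Gamma> \<Longrightarrow> cell \<delta> G \<subseteq> cell \<gamma> F \<Longrightarrow> c \<subseteq> F" by blast+
qed

lemma aff_dim_cell:
  assumes "geometric_realization K \<rho>" "F \<in> K"
  shows "aff_dim (cell \<rho> F) = int (card F) - 1"
proof -
  have "inj_on \<rho> F"
    by (rule inj_on_subset[of \<rho> "\<Union>K"]) (use assms in \<open>auto simp: geometric_realization_def\<close>)
  moreover have "\<not> affine_dependent (\<rho> ` F)"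
    using assms by (simp add: geometric_realization_def)
  ultimately show ?thesis
    using aff_dim_affine_independent[of "\<rho> ` F"]
    by (simp add: cell_def aff_dim_convex_hull card_image)
qed

lemma carrier_face_trans:
  assumes t: "triangulates \<Delta> \<delta> \<Gamma> \<gamma>" and t': "triangulates \<Gamma> \<gamma> K \<kappa>" and G: "G \<in> \<Delta>"
  shows "triangulates \<Delta> \<delta> K \<kappa>"
    and "carrier_face \<delta> K \<kappa> G = (carrier_face \<gamma> K \<kappa> \<circ> carrier_face \<delta> \<Gamma> \<gamma>) G"
proof -
  have "\<exists>F\<in>K. cell \<delta> G \<subseteq> cell \<kappa> F" if "G \<in> \<Delta>" for G
  proof -
    obtain H where "H \<in> \<Gamma>" "cell \<delta> G \<subseteq> cell \<gamma> H"
      using t \<open>G \<in> \<Delta>\<close> unfolding triangulates_def by blast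
    moreover then obtain F where "F \<in> K" "cell \<gamma> H \<subseteq> cell \<kappa> F"
      using t' unfolding triangulates_def by blast
    ultimately show ?thesis by blast
  qed
  then show t'': "triangulates \<Delta> \<delta> K \<kappa>"
    using t t' unfolding triangulates_def by simp
  let ?c = "carrier_face \<delta> \<Gamma> \<gamma> G" and ?d = "carrier_face \<delta> K \<kappa> G"
  note c = carrier_face_props[OF t G] and d = carrier_face_props[OF t'' G]
  note e = carrier_face_props[OF t' c(1)]
  let ?e = "carrier_face \<gamma> K \<kappa> ?c"
  have r: "geometric_realization \<Gamma> \<gamma>" "geometric_realization K \<kappa>"
    and cpx: "abstract_complex \<Gamma>"
    using t t' by (simp_all add: triangulates_def)
  have "?d \<subseteq> ?e"
    by (rule d(3)[OF e(1) subset_trans[OF c(2) e(2)]])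
  moreover have "?e \<subseteq> ?d"
  proof (rule e(3)[OF d(1)])
    show "cell \<gamma> ?c \<subseteq> cell \<kappa> ?d"
    proof (cases "G = {}")
      case True
      then have "?c = {}"
        using c(3)[of "{}"] cpx by (auto simp: cell_def abstract_complex_def)
      then show ?thesis by (simp add: cell_def)
    next
      case False
      then have "rel_interior (cell \<delta> G) \<noteq> {}"
        by (simp add: cell_def rel_interior_eq_empty)
      then obtain x where x: "x \<in> rel_interior (cell \<delta> G)" by blast
      then have xG: "x \<in> cell \<delta> G" using rel_interior_subset by blast
      have aff: "\<not> affine_dependent (\<gamma> ` ?c)"
        using r(1) c(1) by (simp add: geometric_realization_def)
      have fin: "finite (\<gamma> ` ?c)" using aff by (rule aff_independent_finite)
      have "x \<in> rel_interior (cell \<gamma> ?c)"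
      proof (rule ccontr)
        assume "x \<notin> rel_interior (cell \<gamma> ?c)"
        then have "x \<in> rel_frontier (cell \<gamma> ?c)"
          using subsetD[OF closure_subset subsetD[OF c(2) xG]] by (simp add: rel_frontier_def)
        moreover have "polyhedron (cell \<gamma> ?c)"
          using fin by (simp add: cell_def polytope_convex_hull polytope_imp_polyhedron)
        ultimately obtain T where T: "T face_of cell \<gamma> ?c" "T \<noteq> cell \<gamma> ?c" "x \<in> T"
          by (simp add: rel_frontier_of_polyhedron_alt) blast
        obtain A where A: "A \<subseteq> \<gamma> ` ?c" "T = convex hull A"
          using face_of_convex_hull_subset[OF finite_imp_compact[OF fin] T(1)[unfolded cell_def]] .
        then obtain H where H: "H \<subseteq> ?c" "A = \<gamma> ` H" by (meson subset_imageE)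
        have "cell \<delta> G \<subseteq> T"
          by (rule subset_of_face_of[OF T(1) c(2)]) (use T(3) x in blast)
        then have "cell \<delta> G \<subseteq> cell \<gamma> H" using A H by (simp add: cell_def)
        moreover have "H \<in> \<Gamma>" using H(1) c(1) cpx by (auto simp: abstract_complex_def)
        ultimately have "?c \<subseteq> H" using c(3) by blast
        then have "H = ?c" using H(1) by blast
        then show False using T(2) A H by (simp add: cell_def)
      qed
      moreover have "x \<in> cell \<kappa> (?d \<inter> ?e)"
        using subsetD[OF d(2) xG] subsetD[OF e(2) subsetD[OF c(2) xG]]
        by (simp flip: cell_Int[OF r(2) d(1) e(1)])
      moreover have "cell \<kappa> (?d \<inter> ?e) face_of cell \<kappa> ?e"
      proof -
        have "simplicial_complex (cell \<kappa> ` K)"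
          using r(2) by (simp add: geometric_realization_def)
        then have "cell \<kappa> ?e \<inter> cell \<kappa> ?d face_of cell \<kappa> ?e"
          using d(1) e(1) unfolding simplicial_complex_def by blast
        then show ?thesis using cell_Int[OF r(2) d(1) e(1)] by (simp add: Int_commute)
      qed
      ultimately have "cell \<gamma> ?c \<subseteq> cell \<kappa> (?d \<inter> ?e)"
        by (intro subset_of_face_of[OF _ e(2)]) auto
      also have "\<dots> \<subseteq> cell \<kappa> ?d"
        unfolding cell_def by (simp add: hull_mono image_mono)
      finally show ?thesis .
    qed
  qed
  ultimately show "?d = (carrier_face \<gamma> K \<kappa> \<circ> carrier_face \<delta> \<Gamma> \<gamma>) G" by auto
qed

lemma rank_triangulation_simplex:
  assumes t: "triangulates \<Delta> \<delta> (Pow U) \<gamma>"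
  shows "rank_cpx \<Delta> = card U"
proof -
  have r: "geometric_realization \<Delta> \<delta>" "geometric_realization (Pow U) \<gamma>"
    and cpx: "abstract_complex \<Delta>" and un: "\<Union>(cell \<delta> ` \<Delta>) = \<Union>(cell \<gamma> ` Pow U)"
    using t unfolding triangulates_def by argo+
  have "cell \<gamma> F \<subseteq> cell \<gamma> U" if "F \<subseteq> U" for F
    using that unfolding cell_def by (simp add: hull_mono image_mono)
  then have "\<Union>(cell \<gamma> ` Pow U) = cell \<gamma> U" by blast
  then have eq: "\<Union>(cell \<delta> ` \<Delta>) = cell \<gamma> U" using un by simp
  have dimU: "aff_dim (cell \<gamma> U) = int (card U) - 1"
    using aff_dim_cell[OF r(2)] by blast
  have le: "card G \<le> card U" if "G \<in> \<Delta>" for G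
  proof -
    have "cell \<delta> G \<subseteq> cell \<gamma> U" using eq that by blast
    then show ?thesis
      using aff_dim_subset[of "cell \<delta> G" "cell \<gamma> U"] dimU aff_dim_cell[OF r(1) that] by simp
  qed
  have "\<exists>G\<in>\<Delta>. card G = card U"
  proof (cases "cell \<gamma> U = {}")
    case True
    then have "card U = 0" using dimU by simp
    moreover have "{} \<in> \<Delta>" using cpx by (simp add: abstract_complex_def)
    ultimately show ?thesis by (intro bexI[of _ "{}"]) auto
  next
    case False
    have "\<Union>{C \<in> cell \<delta> ` \<Delta>. aff_dim C = aff_dim (cell \<gamma> U)} = cell \<gamma> U"
    proof (rule convex_Union_fulldim_cells[OF _ _ _ eq])
      show "finite (cell \<delta> ` \<Delta>)" using cpx by (simp add: abstract_complex_def)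
      show "closed C" if C: "C \<in> cell \<delta> ` \<Delta>" for C
      proof -
        obtain G where "G \<in> \<Delta>" "C = cell \<delta> G" using C by auto
        moreover have "finite G" using cpx \<open>G \<in> \<Delta>\<close> by (simp add: abstract_complex_def)
        ultimately show ?thesis
          by (simp add: cell_def finite_imp_compact compact_convex_hull compact_imp_closed)
      qed
      show "convex C" if "C \<in> cell \<delta> ` \<Delta>" for C
        using that by (auto simp: cell_def)
      show "convex (cell \<gamma> U)" by (simp add: cell_def)
    qed
    moreover obtain x where "x \<in> cell \<gamma> U" using False by blast
    ultimately have "x \<in> \<Union>{C \<in> cell \<delta> ` \<Delta>. aff_dim C = aff_dim (cell \<gamma> U)}" by simp
    then obtain G where "G \<in> \<Delta>" "aff_dim (cell \<delta> G) = aff_dim (cell \<gamma> U)" by auto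
    then show ?thesis using aff_dim_cell[OF r(1) \<open>G \<in> \<Delta>\<close>] dimU by (intro bexI[of _ G]) auto
  qed
  then obtain G where "G \<in> \<Delta>" "card G = card U" by blast
  moreover have "finite \<Delta>" using cpx by (simp add: abstract_complex_def)
  ultimately show ?thesis
    unfolding rank_cpx_def by (intro Max_eqI) (use le in \<open>auto intro: rev_image_eqI\<close>)
qed

lemma h_poly_uniform_simplex:
  assumes u: "uniform_triangulation f \<Delta> \<delta> (Pow U) \<gamma>"
  shows "h_poly \<Delta> = h_simplex f (card U)"
proof -
  have t: "triangulates \<Delta> \<delta> (Pow U) \<gamma>" using u by (simp add: uniform_triangulation_def)
  have "restriction \<Delta> (carrier_face \<delta> (Pow U) \<gamma>) U = \<Delta>"
    using carrier_face_props(1)[OF t] by (auto simp: restriction_def)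
  then have "face_num \<Delta> i = f i (card U)" if "i \<le> card U" for i
    using u that unfolding uniform_triangulation_def by (metis Pow_top)
  then show ?thesis
    by (simp add: h_poly_def h_simplex_def h_of_f_def rank_triangulation_simplex[OF t])
qed

end

theory Submission
  imports Defs "HOL-Library.Function_Algebras" "HOL-Computational_Algebra.Polynomial_FPS"
begin

text \<open>
  Homogenising a triangulation \<open>\<Gamma>\<close> of the simplex on \<open>V\<close> gives a simplicial fan that subdivides the
  cone over the simplex. The face ring of the fan, realised as a ring of piecewise polynomial
  functions, is a module over the polynomial ring in \<open>V\<close>, the variable of \<open>v \<in> V\<close> acting by the
  barycentric coordinate of \<open>v\<close>. This module is free. For a fan which is regular, that is, carries a
  strictly convex piecewise linear function, a line shelling provides a basis. An arbitrary fan
  becomes regular after finitely many stellar subdivisions of edges, placed where edges cross the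
  hyperplanes spanned by the walls of the original cones, and freeness descends along each of them, because
  the face ring is embedded in that of the subdivision as a direct summand.

  The restrictions to the faces \<open>F \<subseteq> V\<close> are free too, so bases can be built by induction on \<open>F\<close> that are
  compatible with restriction: a basis over \<open>F\<close> is a disjoint union, over \<open>K \<subseteq> F\<close>, of sets of elements
  that vanish on all faces not containing \<open>K\<close>. As the basis over \<open>F\<close> has the degree distribution
  \<open>h(\<Gamma>\<^sub>F)\<close>, Moebius inversion shows that the coefficients of \<open>\<ell>\<^sub>K(\<Gamma>\<^sub>K)\<close> count the \<open>K\<close>-th set.

  For the expansion, let \<open>S\<close> be an umbra, \<open>S\<^sup>m\<close> standing for the \<open>h\<close>-polynomial of the uniformly
  triangulated \<open>(m-1)\<close>-simplex. Then \<open>p\<^sub>m\<^sub>,\<^sub>j = S\<^sup>m\<^sup>-\<^sup>j (S + x - 1)\<^sup>j\<close>, and the formula is the image under the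
  umbra of the homogeneous identity between \<open>h\<close>- and \<open>f\<close>-polynomials of the \<open>\<Gamma>\<^sub>F\<close>.
\<close>

section \<open>Linear independence modulo a subspace\<close>

text \<open>Regularity cannot be assumed of \<open>\<Gamma>\<close>, and neither regularity nor
  shellability descends from a subdivision, so the property carried along has to be algebraic. It is
  expressed by counting: the Hilbert function of a face ring is fixed by the face numbers, so it is
  enough to bound the number of generators in each degree by the \<open>h\<close>-number, and
  equality of the counts then gives linear independence. Functions are evaluated at points with
  coordinates of arbitrary sign: \<open>pts\<close> consists of whole coordinate subspaces, not of
  orthants. The map belonging to a stellar subdivision is therefore generically two-to-one over the
  faces containing the edge, and comparing the two values shows that the two summands of the
  subdivided ring meet only in \<open>0\<close>. The obstacle to compatible bases is that an element
  attached to \<open>K\<close> must vanish on every face not containing \<open>K\<close>, not merely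
  on the boundary of \<open>K\<close>; it is met by subtracting expansions over smaller faces, in
  which all products of smaller support have coefficient \<open>0\<close>. A uniform triangulation
  of \<open>\<Gamma>\<close> may use another realization of \<open>\<Gamma>\<close> than the one
  subdividing the simplex, so the two are linked through carriers only.\<close>

definition indep_mod :: "'m::real_vector set \<Rightarrow> 'b set \<Rightarrow> ('b \<Rightarrow> 'm) \<Rightarrow> bool" where
  "indep_mod T I f \<longleftrightarrow> (\<forall>c. (\<Sum>b\<in>I. c b *\<^sub>R f b) \<in> T \<longrightarrow> (\<forall>b\<in>I. c b = 0))"

lemma indep_modD: "indep_mod T I f \<Longrightarrow> (\<Sum>b\<in>I. c b *\<^sub>R f b) \<in> T \<Longrightarrow> b \<in> I \<Longrightarrow> c b = 0"
  by (auto simp: indep_mod_def)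

lemma indep_modI: "(\<And>c b. (\<Sum>b\<in>I. c b *\<^sub>R f b) \<in> T \<Longrightarrow> b \<in> I \<Longrightarrow> c b = 0) \<Longrightarrow> indep_mod T I f"
  by (auto simp: indep_mod_def)

lemma indep_mod_mono: "indep_mod T I f \<Longrightarrow> S \<subseteq> T \<Longrightarrow> indep_mod S I f"
  unfolding indep_mod_def by (meson subsetD)

lemma indep_mod_subset:
  assumes "indep_mod T I f" "J \<subseteq> I" "finite I"
  shows "indep_mod T J f"
proof (rule indep_modI)
  fix c b assume c: "(\<Sum>b\<in>J. c b *\<^sub>R f b) \<in> T" and b: "b \<in> J"
  have "(\<Sum>b\<in>I. (if b \<in> J then c b else 0) *\<^sub>R f b) = (\<Sum>b\<in>J. c b *\<^sub>R f b)"
    using assms by (intro sum.mono_neutral_cong_right) auto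
  then show "c b = 0"
    using indep_modD[OF assms(1), of "\<lambda>b. if b \<in> J then c b else 0" b] c b assms(2) by auto
qed

lemma in_span_image:
  fixes f :: "'b \<Rightarrow> 'm::real_vector"
  assumes "finite I"
  shows "x \<in> span (f ` I) \<longleftrightarrow> (\<exists>c. x = (\<Sum>b\<in>I. c b *\<^sub>R f b))"
proof
  assume "x \<in> span (f ` I)"
  then show "\<exists>c. x = (\<Sum>b\<in>I. c b *\<^sub>R f b)"
  proof (induction rule: span_induct_alt)
    case base
    show ?case by (rule exI[of _ "\<lambda>_. 0"]) simp
  next
    case (step r y z)
    then obtain b c where "b \<in> I" "y = f b" "z = (\<Sum>b\<in>I. c b *\<^sub>R f b)" by auto
    then have "r *\<^sub>R y + z = (\<Sum>x\<in>I. (c x + (if x = b then r else 0)) *\<^sub>R f x)"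
      using assms by (simp add: scaleR_add_left sum.distrib if_distrib[of "\<lambda>r. r *\<^sub>R _"] cong: if_cong)
    then show ?case by (intro exI[of _ "\<lambda>x. c x + (if x = b then r else 0)"])
  qed
next
  assume "\<exists>c. x = (\<Sum>b\<in>I. c b *\<^sub>R f b)"
  then obtain c where "x = (\<Sum>b\<in>I. c b *\<^sub>R f b)" by blast
  moreover have "(\<Sum>b\<in>I. c b *\<^sub>R f b) \<in> span (f ` I)"
    by (intro span_sum span_scale span_base) simp
  ultimately show "x \<in> span (f ` I)" by simp
qed

text \<open>Independence is a property of indexed families, where a repeated vector already counts
  as a relation; injectivity accounts for the difference from independence of sets.\<close>

lemma indep_mod_0_iff:
  assumes "finite I"
  shows "indep_mod {0} I f \<longleftrightarrow> inj_on f I \<and> independent (f ` I)"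
proof
  assume i: "indep_mod {0} I f"
  have inj: "inj_on f I"
  proof (rule inj_onI, rule ccontr)
    fix x y assume xy: "x \<in> I" "y \<in> I" "f x = f y" "x \<noteq> y"
    let ?c = "\<lambda>b. (if b = x then 1 else 0) - (if b = y then 1 else (0::real))"
    have "(\<Sum>b\<in>I. ?c b *\<^sub>R f b) = f x - f y"
      using assms xy by (simp add: scaleR_diff_left sum_subtractf if_distrib[of "\<lambda>r. r *\<^sub>R _"] cong: if_cong)
    then have "?c x = 0" using indep_modD[OF i, of ?c x] xy by simp
    then show False using xy by simp
  qed
  moreover have "independent (f ` I)"
    unfolding real_vector.independent_explicit_finite_subsets
  proof (intro allI impI ballI)
    fix A u v
    assume A: "A \<subseteq> f ` I" and fA: "finite A" and s: "(\<Sum>v\<in>A. u v *\<^sub>R v) = 0" and v: "v \<in> A"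
    define J where "J = {b\<in>I. f b \<in> A}"
    have fJ: "f ` J = A" and iJ: "inj_on f J"
      using A inj by (auto simp: J_def intro: inj_on_subset)
    have "(\<Sum>b\<in>J. u (f b) *\<^sub>R f b) = 0"
      using s sum.reindex[OF iJ, of "\<lambda>v. u v *\<^sub>R v"] fJ by simp
    moreover have "indep_mod {0} J f" using i assms by (rule_tac indep_mod_subset) (auto simp: J_def)
    moreover obtain b where "b \<in> J" "f b = v" using v fJ by auto
    ultimately show "u v = 0" using indep_modD[of "{0}" J f "\<lambda>b. u (f b)" b] by simp
  qed
  ultimately show "inj_on f I \<and> independent (f ` I)" by simp
next
  assume "inj_on f I \<and> independent (f ` I)"
  then have inj: "inj_on f I" and ind: "independent (f ` I)" by auto
  show "indep_mod {0} I f"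
  proof (rule indep_modI)
    fix c b assume s: "(\<Sum>b\<in>I. c b *\<^sub>R f b) \<in> {0}" and b: "b \<in> I"
    let ?u = "\<lambda>v. c (the_inv_into I f v)"
    have "(\<Sum>v\<in>f ` I. ?u v *\<^sub>R v) = (\<Sum>b\<in>I. c b *\<^sub>R f b)"
      using inj by (subst sum.reindex) (auto intro!: sum.cong simp: the_inv_into_f_f)
    then have "(\<Sum>v\<in>f ` I. ?u v *\<^sub>R v) = 0" using s by simp
    moreover have "\<forall>u. (\<Sum>v\<in>f ` I. u v *\<^sub>R v) = 0 \<longrightarrow> (\<forall>v\<in>f ` I. u v = 0)"
      using ind assms unfolding real_vector.independent_explicit_finite_subsets by blast
    ultimately have "\<forall>v\<in>f ` I. ?u v = 0" by (rule_tac mp) (erule allE)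
    then have "?u (f b) = 0" using b by blast
    then show "c b = 0" using inj b by (simp add: the_inv_into_f_f)
  qed
qed

lemma indep_mod_0_dim:
  assumes "finite I" "indep_mod {0} I f"
  shows "dim (span (f ` I)) = card I"
  using assms by (simp add: indep_mod_0_iff real_vector.dim_eq_card_independent card_image)

text \<open>A maximal independent subset of the image already needs \<open>card I\<close> members,
  which leaves no room for a repetition or a redundant vector.\<close>

lemma indep_mod_0_of_dim:
  assumes I: "finite I" and d: "card I \<le> dim (span (f ` I))"
  shows "indep_mod {0} I f"
proof -
  obtain B where B: "B \<subseteq> f ` I" "independent B" "span B = span (f ` I)"
    by (metis real_vector.maximal_independent_subset real_vector.span_eq real_vector.span_superset subset_trans)
  have "finite B" using B(1) I finite_subset by blast
  have "dim (span (f ` I)) = card B"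
    using B by (metis real_vector.dim_span real_vector.dim_eq_card_independent)
  moreover have "card B \<le> card (f ` I)" using B(1) I by (simp add: card_mono)
  moreover have "card (f ` I) \<le> card I" using I by (rule card_image_le)
  ultimately have "card (f ` I) = card I" "card B = card (f ` I)" using d by linarith+
  then have "inj_on f I" "B = f ` I"
    using I B(1) by (auto simp: eq_card_imp_inj_on card_subset_eq)
  then show ?thesis using B(2) I by (simp add: indep_mod_0_iff)
qed

lemma indep_mod_insert:
  assumes i: "indep_mod T N f" and N: "finite N" and z: "z \<notin> N" "f z \<notin> span (T \<union> f ` N)"
  shows "indep_mod T (insert z N) f"
proof (rule indep_modI)
  fix c b assume c: "(\<Sum>b\<in>insert z N. c b *\<^sub>R f b) \<in> T" and b: "b \<in> insert z N"
  let ?s = "\<Sum>b\<in>N. c b *\<^sub>R f b"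
  have s: "c z *\<^sub>R f z + ?s \<in> T" using c N z by simp
  have "?s \<in> span (T \<union> f ` N)" by (intro span_sum span_scale span_base) simp
  with s have "c z *\<^sub>R f z \<in> span (T \<union> f ` N)"
    by (metis UnI1 add_diff_cancel_right' span_base span_diff)
  then have cz: "c z = 0" using z(2)
    by (metis real_vector.scale_left_imp_eq real_vector.scale_one real_vector.scale_scale span_scale
        left_inverse)
  then have "?s \<in> T" using s by simp
  then show "c b = 0" using indep_modD[OF i, of c b] cz b by auto
qed

text \<open>A finite spanning set bounds the size of the independent subfamilies, so one of maximal
  size exists; by \<open>indep_mod_insert\<close> it cannot miss any vector of the family.\<close>

lemma complement_exists:
  fixes f :: "'b \<Rightarrow> 'm::real_vector"
  assumes T: "subspace T" and fin: "finite F" "f ` Z \<subseteq> span F"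
  shows "\<exists>N\<subseteq>Z. finite N \<and> indep_mod T N f \<and> f ` Z \<subseteq> span (T \<union> f ` N)"
proof -
  let ?P = "\<lambda>N. N \<subseteq> Z \<and> finite N \<and> indep_mod T N f"
  have bd: "card N \<le> card F" if "?P N" for N
  proof -
    have "indep_mod {0} N f"
      using that T by (metis indep_mod_mono subspace_0 empty_subsetI insert_subset)
    then have "inj_on f N" "independent (f ` N)" using that by (auto simp: indep_mod_0_iff)
    then show ?thesis
      using real_vector.independent_span_bound[OF fin(1), of "f ` N"] that fin(2)
      by (metis card_image image_mono subset_trans)
  qed
  have "?P {}" by (simp add: indep_mod_def)
  then have "\<exists>N. ?P N \<and> (\<forall>N'. ?P N' \<longrightarrow> card N' \<le> card N)"
    by (rule ex_has_greatest_nat[where P = ?P and f = card and b = "Suc (card F)"])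
      (intro allI impI le_imp_less_Suc bd)
  then obtain N where N: "?P N" and max: "\<And>N'. ?P N' \<Longrightarrow> card N' \<le> card N"
    by blast
  have "f z \<in> span (T \<union> f ` N)" if z: "z \<in> Z" for z
  proof (rule ccontr)
    assume nz: "f z \<notin> span (T \<union> f ` N)"
    then have "z \<notin> N" by (auto intro: span_base)
    moreover have "?P (insert z N)" using indep_mod_insert[OF _ _ \<open>z \<notin> N\<close> nz] N z by auto
    ultimately show False using max[of "insert z N"] N by simp
  qed
  then show ?thesis using N by blast
qed

text \<open>Exchange in the quotient by \<open>T\<close>, done without quotients: a basis
  \<open>B\<close> of \<open>T\<close> and the family over \<open>I\<close> are jointly independent
  inside the span of \<open>B\<close> and \<open>D\<close>, and \<open>card B\<close> cancels from
  the resulting inequality.\<close>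

lemma indep_mod_card_le:
  fixes f :: "'b \<Rightarrow> 'm::real_vector"
  assumes i: "indep_mod T I f" "finite I" "subspace T" and F: "finite F" "T \<subseteq> span F"
    and D: "finite D" "f ` I \<subseteq> span (T \<union> D)"
  shows "card I \<le> card D"
proof -
  obtain B where B: "B \<subseteq> T" "independent B" "T \<subseteq> span B"
    using real_vector.maximal_independent_subset by metis
  have finB: "finite B" using real_vector.independent_span_bound[OF F(1) B(2)] B F by blast
  have i0: "indep_mod {0} I f" using i by (metis indep_mod_mono subspace_0 empty_subsetI insert_subset)
  define g where "g = (\<lambda>s. case s of Inl b \<Rightarrow> b | Inr x \<Rightarrow> f x)"
  have "indep_mod {0} (B <+> I) g"
  proof (rule indep_modI)
    fix c b assume s: "(\<Sum>b\<in>B <+> I. c b *\<^sub>R g b) \<in> {0}" and b: "b \<in> B <+> I"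
    have eq: "(\<Sum>b\<in>B. c (Inl b) *\<^sub>R b) + (\<Sum>x\<in>I. c (Inr x) *\<^sub>R f x) = 0"
      using s finB i(2) by (simp add: sum.Plus g_def o_def)
    have BT: "(\<Sum>b\<in>B. c (Inl b) *\<^sub>R b) \<in> T"
      using B(1) i(3) by (auto intro!: subspace_sum subspace_scale)
    have "(\<Sum>x\<in>I. c (Inr x) *\<^sub>R f x) = - (\<Sum>b\<in>B. c (Inl b) *\<^sub>R b)"
      using eq by (simp add: eq_neg_iff_add_eq_0 add.commute)
    then have "(\<Sum>x\<in>I. c (Inr x) *\<^sub>R f x) \<in> T" using BT i(3) by (simp add: subspace_neg)
    then have cI: "c (Inr x) = 0" if "x \<in> I" for x
      using indep_modD[OF i(1), of "\<lambda>x. c (Inr x)"] that by blast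
    then have "(\<Sum>b\<in>B. c (Inl b) *\<^sub>R b) = 0" using eq by simp
    then have "c (Inl b) = 0" if "b \<in> B" for b
      using B(2) finB that unfolding real_vector.independent_explicit_finite_subsets
      by (meson order_refl)
    then show "c b = 0" using cI b by auto
  qed
  then have g: "inj_on g (B <+> I)" "independent (g ` (B <+> I))"
    using finB i(2) by (auto simp: indep_mod_0_iff)
  have "T \<union> D \<subseteq> span (B \<union> D)"
    using B(3) by (metis Un_least Un_upper1 Un_upper2 real_vector.span_mono real_vector.span_superset subset_trans)
  then have "span (T \<union> D) \<subseteq> span (B \<union> D)" by (simp add: real_vector.span_minimal)
  then have "g ` (B <+> I) \<subseteq> span (B \<union> D)"
    using D(2) by (auto simp: g_def image_subset_iff subset_eq intro: span_base)
  then have "card (g ` (B <+> I)) \<le> card (B \<union> D)"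
    using real_vector.independent_span_bound[of "B \<union> D", OF _ g(2)] finB D(1) by simp
  also have "card (g ` (B <+> I)) = card B + card I"
    using g(1) finB i(2) by (simp add: card_image card_Plus)
  finally show ?thesis using card_Un_le[of B D] by linarith
qed

section \<open>Graded modules over a polynomial ring\<close>

definition multi_idx :: "'v set \<Rightarrow> nat \<Rightarrow> ('v \<Rightarrow> nat) set" where
  "multi_idx V k = {\<alpha>. (\<forall>v. v \<notin> V \<longrightarrow> \<alpha> v = 0) \<and> sum \<alpha> V = k}"

definition mpow :: "('v \<Rightarrow> 'm::comm_monoid_mult) \<Rightarrow> 'v set \<Rightarrow> ('v \<Rightarrow> nat) \<Rightarrow> 'm" where
  "mpow \<theta> V \<alpha> = (\<Prod>v\<in>V. \<theta> v ^ \<alpha> v)"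

lemma finite_multi_idx:
  assumes "finite V" shows "finite (multi_idx V k)"
proof (rule finite_subset)
  show "multi_idx V k \<subseteq> {\<alpha>. \<forall>v. (v \<in> V \<longrightarrow> \<alpha> v \<in> {..k}) \<and> (v \<notin> V \<longrightarrow> \<alpha> v = 0)}"
    using assms member_le_sum[of _ V] by (fastforce simp: multi_idx_def)
  show "finite {\<alpha>. \<forall>v. (v \<in> V \<longrightarrow> \<alpha> v \<in> {..k}) \<and> (v \<notin> V \<longrightarrow> \<alpha> v = 0)}"
    using assms by (intro finite_set_of_finite_funs) auto
qed

lemma multi_idx_0 [simp]: "finite V \<Longrightarrow> multi_idx V 0 = {\<lambda>_. 0}"
  by (auto simp: multi_idx_def fun_eq_iff)

lemma mpow_0 [simp]: "mpow \<theta> V (\<lambda>_. 0) = 1"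
  by (simp add: mpow_def)

lemma multi_idx_inc:
  assumes "finite V" "v \<in> V" "\<alpha> \<in> multi_idx V k"
  shows "\<alpha>(v := Suc (\<alpha> v)) \<in> multi_idx V (Suc k)"
  using assms by (auto simp: multi_idx_def sum.remove[of V v])

lemma mpow_inc:
  assumes "finite V" "v \<in> V"
  shows "mpow \<theta> V (\<alpha>(v := Suc (\<alpha> v))) = \<theta> v * mpow \<theta> V \<alpha>"
proof -
  have "(\<Prod>u\<in>V - {v}. \<theta> u ^ (\<alpha>(v := Suc (\<alpha> v))) u) = (\<Prod>u\<in>V - {v}. \<theta> u ^ \<alpha> u)"
    by (rule prod.cong) auto
  then show ?thesis using assms by (simp add: mpow_def prod.remove[of V v] mult.assoc)
qed

lemma multi_idx_pos:
  assumes "finite V" "\<alpha> \<in> multi_idx V (Suc k)"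
  obtains v \<beta> where "v \<in> V" "\<beta> \<in> multi_idx V k" "\<alpha> = \<beta>(v := Suc (\<beta> v))"
proof -
  have s: "sum \<alpha> V = Suc k" using assms by (simp add: multi_idx_def)
  then have "\<exists>v\<in>V. \<alpha> v \<noteq> 0" by (metis nat.distinct(1) sum.neutral)
  then obtain v where v: "v \<in> V" "\<alpha> v \<noteq> 0" by blast
  define \<beta> where "\<beta> = \<alpha>(v := \<alpha> v - 1)"
  have "sum \<alpha> V = \<alpha> v + sum \<alpha> (V - {v})" using assms(1) v by (simp add: sum.remove)
  moreover have "sum \<beta> V = (\<alpha> v - 1) + sum \<alpha> (V - {v})"
    using assms(1) v by (simp add: sum.remove[of V v] \<beta>_def)
  ultimately have "sum \<beta> V = k" using s v by simp
  then have "\<beta> \<in> multi_idx V k" using assms v by (auto simp: multi_idx_def \<beta>_def)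
  moreover have "\<alpha> = \<beta>(v := Suc (\<beta> v))" using v by (auto simp: \<beta>_def)
  ultimately show ?thesis using that v by blast
qed

text \<open>The part of degree \<open>j\<close> of the submodule generated by all products with a
  parameter. A minimal system of generators is a basis of a complement to it in each degree. Nothing
  lies below degree \<open>0\<close>, hence the case distinction.\<close>

definition low :: "'v set \<Rightarrow> ('v \<Rightarrow> 'm::{real_algebra_1,comm_ring_1}) \<Rightarrow> (nat \<Rightarrow> 'm set) \<Rightarrow> nat \<Rightarrow> 'm set" where
  "low V \<theta> M j = span (\<Union>v\<in>V. (*) (\<theta> v) ` (case j of 0 \<Rightarrow> {} | Suc i \<Rightarrow> M i))"

text \<open>Index set for the products of degree \<open>j\<close> of a monomial in the \<open>\<theta> v\<close> with a generator;
  \<open>C i\<close> indexes the generators of degree \<open>i\<close>, and \<open>fval\<close> is the product.\<close>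

definition fam :: "'v set \<Rightarrow> (nat \<Rightarrow> 'b set) \<Rightarrow> nat \<Rightarrow> (nat \<times> 'b \<times> ('v \<Rightarrow> nat)) set" where
  "fam V C j = (SIGMA i:{..j}. C i \<times> multi_idx V (j - i))"

definition fval :: "'v set \<Rightarrow> ('v \<Rightarrow> 'm::{real_algebra_1,comm_ring_1}) \<Rightarrow> ('b \<Rightarrow> 'm) \<Rightarrow> nat \<times> 'b \<times> ('v \<Rightarrow> nat) \<Rightarrow> 'm" where
  "fval V \<theta> f = (\<lambda>(i, b, \<alpha>). mpow \<theta> V \<alpha> * f b)"

lemma subspace_low: "subspace (low V \<theta> M j)"
  by (simp add: low_def)

lemma low_0: "low V \<theta> M 0 = {0}"
  by (simp add: low_def)

lemma low_Suc_iff: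
  assumes "finite V" "subspace (M i)"
  shows "x \<in> low V \<theta> M (Suc i) \<longleftrightarrow> (\<exists>m. (\<forall>v\<in>V. m v \<in> M i) \<and> x = (\<Sum>v\<in>V. \<theta> v * m v))"
proof
  assume "x \<in> low V \<theta> M (Suc i)"
  then have "x \<in> span (\<Union>v\<in>V. (*) (\<theta> v) ` M i)" by (simp add: low_def)
  then show "\<exists>m. (\<forall>v\<in>V. m v \<in> M i) \<and> x = (\<Sum>v\<in>V. \<theta> v * m v)"
  proof (induction rule: span_induct_alt)
    case base
    show ?case by (rule exI[of _ "\<lambda>_. 0"]) (simp add: subspace_0[OF assms(2)])
  next
    case (step r y z)
    then obtain v y' m where v: "v \<in> V" "y' \<in> M i" "y = \<theta> v * y'"
      and m: "\<forall>v\<in>V. m v \<in> M i" "z = (\<Sum>v\<in>V. \<theta> v * m v)" by auto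
    let ?m = "m(v := r *\<^sub>R y' + m v)"
    have "\<forall>u\<in>V. ?m u \<in> M i"
      using v m assms(2) by (auto intro: subspace_add subspace_scale)
    moreover have "(\<Sum>u\<in>V - {v}. \<theta> u * ?m u) = (\<Sum>u\<in>V - {v}. \<theta> u * m u)"
      by (rule sum.cong) auto
    then have "r *\<^sub>R y + z = (\<Sum>u\<in>V. \<theta> u * ?m u)"
      using v m assms(1) by (simp add: sum.remove[of V v] distrib_left)
    ultimately show ?case by blast
  qed
next
  assume "\<exists>m. (\<forall>v\<in>V. m v \<in> M i) \<and> x = (\<Sum>v\<in>V. \<theta> v * m v)"
  then obtain m where m: "\<forall>v\<in>V. m v \<in> M i" "x = (\<Sum>v\<in>V. \<theta> v * m v)" by blast
  have "\<theta> v * m v \<in> span (\<Union>v\<in>V. (*) (\<theta> v) ` M i)" if "v \<in> V" for v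
    using m(1) that by (intro span_base) blast
  then show "x \<in> low V \<theta> M (Suc i)" by (simp add: low_def m(2) span_sum)
qed

lemma finite_fam: "finite V \<Longrightarrow> (\<And>i. finite (C i)) \<Longrightarrow> finite (fam V C j)"
  by (auto simp: fam_def intro!: finite_SigmaI finite_multi_idx)

lemma card_fam:
  assumes "finite V" "\<And>i. finite (C i)"
  shows "card (fam V C j) = (\<Sum>i\<le>j. card (C i) * card (multi_idx V (j - i)))"
  using assms by (simp add: fam_def finite_multi_idx card_cartesian_product)

locale graded_module =
  fixes V :: "'v set" and \<theta> :: "'v \<Rightarrow> 'm::{real_algebra_1,comm_ring_1}" and M :: "nat \<Rightarrow> 'm set"
  assumes finV: "finite V" and sub: "\<And>j. subspace (M j)"
    and act: "\<And>v m j. v \<in> V \<Longrightarrow> m \<in> M j \<Longrightarrow> \<theta> v * m \<in> M (Suc j)"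
    and fin: "\<And>j. \<exists>F. finite F \<and> M j \<subseteq> span F"
begin

lemma low_subset: "low V \<theta> M j \<subseteq> M j"
  unfolding low_def by (rule span_minimal) (use act sub in \<open>auto split: nat.splits\<close>)

lemma mpow_act:
  assumes "\<alpha> \<in> multi_idx V k" "m \<in> M i"
  shows "mpow \<theta> V \<alpha> * m \<in> M (k + i)"
  using assms
proof (induction k arbitrary: \<alpha>)
  case 0
  then show ?case using finV by simp
next
  case (Suc k)
  then obtain v \<beta> where "v \<in> V" "\<beta> \<in> multi_idx V k" "\<alpha> = \<beta>(v := Suc (\<beta> v))"
    using multi_idx_pos finV by metis
  then show ?case using Suc.IH[of \<beta>] Suc.prems(2) finV act mpow_inc[of V v \<theta> \<beta>]
    by (simp add: mult.assoc del: fun_upd_apply)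
qed

lemma fval_in: 
  assumes "\<And>i. f ` C i \<subseteq> M i" "t \<in> fam V C j"
  shows "fval V \<theta> f t \<in> M j"
proof -
  obtain i b \<alpha> where t: "t = (i, b, \<alpha>)" "i \<le> j" "b \<in> C i" "\<alpha> \<in> multi_idx V (j - i)"
    using assms(2) by (auto simp: fam_def)
  moreover have "f b \<in> M i" using assms(1) t(3) by blast
  ultimately show ?thesis using mpow_act[of \<alpha> "j - i" "f b" i] by (simp add: fval_def)
qed

text \<open>Graded Nakayama lemma: an element of \<open>low\<close> is a combination of parameters
  times elements of one degree less, to which induction on the degree applies.\<close>

lemma span_fam:
  assumes "\<And>i. M i \<subseteq> span (low V \<theta> M i \<union> f ` C i)"
  shows "M j \<subseteq> span (fval V \<theta> f ` fam V C j)"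
proof (induction j)
  case 0
  have "f ` C 0 \<subseteq> fval V \<theta> f ` fam V C 0"
  proof
    fix x assume "x \<in> f ` C 0"
    then obtain b where "b \<in> C 0" "x = f b" by auto
    then show "x \<in> fval V \<theta> f ` fam V C 0"
      using finV by (intro image_eqI[of _ _ "(0, b, \<lambda>_. 0)"]) (auto simp: fam_def fval_def)
  qed
  then have "low V \<theta> M 0 \<union> f ` C 0 \<subseteq> span (fval V \<theta> f ` fam V C 0)"
    by (simp add: low_0 span_zero) (meson real_vector.span_superset subset_trans)
  then show ?case using assms[of 0] span_minimal[OF _ subspace_span] by blast
next
  case (Suc j)
  let ?S = "span (fval V \<theta> f ` fam V C (Suc j))"
  have "f ` C (Suc j) \<subseteq> ?S"
  proof
    fix x assume "x \<in> f ` C (Suc j)"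
    then obtain b where "b \<in> C (Suc j)" "x = f b" by auto
    then have "x \<in> fval V \<theta> f ` fam V C (Suc j)"
      using finV by (intro image_eqI[of _ _ "(Suc j, b, \<lambda>_. 0)"]) (auto simp: fam_def fval_def)
    then show "x \<in> ?S" by (rule span_base)
  qed
  moreover have "low V \<theta> M (Suc j) \<subseteq> ?S"
    unfolding low_def
  proof (rule span_minimal)
    show "(\<Union>v\<in>V. (*) (\<theta> v) ` (case Suc j of 0 \<Rightarrow> {} | Suc i \<Rightarrow> M i)) \<subseteq> ?S"
    proof clarsimp
      fix v m assume v: "v \<in> V" and m: "m \<in> M j"
      have "m \<in> span (fval V \<theta> f ` fam V C j)" using Suc m by blast
      then show "\<theta> v * m \<in> ?S"
      proof (induction rule: span_induct_alt)
        case base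
        show ?case by (simp add: span_zero)
      next
        case (step c x y)
        then obtain i b \<alpha> where t: "i \<le> j" "b \<in> C i" "\<alpha> \<in> multi_idx V (j - i)" "x = mpow \<theta> V \<alpha> * f b"
          by (auto simp: fam_def fval_def)
        have "\<theta> v * x = fval V \<theta> f (i, b, \<alpha>(v := Suc (\<alpha> v)))"
          using t v finV by (simp add: fval_def mpow_inc mult.assoc)
        moreover have "(i, b, \<alpha>(v := Suc (\<alpha> v))) \<in> fam V C (Suc j)"
          using t v finV multi_idx_inc[of V v \<alpha> "j - i"] by (simp add: fam_def Suc_diff_le)
        ultimately have "\<theta> v * x \<in> ?S" by (simp add: span_base)
        then have "c *\<^sub>R (\<theta> v * x) + \<theta> v * y \<in> ?S" using step by (intro span_add span_scale)
        then show ?case by (simp add: distrib_left)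
      qed
    qed
  qed simp
  ultimately have "low V \<theta> M (Suc j) \<union> f ` C (Suc j) \<subseteq> ?S" by blast
  then show ?case using assms[of "Suc j"] span_minimal[OF _ subspace_span] by blast
qed

lemma span_fam_eq:
  assumes "\<And>i. f ` C i \<subseteq> M i" "\<And>i. M i \<subseteq> span (low V \<theta> M i \<union> f ` C i)"
  shows "span (fval V \<theta> f ` fam V C j) = M j"
proof
  show "span (fval V \<theta> f ` fam V C j) \<subseteq> M j"
    by (rule span_minimal) (use fval_in[OF assms(1)] sub in auto)
  show "M j \<subseteq> span (fval V \<theta> f ` fam V C j)" by (rule span_fam[OF assms(2)])
qed

text \<open>The Hilbert series is \<open>(\<Sum>i. h i * t^i) / (1 - t)^card V\<close>.\<close>

definition hilbert :: "(nat \<Rightarrow> int) \<Rightarrow> bool" where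
  "hilbert h \<longleftrightarrow> (\<forall>j. int (dim (M j)) = (\<Sum>i\<le>j. h i * int (card (multi_idx V (j - i)))))"

text \<open>A squeeze: the products span \<open>M j\<close>, so there are at least
  \<open>dim (M j)\<close> of them, while the bounds on the generators allow at most that many.
  Equality makes them independent. The sums being compared are ordered term by term, so each term is
  an equality too, and the term \<open>i = j\<close> has factor \<open>1\<close>.\<close>

lemma fam_indep:
  assumes h: "hilbert h" and C: "\<And>i. finite (C i)" "\<And>i. int (card (C i)) \<le> h i"
    and s: "\<And>i. f ` C i \<subseteq> M i" "\<And>i. M i \<subseteq> span (low V \<theta> M i \<union> f ` C i)"
  shows "indep_mod {0} (fam V C j) (fval V \<theta> f)" "int (card (C j)) = h j"
proof -
  note sp = span_fam_eq[OF s, where j = j]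
  have ff: "finite (fam V C j)" using finite_fam[OF finV C(1)] .
  have "dim (M j) \<le> card (fam V C j)"
    using real_vector.dim_le_card[of "M j" "fval V \<theta> f ` fam V C j"] sp ff card_image_le[OF ff, of "fval V \<theta> f"]
    by (metis finite_imageI order_refl order_trans)
  moreover have cf: "int (card (fam V C j)) = (\<Sum>i\<le>j. int (card (C i)) * int (card (multi_idx V (j - i))))"
    by (simp add: card_fam[OF finV C(1)])
  moreover have le: "int (card (C i)) * int (card (multi_idx V (j - i))) \<le> h i * int (card (multi_idx V (j - i)))" for i
    using C(2) by (intro mult_right_mono) auto
  moreover have "(\<Sum>i\<le>j. int (card (C i)) * int (card (multi_idx V (j - i))))
      \<le> (\<Sum>i\<le>j. h i * int (card (multi_idx V (j - i))))"
    by (rule sum_mono) (rule le)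
  moreover have "int (dim (M j)) = (\<Sum>i\<le>j. h i * int (card (multi_idx V (j - i))))"
    using h by (simp add: hilbert_def)
  ultimately have "int (card (fam V C j)) = int (dim (M j))"
    and eq: "(\<Sum>i\<le>j. int (card (C i)) * int (card (multi_idx V (j - i)))) = (\<Sum>i\<le>j. h i * int (card (multi_idx V (j - i))))"
    by linarith+
  then show "indep_mod {0} (fam V C j) (fval V \<theta> f)"
    using indep_mod_0_of_dim[OF ff, of "fval V \<theta> f"] sp by simp
  have "int (card (C j)) * int (card (multi_idx V (j - j))) = h j * int (card (multi_idx V (j - j)))"
    by (rule sum_mono_inv[OF eq le]) auto
  then show "int (card (C j)) = h j" using finV by simp
qed

text \<open>The dimension formula is triangular in the numbers of generators, with diagonal entry
  \<open>1\<close> (the only monomial of degree \<open>0\<close>), so it determines them by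
  induction on the degree.\<close>

lemma card_of_indep:
  assumes h: "hilbert h" and C: "\<And>i. finite (C i)"
    and s: "\<And>i. f ` C i \<subseteq> M i" "\<And>i. M i \<subseteq> span (low V \<theta> M i \<union> f ` C i)"
    and ind: "\<And>j. indep_mod {0} (fam V C j) (fval V \<theta> f)"
  shows "int (card (C j)) = h j"
proof (induction j rule: less_induct)
  case (less j)
  have "dim (M j) = card (fam V C j)"
    using indep_mod_0_dim[OF finite_fam[OF finV C] ind] span_fam_eq[OF s] by simp
  then have "(\<Sum>i\<le>j. int (card (C i)) * int (card (multi_idx V (j - i)))) = (\<Sum>i\<le>j. h i * int (card (multi_idx V (j - i))))"
    using h[unfolded hilbert_def, rule_format, of j] by (simp add: card_fam[OF finV C])
  moreover have "(\<Sum>i<j. int (card (C i)) * int (card (multi_idx V (j - i)))) = (\<Sum>i<j. h i * int (card (multi_idx V (j - i))))"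
    using less by (intro sum.cong) auto
  ultimately show ?case using finV by (simp add: lessThan_Suc_atMost[symmetric])
qed

text \<open>If \<open>h\<close> is the numerator of the Hilbert series, then by dimension count the module is generated
  by \<open>h j\<close> elements in each degree \<open>j\<close> only if it is free. Freeness can thus be verified by
  exhibiting generators.\<close>

definition cm :: "(nat \<Rightarrow> int) \<Rightarrow> bool" where
  "cm h \<longleftrightarrow> (\<forall>j. \<exists>D. finite D \<and> int (card D) \<le> h j \<and> M j \<subseteq> span (low V \<theta> M j \<union> D))"

lemma card_le_cm:
  assumes "cm h" "finite C" "f ` C \<subseteq> M j" "indep_mod (low V \<theta> M j) C f"
  shows "int (card C) \<le> h j"
proof -
  obtain D where D: "finite D" "int (card D) \<le> h j" "M j \<subseteq> span (low V \<theta> M j \<union> D)"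
    using assms(1) by (auto simp: cm_def)
  obtain F where F: "finite F" "M j \<subseteq> span F" using fin by blast
  have "card C \<le> card D"
    using indep_mod_card_le[OF assms(4,2) subspace_low F(1) _ D(1)] low_subset F(2) D(3) assms(3) by blast
  then show ?thesis using D(2) by linarith
qed

text \<open>Minimal generators can be completed from any pool \<open>Z\<close> that is large enough.
  The pool is left free because generators with prescribed vanishing will be wanted.\<close>

lemma complement_low:
  assumes E: "finite E" "f ` E \<subseteq> M j" "indep_mod (low V \<theta> M j) E f"
    and Z: "f ` Z \<subseteq> M j" "M j \<subseteq> span (low V \<theta> M j \<union> f ` (E \<union> Z))"
  shows "\<exists>N\<subseteq>Z. finite N \<and> N \<inter> E = {} \<and> indep_mod (low V \<theta> M j) (E \<union> N) f \<and>
           M j \<subseteq> span (low V \<theta> M j \<union> f ` (E \<union> N))"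
proof -
  let ?L = "low V \<theta> M j" and ?T = "span (low V \<theta> M j \<union> f ` E)"
  obtain F where F: "finite F" "M j \<subseteq> span F" using fin by blast
  obtain N where N: "N \<subseteq> Z" "finite N" "indep_mod ?T N f" "f ` Z \<subseteq> span (?T \<union> f ` N)"
    using complement_exists[OF subspace_span F(1), of f Z "low V \<theta> M j \<union> f ` E"] F(2) Z(1) by blast
  have dis: "N \<inter> E = {}"
  proof (rule ccontr)
    assume "N \<inter> E \<noteq> {}"
    then obtain b where b: "b \<in> N" "b \<in> E" by blast
    then have "f b \<in> ?T" by (auto intro: span_base)
    moreover have "(\<Sum>x\<in>N. (if x = b then 1 else 0) *\<^sub>R f x) = f b"
      using N(2) b by (simp add: if_distrib[of "\<lambda>r. r *\<^sub>R _"] cong: if_cong)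
    ultimately have "(if b = b then 1 else 0) = (0::real)"
      using indep_modD[OF N(3), of "\<lambda>x. if x = b then 1 else 0" b] b by simp
    then show False by simp
  qed
  have "indep_mod ?L (E \<union> N) f"
  proof (rule indep_modI)
    fix c b assume c: "(\<Sum>b\<in>E \<union> N. c b *\<^sub>R f b) \<in> ?L" and b: "b \<in> E \<union> N"
    have eq: "(\<Sum>b\<in>E \<union> N. c b *\<^sub>R f b) = (\<Sum>b\<in>E. c b *\<^sub>R f b) + (\<Sum>b\<in>N. c b *\<^sub>R f b)"
      using E(1) N(2) dis by (intro sum.union_disjoint) auto
    have "(\<Sum>b\<in>E \<union> N. c b *\<^sub>R f b) \<in> ?T" using c by (intro span_base) simp
    moreover have "(\<Sum>b\<in>E. c b *\<^sub>R f b) \<in> ?T" by (intro span_sum span_scale span_base) simp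
    ultimately have "(\<Sum>b\<in>E \<union> N. c b *\<^sub>R f b) - (\<Sum>b\<in>E. c b *\<^sub>R f b) \<in> ?T"
      by (rule span_diff)
    then have "(\<Sum>b\<in>N. c b *\<^sub>R f b) \<in> ?T" using eq by simp
    then have cN: "\<forall>b\<in>N. c b = 0" using indep_modD[OF N(3), of c] by blast
    then have "(\<Sum>b\<in>E. c b *\<^sub>R f b) \<in> ?L" using c eq by simp
    then have "\<forall>b\<in>E. c b = 0" using indep_modD[OF E(3)] by blast
    then show "c b = 0" using cN b by auto
  qed
  moreover have "M j \<subseteq> span (?L \<union> f ` (E \<union> N))"
  proof -
    have "?T \<subseteq> span (?L \<union> f ` (E \<union> N))" by (rule real_vector.span_mono) auto
    moreover have "f ` N \<subseteq> span (?L \<union> f ` (E \<union> N))" by (auto intro: span_base)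
    ultimately have "span (?T \<union> f ` N) \<subseteq> span (?L \<union> f ` (E \<union> N))" by (simp add: span_minimal)
    moreover have "?L \<union> f ` E \<subseteq> span (?L \<union> f ` (E \<union> N))" by (auto intro: span_base)
    ultimately have "?L \<union> f ` (E \<union> Z) \<subseteq> span (?L \<union> f ` (E \<union> N))"
      using N(4) by (simp add: image_Un)
    then have "span (?L \<union> f ` (E \<union> Z)) \<subseteq> span (?L \<union> f ` (E \<union> N))"
      by (rule span_minimal) simp
    then show ?thesis by (rule subset_trans[OF Z(2)])
  qed
  ultimately show ?thesis using N(1,2) dis by (intro exI[of _ N] conjI)
qed

end

section \<open>Minimal generators of a free module, and descent of freeness\<close>

lemma indep_mod_reindex:
  assumes "inj_on g I"
  shows "indep_mod T (g ` I) f \<longleftrightarrow> indep_mod T I (f \<circ> g)"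
proof
  assume i: "indep_mod T (g ` I) f"
  show "indep_mod T I (f \<circ> g)"
  proof (rule indep_modI)
    fix c b assume "(\<Sum>b\<in>I. c b *\<^sub>R (f \<circ> g) b) \<in> T" and b: "b \<in> I"
    then have "(\<Sum>x\<in>g ` I. c (the_inv_into I g x) *\<^sub>R f x) \<in> T"
      using assms by (simp add: sum.reindex the_inv_into_f_f)
    from indep_modD[OF i this, of "g b"] b assms show "c b = 0" by (simp add: the_inv_into_f_f)
  qed
next
  assume i: "indep_mod T I (f \<circ> g)"
  show "indep_mod T (g ` I) f"
  proof (rule indep_modI)
    fix c b assume "(\<Sum>b\<in>g ` I. c b *\<^sub>R f b) \<in> T" and b: "b \<in> g ` I"
    then have "(\<Sum>x\<in>I. c (g x) *\<^sub>R (f \<circ> g) x) \<in> T"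
      using assms by (simp add: sum.reindex)
    from indep_modD[OF i this] b show "c b = 0" by auto
  qed
qed

context graded_module
begin

text \<open>A generator redundant modulo \<open>low\<close> could be dropped, leaving fewer than
  \<open>h j\<close> of them in degree \<open>j\<close>, against the exact count in
  \<open>fam_indep\<close>.\<close>

lemma indep_low:
  assumes h: "hilbert h" and C: "\<And>i. finite (C i)" "\<And>i. int (card (C i)) \<le> h i"
    and s: "\<And>i. f ` C i \<subseteq> M i" "\<And>i. M i \<subseteq> span (low V \<theta> M i \<union> f ` C i)"
  shows "indep_mod (low V \<theta> M j) (C j) f"
proof -
  have "indep_mod (low V \<theta> M j) {} f" by (simp add: indep_mod_def)
  then obtain N where N: "N \<subseteq> C j" "finite N" "indep_mod (low V \<theta> M j) N f"
      "M j \<subseteq> span (low V \<theta> M j \<union> f ` N)"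
    using complement_low[of "{}" f j "C j"] s[of j] by auto
  let ?C = "C(j := N)"
  have "card N \<le> card (C j)" using N(1) C(1) by (simp add: card_mono)
  then have c: "int (card (?C i)) \<le> h i" "finite (?C i)" for i using C[of i] C[of j] N(2) by auto
  have "f ` ?C i \<subseteq> M i" "M i \<subseteq> span (low V \<theta> M i \<union> f ` ?C i)" for i
    using s[of i] s[of j] N by (auto simp: image_subset_iff dest: subsetD)
  from fam_indep(2)[where C = ?C and f = f and j = j, OF h c(2,1) this]
  have "int (card N) = h j" by simp
  then have "card (C j) \<le> card N" using C(2)[of j] by simp
  then have "N = C j" using N(1) C(1) by (simp add: card_seteq)
  then show ?thesis using N(3) by simp
qed

end

text \<open>The last hypothesis says that \<open>\<iota>\<close> reflects \<open>low\<close>.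
  Minimal generators of \<open>M\<close> then remain independent modulo \<open>low\<close> in
  \<open>M'\<close>, so they are part of a minimal system there. Freeness of \<open>M'\<close>
  excludes relations in that system, hence also among the generators of \<open>M\<close>, and
  \<open>card_of_indep\<close> gives their number. It is this reflection, rather than a projection
  onto the summand, that is used.\<close>

lemma cm_retract:
  fixes \<iota> :: "'m::{real_algebra_1,comm_ring_1} \<Rightarrow> 'n::{real_algebra_1,comm_ring_1}"
  assumes gm: "graded_module V \<theta> M" and gm': "graded_module V \<theta>' M'"
    and h: "graded_module.hilbert V M h" and h': "graded_module.hilbert V M' h'"
    and cm: "graded_module.cm V \<theta>' M' h'"
    and lin: "linear \<iota>" and im: "\<And>j. \<iota> ` M j \<subseteq> M' j" and ker: "\<And>m j. m \<in> M j \<Longrightarrow> \<iota> m = 0 \<Longrightarrow> m = 0"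
    and act: "\<And>m j v. m \<in> M j \<Longrightarrow> v \<in> V \<Longrightarrow> \<iota> (\<theta> v * m) = \<theta>' v * \<iota> m"
    and R: "\<And>m j. m \<in> M j \<Longrightarrow> \<iota> m \<in> low V \<theta>' M' j \<Longrightarrow> m \<in> low V \<theta> M j"
  shows "graded_module.cm V \<theta> M h"
proof -
  interpret A: graded_module V \<theta> M by (rule gm)
  interpret B: graded_module V \<theta>' M' by (rule gm')
  have "\<exists>C. finite C \<and> C \<subseteq> M j \<and> indep_mod (low V \<theta> M j) C id \<and> M j \<subseteq> span (low V \<theta> M j \<union> C)" for j
  proof -
    have "M j \<subseteq> span (low V \<theta> M j \<union> id ` ({} \<union> M j))" by (auto intro: span_base)
    from A.complement_low[of "{}" id j "M j", OF _ _ _ _ this] show ?thesis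
      by (auto simp: indep_mod_def)
  qed
  then obtain C where C: "\<And>j. finite (C j)" "\<And>j. C j \<subseteq> M j" "\<And>j. indep_mod (low V \<theta> M j) (C j) id"
      "\<And>j. M j \<subseteq> span (low V \<theta> M j \<union> C j)" by metis
  have inj: "inj_on \<iota> (M j)" for j
  proof (rule inj_onI)
    fix x y assume xy: "x \<in> M j" "y \<in> M j" "\<iota> x = \<iota> y"
    then have "x - y \<in> M j" using A.sub by (intro subspace_diff) auto
    moreover have "\<iota> (x - y) = 0" using xy(3) lin by (simp add: linear_diff)
    ultimately have "x - y = 0" using ker by blast
    then show "x = y" by simp
  qed
  have injC: "inj_on \<iota> (C j)" for j using inj C(2) by (rule inj_on_subset)
  have ind: "indep_mod (low V \<theta>' M' j) (\<iota> ` C j) id" for j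
  proof -
    have "indep_mod (low V \<theta>' M' j) (C j) \<iota>"
    proof (rule indep_modI)
      fix c b assume s: "(\<Sum>b\<in>C j. c b *\<^sub>R \<iota> b) \<in> low V \<theta>' M' j" and b: "b \<in> C j"
      have "\<iota> (\<Sum>b\<in>C j. c b *\<^sub>R b) = (\<Sum>b\<in>C j. c b *\<^sub>R \<iota> b)"
        using lin by (simp add: linear_sum linear_scale)
      moreover have "(\<Sum>b\<in>C j. c b *\<^sub>R b) \<in> M j"
        using C(2)[of j] A.sub by (intro subspace_sum subspace_scale) auto
      ultimately have "(\<Sum>b\<in>C j. c b *\<^sub>R id b) \<in> low V \<theta> M j" using R s by simp
      then show "c b = 0" using indep_modD[OF C(3)] b by blast
    qed
    then show ?thesis using indep_mod_reindex[OF injC, where f = id] by simp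
  qed
  have "\<exists>N. finite N \<and> N \<subseteq> M' j \<and> indep_mod (low V \<theta>' M' j) (\<iota> ` C j \<union> N) id \<and>
      M' j \<subseteq> span (low V \<theta>' M' j \<union> (\<iota> ` C j \<union> N))" for j
  proof -
    have "M' j \<subseteq> span (low V \<theta>' M' j \<union> id ` (\<iota> ` C j \<union> M' j))" by (auto intro: span_base)
    moreover have "id ` \<iota> ` C j \<subseteq> M' j" using C(2)[of j] im[of j] by auto
    ultimately show ?thesis using B.complement_low[OF _ _ ind, of j "M' j"] C(1) by auto
  qed
  then obtain N where N: "\<And>j. finite (N j)" "\<And>j. N j \<subseteq> M' j"
      "\<And>j. indep_mod (low V \<theta>' M' j) (\<iota> ` C j \<union> N j) id"
      "\<And>j. M' j \<subseteq> span (low V \<theta>' M' j \<union> (\<iota> ` C j \<union> N j))" by metis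
  let ?C' = "\<lambda>j. \<iota> ` C j \<union> N j"
  have C': "finite (?C' j)" "id ` ?C' j \<subseteq> M' j" for j
    using C(1,2)[of j] N(1,2)[of j] im[of j] by auto
  have "int (card (?C' j)) \<le> h' j" for j
    using B.card_le_cm[OF cm C' N(3)] .
  \<comment> \<open>Here freeness of \<open>M'\<close> enters: the completed system has no
    relations, and the part of it coming from \<open>M\<close> inherits this.\<close>
  from B.fam_indep(1)[where f = id and C = ?C', OF h' C'(1) this C'(2)] N(4)
  have big: "indep_mod {0} (fam V ?C' j) (fval V \<theta>' id)" for j by simp
  have sub: "fam V (\<lambda>j. \<iota> ` C j) j \<subseteq> fam V ?C' j" for j by (auto simp: fam_def)
  have small: "indep_mod {0} (fam V (\<lambda>j. \<iota> ` C j) j) (fval V \<theta>' id)" for j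
    by (rule indep_mod_subset[OF big sub finite_fam[OF B.finV C'(1)]])
  let ?g = "\<lambda>(i, b, \<alpha>). (i, \<iota> b, \<alpha>)"
  have "inj_on ?g (fam V C j)" for j
    using injC by (auto simp: inj_on_def fam_def)
  moreover have "?g ` fam V C j = fam V (\<lambda>j. \<iota> ` C j) j" for j
    by (force simp: fam_def)
  ultimately have "indep_mod {0} (fam V C j) (fval V \<theta>' id \<circ> ?g)" for j
    using small[of j] indep_mod_reindex by metis
  moreover have "fval V \<theta>' id \<circ> ?g = fval V \<theta>' \<iota>" by (auto simp: fval_def)
  ultimately have ind': "indep_mod {0} (fam V C j) (fval V \<theta>' \<iota>)" for j by simp
  have mp: "\<iota> (mpow \<theta> V \<alpha> * b) = mpow \<theta>' V \<alpha> * \<iota> b" if "\<alpha> \<in> multi_idx V k" "b \<in> M i" for \<alpha> b k i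
    using that
  proof (induction k arbitrary: \<alpha>)
    case 0
    then show ?case using A.finV by simp
  next
    case (Suc k)
    obtain v \<beta> where v: "v \<in> V" "\<beta> \<in> multi_idx V k" "\<alpha> = \<beta>(v := Suc (\<beta> v))"
      using multi_idx_pos A.finV Suc.prems(1) by metis
    then show ?case
      using Suc.IH[of \<beta>] Suc.prems(2) act[OF A.mpow_act[of \<beta> k b i]] A.finV
        mpow_inc[of V v \<theta> \<beta>] mpow_inc[of V v \<theta>' \<beta>]
      by (simp add: mult.assoc del: fun_upd_apply)
  qed
  have "indep_mod {0} (fam V C j) (fval V \<theta> id)" for j
  proof (rule indep_modI)
    fix c t assume s: "(\<Sum>t\<in>fam V C j. c t *\<^sub>R fval V \<theta> id t) \<in> {0}" and t: "t \<in> fam V C j"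
    have "\<iota> (\<Sum>t\<in>fam V C j. c t *\<^sub>R fval V \<theta> id t) = (\<Sum>t\<in>fam V C j. c t *\<^sub>R \<iota> (fval V \<theta> id t))"
      using lin by (simp add: linear_sum linear_scale)
    also have "\<dots> = (\<Sum>t\<in>fam V C j. c t *\<^sub>R fval V \<theta>' \<iota> t)"
    proof (rule sum.cong[OF refl])
      fix t assume "t \<in> fam V C j"
      then obtain i b \<alpha> where "t = (i, b, \<alpha>)" "b \<in> C i" "\<alpha> \<in> multi_idx V (j - i)"
        by (auto simp: fam_def)
      then show "c t *\<^sub>R \<iota> (fval V \<theta> id t) = c t *\<^sub>R fval V \<theta>' \<iota> t"
        using mp C(2)[of i] by (auto simp: fval_def)
    qed
    finally have "(\<Sum>t\<in>fam V C j. c t *\<^sub>R fval V \<theta>' \<iota> t) \<in> {0}"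
      using s lin by (simp add: linear_0)
    then show "c t = 0" using indep_modD[OF ind'] t by blast
  qed
  then have "int (card (C j)) = h j" for j
    using A.card_of_indep[where f = id and C = C and j = j, OF h C(1)] C(2,4) by simp
  then show ?thesis using C(1,4) by (auto simp: A.cm_def intro!: exI[of _ "C _"])
qed

section \<open>Bases compatible with restriction to faces\<close>

lemma mpow_cong_support:
  assumes "finite V" "K \<subseteq> V" "\<And>v. v \<notin> K \<Longrightarrow> \<alpha> v = 0"
  shows "mpow \<theta> V \<alpha> = mpow \<theta> K \<alpha>"
  unfolding mpow_def using assms by (intro prod.mono_neutral_right) auto

lemma multi_idx_support:
  assumes "finite V" "K \<subseteq> V"
  shows "\<alpha> \<in> multi_idx K k \<longleftrightarrow> \<alpha> \<in> multi_idx V k \<and> (\<forall>v. v \<notin> K \<longrightarrow> \<alpha> v = 0)"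
proof -
  have "sum \<alpha> V = sum \<alpha> K" if "\<forall>v. v \<notin> K \<longrightarrow> \<alpha> v = 0"
    using assms that by (intro sum.mono_neutral_right) auto
  then show ?thesis using assms(2) by (auto simp: multi_idx_def)
qed

lemma mult_left_eq_0:
  fixes a :: "'m::comm_ring_1"
  shows "a * b = 0 \<Longrightarrow> a * (c * b) = 0" "a * c = 0 \<Longrightarrow> a * (c * b) = 0"
  by (simp add: mult.left_commute[of a c b]) (simp flip: mult.assoc)

lemma mult_mpow_eq_0:
  fixes a :: "'m::comm_ring_1"
  assumes "finite V" "v \<in> V" "\<alpha> v \<noteq> 0" "a * \<theta> v = 0"
  shows "a * mpow \<theta> V \<alpha> = 0"
proof -
  obtain k where k: "\<alpha> v = Suc k" using assms(3) not0_implies_Suc by blast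
  have "mpow \<theta> V \<alpha> = \<theta> v * (\<theta> v ^ k * (\<Prod>u\<in>V - {v}. \<theta> u ^ \<alpha> u))"
    using assms(1,2) by (simp add: mpow_def prod.remove[of V v] k mult.assoc)
  then show ?thesis using assms(4) by (simp flip: mult.assoc)
qed

text \<open>\<open>e F\<close> plays the role of the indicator function of the restriction to \<open>F\<close>.\<close>

locale face_system =
  fixes V :: "'v set" and \<theta> :: "'v \<Rightarrow> 'm::{real_algebra_1,comm_ring_1}" and P :: "nat \<Rightarrow> 'm set"
    and e :: "'v set \<Rightarrow> 'm" and h :: "'v set \<Rightarrow> nat \<Rightarrow> int"
  assumes grP: "graded_module V \<theta> P"
    and e_mult: "\<And>F G. G \<subseteq> F \<Longrightarrow> F \<subseteq> V \<Longrightarrow> e G * e F = e G"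
    and e_0: "\<And>F v. F \<subseteq> V \<Longrightarrow> v \<in> V - F \<Longrightarrow> e F * \<theta> v = 0"
    and hil: "\<And>F. F \<subseteq> V \<Longrightarrow> graded_module.hilbert F (\<lambda>j. (*) (e F) ` P j) (h F)"
    and cm: "\<And>F. F \<subseteq> V \<Longrightarrow> graded_module.cm F \<theta> (\<lambda>j. (*) (e F) ` P j) (h F)"
    and lift: "\<And>G g j. G \<subseteq> V \<Longrightarrow> g \<in> P j \<Longrightarrow>
      \<exists>g'\<in>P j. e G * g' = e G * g \<and> (\<forall>F\<subseteq>V. e (F \<inter> G) * g = 0 \<longrightarrow> e F * g' = 0)"
begin

sublocale P: graded_module V \<theta> P by (rule grP)

definition MF where "MF F j = (*) (e F) ` P j"

lemma graded_MF:
  assumes F: "F \<subseteq> V"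
  shows "graded_module F \<theta> (MF F)"
proof
  show "finite F" using F P.finV finite_subset by blast
  show "subspace (MF F j)" for j
    unfolding MF_def using P.sub
    by (intro linear_subspace_image) (auto intro!: linearI simp: distrib_left)
  show "\<theta> v * m \<in> MF F (Suc j)" if v: "v \<in> F" and m: "m \<in> MF F j" for v m j
  proof -
    obtain p where "p \<in> P j" "m = e F * p" using m by (auto simp: MF_def)
    then show ?thesis using P.act[of v p j] v F
      by (auto simp: MF_def mult.left_commute intro!: image_eqI[of _ _ "\<theta> v * p"])
  qed
  show "\<exists>X. finite X \<and> MF F j \<subseteq> span X" for j
  proof -
    obtain X where "finite X" "P j \<subseteq> span X" using P.fin by blast
    moreover have "linear ((*) (e F))" by (auto intro!: linearI simp: distrib_left)
    ultimately show ?thesis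
      by (intro exI[of _ "(*) (e F) ` X"]) (auto simp: MF_def linear_span_image)
  qed
qed

lemma e_sub: "K \<subseteq> F \<Longrightarrow> F \<subseteq> V \<Longrightarrow> e K * (e F * m) = e K * m"
  using e_mult[of K F] by (simp add: mult.assoc[symmetric])

text \<open>Over \<open>K\<close> the parameters outside \<open>K\<close> act as zero, so only those
  of \<open>K\<close> survive the restriction.\<close>

lemma low_restrict:
  assumes KF: "K \<subseteq> F" "F \<subseteq> V" and x: "x \<in> low F \<theta> (MF F) j"
  shows "e K * x \<in> low K \<theta> (MF K) j"
proof (cases j)
  case 0
  then show ?thesis using x by (simp add: low_0)
next
  case (Suc i)
  interpret F: graded_module F \<theta> "MF F" by (rule graded_MF[OF KF(2)])
  interpret K: graded_module K \<theta> "MF K" by (rule graded_MF) (use KF in blast)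
  obtain m where m: "\<forall>v\<in>F. m v \<in> MF F i" "x = (\<Sum>v\<in>F. \<theta> v * m v)"
    using x low_Suc_iff[of F "MF F" i] F.finV F.sub Suc by auto
  have "e K * x = (\<Sum>v\<in>F. e K * \<theta> v * m v)" by (simp add: m(2) sum_distrib_left mult.assoc)
  also have "\<dots> = (\<Sum>v\<in>K. e K * \<theta> v * m v)"
  proof (rule sum.mono_neutral_right)
    show "\<forall>v\<in>F - K. e K * \<theta> v * m v = 0"
    proof
      fix v assume "v \<in> F - K"
      then have "e K * \<theta> v = 0" using KF by (intro e_0) auto
      then show "e K * \<theta> v * m v = 0" by simp
    qed
  qed (use KF F.finV in auto)
  also have "\<dots> = (\<Sum>v\<in>K. \<theta> v * (e K * m v))" by (simp add: ac_simps)
  finally have "e K * x = (\<Sum>v\<in>K. \<theta> v * (e K * m v))" .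
  moreover have "e K * m v \<in> MF K i" if "v \<in> K" for v
  proof -
    have "m v \<in> MF F i" using m(1) that KF(1) by blast
    then obtain p where "p \<in> P i" "m v = e F * p" by (auto simp: MF_def)
    then show ?thesis using e_sub[OF KF] by (auto simp: MF_def)
  qed
  ultimately show ?thesis
    unfolding Suc low_Suc_iff[where M = "MF K", OF K.finV K.sub] by (intro exI[of _ "\<lambda>v. e K * m v"]) simp
qed

text \<open>Vanishing is demanded on all faces not containing \<open>K\<close>, also on those
  incomparable with \<open>K\<close>. The same elements can then serve over every \<open>F\<close>
  containing \<open>K\<close> and contribute nothing over the other faces.\<close>

definition interior_part where
  "interior_part K j = {b \<in> P j. \<forall>F\<subseteq>V. \<not> K \<subseteq> F \<longrightarrow> e F * b = 0}"

definition CF where "CF B F i = (\<Union>K\<in>Pow F. B K i)"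

text \<open>\<open>B K\<close> is the part of the basis with support \<open>K\<close>.\<close>

definition good where
  "good B F \<longleftrightarrow> (\<forall>i. finite (CF B F i) \<and> B F i \<subseteq> interior_part F i \<and> int (card (CF B F i)) = h F i)
     \<and> (\<forall>j. MF F j \<subseteq> span (low F \<theta> (MF F) j \<union> (*) (e F) ` CF B F j))
     \<and> (\<forall>j. indep_mod {0} (fam F (CF B F) j) (fval F \<theta> ((*) (e F))))"

text \<open>Two facts make the extension possible: the parts over proper faces stay independent
  modulo \<open>low\<close> over \<open>G\<close>, and what they fail to generate can be taken from
  \<open>interior_part G\<close>. The number of elements then added is forced by the count.\<close>

lemma good_step:
  assumes G: "G \<subseteq> V" and B: "\<And>K. K \<subset> G \<Longrightarrow> good B K"
  shows "\<exists>N. good (B(G := N)) G"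
proof -
  interpret G: graded_module G \<theta> "MF G" by (rule graded_MF[OF G])
  define E where "E i = (\<Union>K\<in>Pow G - {G}. B K i)" for i
  have BKV: "K \<subseteq> V" if "K \<subset> G" for K using that G by blast
  have int: "B K i \<subseteq> interior_part K i" if "K \<subset> G" for K i
    using B[OF that] by (simp add: good_def)
  have Pin: "b \<in> P i" if "K \<subset> G" "b \<in> B K i" for K i b
    using int[OF that(1)] that(2) by (auto simp: interior_part_def)
  have van: "e F * b = 0" if "K \<subset> G" "b \<in> B K i" "F \<subseteq> V" "\<not> K \<subseteq> F" for K F i b
    using int[OF that(1)] that(2-) by (auto simp: interior_part_def)
  have CFE: "CF B K i \<subseteq> E i" if "K \<subset> G" for K i
    using that by (auto simp: CF_def E_def)
  have CFM: "(*) (e K) ` CF B K i \<subseteq> MF K i" if "K \<subset> G" for K i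
    using Pin that by (auto simp: CF_def MF_def) blast
  have finB: "finite (B K i)" if "K \<subset> G" for K i
  proof (rule finite_subset)
    show "B K i \<subseteq> CF B K i" by (auto simp: CF_def)
    show "finite (CF B K i)" using B[OF that] by (simp add: good_def)
  qed
  have finE: "finite (E i)" for i
    using G.finV finB by (auto simp: E_def)
  have EP: "E i \<subseteq> P i" for i using Pin by (auto simp: E_def)
  have low_indep: "indep_mod (low K \<theta> (MF K) i) (CF B K i) ((*) (e K))" if K: "K \<subset> G" for K i
  proof -
    interpret K: graded_module K \<theta> "MF K" by (rule graded_MF[OF BKV[OF K]])
    have hK: "K.hilbert (h K)" using hil[OF BKV[OF K]] by (simp add: MF_def[abs_def])
    show ?thesis
      by (rule K.indep_low[where C = "CF B K" and h = "h K"])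
        (use B[OF K] hK CFM[OF K] in \<open>auto simp: good_def\<close>)
  qed
  \<comment> \<open>The coefficient of an element of \<open>B K\<close> is isolated by restricting
    to \<open>K\<close>: parts not inside \<open>K\<close> vanish there, and the others form a
    minimal system over \<open>K\<close>.\<close>
  have Eind: "indep_mod (low G \<theta> (MF G) i) (E i) ((*) (e G))" for i
  proof (rule indep_modI)
    fix c b assume s: "(\<Sum>b\<in>E i. c b *\<^sub>R (e G * b)) \<in> low G \<theta> (MF G) i" and b: "b \<in> E i"
    then obtain K where K: "K \<subset> G" "b \<in> B K i" by (auto simp: E_def)
    have "e K * (\<Sum>b\<in>E i. c b *\<^sub>R (e G * b)) = (\<Sum>b\<in>E i. c b *\<^sub>R (e K * b))"
      using e_sub[of K G] K(1) G by (simp add: sum_distrib_left psubset_imp_subset)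
    also have "\<dots> = (\<Sum>b\<in>CF B K i. c b *\<^sub>R (e K * b))"
    proof (rule sum.mono_neutral_right[OF finE CFE[OF K(1)]], rule ballI)
      fix x assume x: "x \<in> E i - CF B K i"
      then obtain K' where K': "K' \<subset> G" "x \<in> B K' i" by (auto simp: E_def)
      then have "\<not> K' \<subseteq> K" using x by (auto simp: CF_def)
      then show "c x *\<^sub>R (e K * x) = 0" using van[OF K' BKV[OF K(1)]] by simp
    qed
    finally have "(\<Sum>b\<in>CF B K i. c b *\<^sub>R (e K * b)) \<in> low K \<theta> (MF K) i"
      using low_restrict[OF _ G s, of K] K(1) by (simp add: psubset_imp_subset)
    then show "c b = 0" using indep_modD[OF low_indep[OF K(1)]] K(2) by (auto simp: CF_def)
  qed
  let ?L = "\<lambda>j. span (low G \<theta> (MF G) j \<union> (*) (e G) ` E j)"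
  \<comment> \<open>Modulo \<open>?L\<close> every \<open>f\<close> can be made to vanish on all
    proper faces of size below \<open>m\<close>; the induction on \<open>m\<close> clears the faces
    of one size at a time.\<close>
  have peel: "\<exists>g\<in>P j. (\<forall>K. K \<subset> G \<longrightarrow> card K < m \<longrightarrow> e K * g = 0) \<and> e G * (f - g) \<in> ?L j"
    if f: "f \<in> P j" for f j m
  proof (induction m)
    case 0
    show ?case using f by (intro bexI[of _ f]) (auto simp: span_zero)
  next
    case (Suc m)
    then obtain g where g: "g \<in> P j" "\<And>K. K \<subset> G \<Longrightarrow> card K < m \<Longrightarrow> e K * g = 0" "e G * (f - g) \<in> ?L j"
      by blast
    define \<phi> where "\<phi> = (\<lambda>K. \<lambda>(i::nat, b, \<alpha>). mpow \<theta> K \<alpha> * b)"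
    have "\<exists>s\<in>P j. e K * s = e K * g \<and> (\<forall>F\<subseteq>V. \<not> K \<subseteq> F \<longrightarrow> e F * s = 0) \<and> e G * s \<in> ?L j"
      if K: "K \<subset> G" "card K = m" for K
    proof -
      interpret K: graded_module K \<theta> "MF K" by (rule graded_MF[OF BKV[OF K(1)]])
      have gK: "good B K" by (rule B[OF K(1)])
      then have sp: "MF K j \<subseteq> span (fval K \<theta> ((*) (e K)) ` fam K (CF B K) j)"
        by (intro K.span_fam) (simp add: good_def)
      have finf: "finite (fam K (CF B K) j)"
        by (rule finite_fam[OF K.finV]) (use gK in \<open>simp add: good_def\<close>)
      have "e K * g \<in> MF K j" using g(1) by (simp add: MF_def)
      then obtain d where d: "e K * g = (\<Sum>t\<in>fam K (CF B K) j. d t *\<^sub>R fval K \<theta> ((*) (e K)) t)"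
        using sp in_span_image[OF finf] by blast
      have fv: "fval K \<theta> ((*) (e K)) t = e K * \<phi> K t" for t
        by (auto simp: fval_def \<phi>_def mult.left_commute split: prod.splits)
      \<comment> \<open>The expansion of \<open>e K * g\<close> over \<open>K\<close>, with each
        restricted product replaced by the product in \<open>P\<close> that it comes from: an
        extension of \<open>e K * g\<close> beyond \<open>K\<close>.\<close>
      define s where "s = (\<Sum>t\<in>fam K (CF B K) j. d t *\<^sub>R \<phi> K t)"
      have es: "e F * s = (\<Sum>t\<in>fam K (CF B K) j. d t *\<^sub>R (e F * \<phi> K t))" for F
        by (simp add: s_def sum_distrib_left)
      have 1: "e K * s = e K * g" by (simp add: es d fv)
      have phiP: "\<phi> K t \<in> P j" if tf: "t \<in> fam K (CF B K) j" for t
      proof -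
        obtain i b \<alpha> where t: "t = (i, b, \<alpha>)" "i \<le> j" "b \<in> CF B K i" "\<alpha> \<in> multi_idx K (j - i)"
          using tf by (auto simp: fam_def)
        have "b \<in> P i" using t(3) CFE[OF K(1)] EP by blast
        moreover have "\<alpha> \<in> multi_idx V (j - i)" "mpow \<theta> K \<alpha> = mpow \<theta> V \<alpha>"
          using t(4) multi_idx_support[OF P.finV BKV[OF K(1)], of \<alpha>]
            mpow_cong_support[OF P.finV BKV[OF K(1)], of \<alpha> \<theta>] by auto
        ultimately show ?thesis using P.mpow_act[of \<alpha> "j - i" b i] t by (simp add: \<phi>_def)
      qed
      \<comment> \<open>A product lives on the faces containing \<open>K1\<close>, the label of its
        basis element joined with the support of its monomial. If \<open>K1\<close> is smaller than
        \<open>K\<close>, then \<open>g\<close> already vanishes over \<open>K1\<close>, and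
        independence over \<open>K1\<close> makes the coefficient zero. Products with
        \<open>K1 = K\<close> vanish on every \<open>F\<close> not containing
        \<open>K\<close>.\<close>
      have 2: "e F * s = 0" if F: "F \<subseteq> V" "\<not> K \<subseteq> F" for F
        unfolding es
      proof (rule sum.neutral, rule ballI, rule ccontr)
        fix t assume t: "t \<in> fam K (CF B K) j" and nz: "d t *\<^sub>R (e F * \<phi> K t) \<noteq> 0"
        obtain i b \<alpha> K' where t': "t = (i, b, \<alpha>)" "i \<le> j" "b \<in> B K' i" "K' \<subseteq> K" "\<alpha> \<in> multi_idx K (j - i)"
          using t by (auto simp: fam_def CF_def)
        define K1 where "K1 = K' \<union> {v. \<alpha> v \<noteq> 0}"
        have K1K: "K1 \<subseteq> K" using t'(4,5) by (auto simp: K1_def multi_idx_def)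
        have K1F: "K1 \<subseteq> F"
        proof (rule ccontr)
          assume "\<not> K1 \<subseteq> F"
          then consider "\<not> K' \<subseteq> F" | v where "\<alpha> v \<noteq> 0" "v \<notin> F" by (auto simp: K1_def)
          then have "e F * \<phi> K t = 0"
          proof cases
            case 1
            then have "e F * b = 0" using van[of K' b i F] t' K(1) F(1) by auto
            then show ?thesis by (simp add: \<phi>_def t' mult_left_eq_0(1))
          next
            case (2 v)
            have vK: "v \<in> K" using 2 K1K by (auto simp: K1_def)
            then have "v \<in> V" using BKV[OF K(1)] by blast
            then have "e F * \<theta> v = 0" using e_0[OF F(1)] 2 by blast
            then have "e F * mpow \<theta> K \<alpha> = 0" using K.finV vK 2(1) by (intro mult_mpow_eq_0)
            then show ?thesis by (simp add: \<phi>_def t' mult_left_eq_0(2))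
          qed
          then show False using nz by simp
        qed
        then have K1: "K1 \<subset> K" using K1K F(2) by auto
        then have K1G: "K1 \<subset> G" using K(1) by blast
        have "card K1 < m" using K1 K.finV K(2) psubset_card_mono by blast
        then have "e K1 * g = 0" using g(2) K1G by blast
        then have "e K1 * s = 0"
          using 1 e_sub[OF K1K BKV[OF K(1)]] by metis
        then have "(\<Sum>t\<in>fam K (CF B K) j. d t *\<^sub>R (e K1 * \<phi> K t)) = 0" by (simp add: es)
        moreover have sub: "fam K1 (CF B K1) j \<subseteq> fam K (CF B K) j"
        proof -
          have "CF B K1 i \<subseteq> CF B K i" for i using K1K by (auto simp: CF_def)
          moreover have "multi_idx K1 i \<subseteq> multi_idx K i" for i
            using multi_idx_support[OF K.finV K1K] by blast
          ultimately show ?thesis unfolding fam_def by (intro Sigma_mono Sigma_mono) auto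
        qed
        moreover have "(\<Sum>t\<in>fam K (CF B K) j. d t *\<^sub>R (e K1 * \<phi> K t)) =
            (\<Sum>t\<in>fam K1 (CF B K1) j. d t *\<^sub>R fval K1 \<theta> ((*) (e K1)) t)"
        proof (rule sum.mono_neutral_cong_right[OF finf sub])
          show "\<forall>t\<in>fam K (CF B K) j - fam K1 (CF B K1) j. d t *\<^sub>R (e K1 * \<phi> K t) = 0"
          proof
            fix t assume t: "t \<in> fam K (CF B K) j - fam K1 (CF B K1) j"
            then have "t \<in> fam K (CF B K) j" by blast
            then obtain i b \<alpha> K' where t': "t = (i, b, \<alpha>)" "i \<le> j" "b \<in> B K' i" "K' \<subseteq> K" "\<alpha> \<in> multi_idx K (j - i)"
              by (auto simp: fam_def CF_def)
            have "\<not> K' \<subseteq> K1 \<or> \<alpha> \<notin> multi_idx K1 (j - i)"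
              using t t' by (auto simp: fam_def CF_def)
            then consider "\<not> K' \<subseteq> K1" | v where "\<alpha> v \<noteq> 0" "v \<notin> K1"
              using t'(5) multi_idx_support[OF K.finV K1K, of \<alpha>] by blast
            then have "e K1 * \<phi> K t = 0"
            proof cases
              case 1
              then have "e K1 * b = 0" using van[of K' b i K1] t' K(1) BKV[OF K1G] by auto
              then show ?thesis by (simp add: \<phi>_def t' mult_left_eq_0(1))
            next
              case (2 v)
              have vK: "v \<in> K" using 2 t'(5) by (auto simp: multi_idx_def)
              then have "v \<in> V" using BKV[OF K(1)] by blast
              then have "e K1 * \<theta> v = 0" using e_0[OF BKV[OF K1G]] 2 by blast
              then have "e K1 * mpow \<theta> K \<alpha> = 0" using K.finV vK 2(1) by (intro mult_mpow_eq_0)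
              then show ?thesis by (simp add: \<phi>_def t' mult_left_eq_0(2))
            qed
            then show "d t *\<^sub>R (e K1 * \<phi> K t) = 0" by simp
          qed
          show "d t *\<^sub>R (e K1 * \<phi> K t) = d t *\<^sub>R fval K1 \<theta> ((*) (e K1)) t"
            if tf: "t \<in> fam K1 (CF B K1) j" for t
          proof -
            obtain i b \<alpha> where "t = (i, b, \<alpha>)" "\<alpha> \<in> multi_idx K1 (j - i)"
              using tf by (auto simp: fam_def)
            moreover then have "mpow \<theta> K \<alpha> = mpow \<theta> K1 \<alpha>"
              using mpow_cong_support[OF K.finV K1K, of \<alpha> \<theta>] by (auto simp: multi_idx_def)
            ultimately show ?thesis by (simp add: fval_def \<phi>_def mult.left_commute)
          qed
        qed
        moreover have "indep_mod {0} (fam K1 (CF B K1) j) (fval K1 \<theta> ((*) (e K1)))"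
          using B[OF K1G] by (simp add: good_def)
        moreover have "t \<in> fam K1 (CF B K1) j"
          using t' multi_idx_support[OF K.finV K1K, of \<alpha>] by (auto simp: fam_def CF_def K1_def)
        ultimately have "d t = 0" using indep_modD by fastforce
        then show False using nz by simp
      qed
      \<comment> \<open>A product with a trivial monomial is an old basis element; any other one has
        a factor \<open>\<theta> v\<close> with \<open>v\<close> in \<open>G\<close> and lies in
        \<open>low\<close>.\<close>
      have 3: "e G * \<phi> K t \<in> ?L j" if tf: "t \<in> fam K (CF B K) j" for t
      proof -
        obtain i b \<alpha> where t: "t = (i, b, \<alpha>)" "i \<le> j" "b \<in> CF B K i" "\<alpha> \<in> multi_idx K (j - i)"
          using tf by (auto simp: fam_def)
        have bE: "b \<in> E i" using CFE[OF K(1)] t(3) by blast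
        show ?thesis
        proof (cases "j - i")
          case 0
          then have "e G * \<phi> K t = e G * b" "i = j" using t K.finV by (auto simp: \<phi>_def)
          then show ?thesis using bE by (auto intro!: span_base)
        next
          case (Suc k)
          obtain v \<beta> where v: "v \<in> K" "\<beta> \<in> multi_idx K k" "\<alpha> = \<beta>(v := Suc (\<beta> v))"
            using multi_idx_pos[OF K.finV] t(4) Suc by metis
          have "\<beta> \<in> multi_idx V k" "mpow \<theta> K \<beta> = mpow \<theta> V \<beta>"
            using v(2) multi_idx_support[OF P.finV BKV[OF K(1)], of \<beta>]
              mpow_cong_support[OF P.finV BKV[OF K(1)], of \<beta> \<theta>] by auto
          then have "mpow \<theta> K \<beta> * b \<in> P (k + i)" using P.mpow_act[of \<beta> k b i] EP bE by auto
          then have "e G * (mpow \<theta> K \<beta> * b) \<in> MF G (k + i)" by (simp add: MF_def)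
          moreover have "v \<in> G" using v(1) K(1) by blast
          moreover have "j = Suc (k + i)" using Suc t(2) by simp
          ultimately have "\<theta> v * (e G * (mpow \<theta> K \<beta> * b)) \<in> low G \<theta> (MF G) j"
            by (auto simp: low_def intro!: span_base)
          moreover have "\<theta> v * (e G * (mpow \<theta> K \<beta> * b)) = e G * \<phi> K t"
            using v K.finV by (simp add: \<phi>_def t(1) mpow_inc ac_simps del: fun_upd_apply)
          ultimately show ?thesis by (auto intro!: span_base)
        qed
      qed
      have "s \<in> P j" unfolding s_def using phiP P.sub by (intro subspace_sum subspace_scale) auto
      moreover have "e G * s \<in> ?L j" unfolding es by (intro span_sum span_scale 3)
      ultimately show ?thesis using 1 2 by blast
    qed
    then have "\<forall>K. \<exists>s. K \<subset> G \<and> card K = m \<longrightarrow> s \<in> P j \<and> e K * s = e K * g \<and>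
        (\<forall>F\<subseteq>V. \<not> K \<subseteq> F \<longrightarrow> e F * s = 0) \<and> e G * s \<in> ?L j" by blast
    from choice[OF this] obtain S where S':
        "\<forall>K. K \<subset> G \<and> card K = m \<longrightarrow> S K \<in> P j \<and> e K * S K = e K * g \<and>
          (\<forall>F\<subseteq>V. \<not> K \<subseteq> F \<longrightarrow> e F * S K = 0) \<and> e G * S K \<in> ?L j" by blast
    then have S: "\<And>K. K \<subset> G \<Longrightarrow> card K = m \<Longrightarrow> S K \<in> P j"
        "\<And>K. K \<subset> G \<Longrightarrow> card K = m \<Longrightarrow> e K * S K = e K * g"
        "\<And>K F. K \<subset> G \<Longrightarrow> card K = m \<Longrightarrow> F \<subseteq> V \<Longrightarrow> \<not> K \<subseteq> F \<Longrightarrow> e F * S K = 0"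
        "\<And>K. K \<subset> G \<Longrightarrow> card K = m \<Longrightarrow> e G * S K \<in> ?L j" by simp_all
    let ?I = "{K. K \<subset> G \<and> card K = m}"
    have finI: "finite ?I" by (rule finite_subset[of _ "Pow G"]) (use G.finV in auto)
    let ?g = "g - (\<Sum>K\<in>?I. S K)"
    have "?g \<in> P j" using S(1) g(1) P.sub by (intro subspace_diff subspace_sum) auto
    moreover have "e F * ?g = 0" if F: "F \<subset> G" "card F < Suc m" for F
    proof -
      \<comment> \<open>Faces of the same size do not interfere: the correction for \<open>K\<close>
        vanishes on every other \<open>F\<close> of at most that size, so all corrections are
        subtracted at once.\<close>
      have nsub: "\<not> K \<subseteq> F" if "K \<in> ?I" "K \<noteq> F" for K
        using that F card_seteq[of F K] G.finV by (auto dest: finite_subset)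
      have "e F * (\<Sum>K\<in>?I. S K) = (\<Sum>K\<in>?I. e F * S K)" by (simp add: sum_distrib_left)
      also have "\<dots> = (\<Sum>K\<in>?I. if K = F then e F * g else 0)"
        by (rule sum.cong[OF refl]) (use S nsub BKV[OF F(1)] in auto)
      also have "\<dots> = e F * g"
        using finI F g(2)[of F] by (cases "card F = m") auto
      finally show ?thesis by (simp add: right_diff_distrib)
    qed
    moreover have "e G * (f - ?g) \<in> ?L j"
    proof -
      have "e G * (f - ?g) = e G * (f - g) + (\<Sum>K\<in>?I. e G * S K)"
        by (simp add: algebra_simps sum_distrib_left)
      also have "\<dots> \<in> ?L j" using g(3) S(4) by (intro span_add span_sum) auto
      finally show ?thesis .
    qed
    ultimately show ?case by blast
  qed
  have spanning: "MF G j \<subseteq> span (low G \<theta> (MF G) j \<union> (*) (e G) ` (E j \<union> interior_part G j))" for j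
  proof
    fix x assume "x \<in> MF G j"
    then obtain f where f: "f \<in> P j" "x = e G * f" by (auto simp: MF_def)
    obtain g where g: "g \<in> P j" "\<And>K. K \<subset> G \<Longrightarrow> card K < card G \<Longrightarrow> e K * g = 0" "e G * (f - g) \<in> ?L j"
      using peel[OF f(1), of "card G"] by blast
    \<comment> \<open>\<open>g\<close> vanishes on all proper faces of \<open>G\<close> but is
      uncontrolled outside \<open>G\<close>; \<open>lift\<close> trades it for an element of
      \<open>interior_part G\<close> with the same restriction to \<open>G\<close>.\<close>
    obtain g' where g': "g' \<in> P j" "e G * g' = e G * g" "\<And>F. F \<subseteq> V \<Longrightarrow> e (F \<inter> G) * g = 0 \<Longrightarrow> e F * g' = 0"
      using lift[OF G g(1)] by blast
    have g'I: "g' \<in> interior_part G j"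
      unfolding interior_part_def
    proof (intro CollectI conjI allI impI)
      fix F assume F: "F \<subseteq> V" "\<not> G \<subseteq> F"
      then have "F \<inter> G \<subset> G" by blast
      then have "e (F \<inter> G) * g = 0" using g(2) psubset_card_mono[OF G.finV] by blast
      then show "e F * g' = 0" using g'(3) F(1) by blast
    qed (rule g'(1))
    let ?S = "span (low G \<theta> (MF G) j \<union> (*) (e G) ` (E j \<union> interior_part G j))"
    have "?L j \<subseteq> ?S" by (rule real_vector.span_mono) auto
    then have "e G * (f - g) \<in> ?S" using g(3) by blast
    moreover have "e G * g' \<in> ?S" using g'I by (auto intro!: span_base)
    ultimately have "e G * (f - g) + e G * g' \<in> ?S" by (rule span_add)
    then show "x \<in> ?S" using f(2) g'(2) by (simp add: algebra_simps)
  qed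
  have "\<exists>N\<subseteq>interior_part G i. finite N \<and> N \<inter> E i = {} \<and>
      indep_mod (low G \<theta> (MF G) i) (E i \<union> N) ((*) (e G)) \<and>
      MF G i \<subseteq> span (low G \<theta> (MF G) i \<union> (*) (e G) ` (E i \<union> N))" for i
  proof (rule G.complement_low[OF finE _ Eind _ spanning])
    show "(*) (e G) ` E i \<subseteq> MF G i" using EP by (auto simp: MF_def)
    show "(*) (e G) ` interior_part G i \<subseteq> MF G i" by (auto simp: MF_def interior_part_def)
  qed
  then obtain N where N: "\<And>i. N i \<subseteq> interior_part G i" "\<And>i. finite (N i)"
      "\<And>i. indep_mod (low G \<theta> (MF G) i) (E i \<union> N i) ((*) (e G))"
      "\<And>i. MF G i \<subseteq> span (low G \<theta> (MF G) i \<union> (*) (e G) ` (E i \<union> N i))" by metis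
  let ?B = "B(G := N)"
  have CFB: "CF ?B G i = E i \<union> N i" for i
  proof -
    have "Pow G = insert G (Pow G - {G})" by blast
    then have "CF ?B G i = (\<Union>K\<in>insert G (Pow G - {G}). ?B K i)" by (simp add: CF_def)
    also have "\<dots> = N i \<union> (\<Union>K\<in>Pow G - {G}. ?B K i)" by (simp only: UN_insert fun_upd_same)
    also have "(\<Union>K\<in>Pow G - {G}. ?B K i) = E i" by (simp add: E_def)
    finally show ?thesis by (simp only: Un_commute)
  qed
  have sub: "(*) (e G) ` CF ?B G i \<subseteq> MF G i" for i
  proof -
    have "E i \<union> N i \<subseteq> P i" using EP[of i] N(1)[of i] by (auto simp: interior_part_def)
    then show ?thesis unfolding CFB MF_def by (rule image_mono)
  qed
  have fin: "finite (CF ?B G i)" for i unfolding CFB using finE N(2) by (rule finite_UnI)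
  have hG: "G.hilbert (h G)" using hil[OF G] by (simp add: MF_def[abs_def])
  have cG: "G.cm (h G)" using cm[OF G] by (simp add: MF_def[abs_def])
  have le: "int (card (CF ?B G i)) \<le> h G i" for i
    by (rule G.card_le_cm[OF cG fin sub]) (unfold CFB, rule N(3))
  have sp: "MF G i \<subseteq> span (low G \<theta> (MF G) i \<union> (*) (e G) ` CF ?B G i)" for i
    unfolding CFB by (rule N(4))
  note G.fam_indep[where C = "CF ?B G", OF hG fin le sub sp]
  then have "good ?B G" using fin N(1) sp by (simp add: good_def)
  then show ?thesis by blast
qed

lemma local_decomposition:
  "\<exists>l :: 'v set \<Rightarrow> nat \<Rightarrow> nat. \<forall>F\<subseteq>V. \<forall>i. h F i = (\<Sum>K\<in>Pow F. int (l K i))"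
proof -
  have good_cong: "good B F = good B' F" if "\<And>K. K \<subseteq> F \<Longrightarrow> B K = B' K" for B B' F
  proof -
    have "CF B F = CF B' F" using that by (auto simp: CF_def fun_eq_iff)
    then show ?thesis using that[of F] by (simp add: good_def)
  qed
  have "\<exists>B. \<forall>K. K \<subseteq> V \<longrightarrow> card K < m \<longrightarrow> good B K" for m
  proof (induction m)
    case (Suc m)
    then obtain B where B: "\<And>K. K \<subseteq> V \<Longrightarrow> card K < m \<Longrightarrow> good B K" by blast
    have "\<exists>N. good (B(G := N)) G" if "G \<subseteq> V" "card G = m" for G
    proof (rule good_step[OF that(1)])
      fix K assume "K \<subset> G"
      moreover have "finite G" using that(1) P.finV finite_subset by blast
      ultimately show "good B K" using B[of K] psubset_card_mono[of G K] that by auto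
    qed
    then obtain N where N: "\<And>G. G \<subseteq> V \<Longrightarrow> card G = m \<Longrightarrow> good (B(G := N G)) G" by metis
    let ?B = "\<lambda>K. if K \<subseteq> V \<and> card K = m then N K else B K"
    have "good ?B K" if K: "K \<subseteq> V" "card K < Suc m" for K
    proof (cases "card K = m")
      case True
      have "good (B(K := N K)) K" using N K True by blast
      moreover have "(B(K := N K)) K' = ?B K'" if "K' \<subseteq> K" for K'
      proof (cases "K' = K")
        case False
        then have "card K' < m" using that True K(1) P.finV psubset_card_mono[of K K']
          by (auto dest: finite_subset)
        then show ?thesis using False by simp
      qed (use K True in simp)
      then have "good (B(K := N K)) K = good ?B K" by (rule good_cong)
      ultimately show ?thesis by (simp only:)
    next
      case False
      then have cK: "card K < m" using K(2) by simp
      have "good B K" using B K cK by simp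
      moreover have "B K' = ?B K'" if "K' \<subseteq> K" for K'
        using that cK card_mono[of K K'] K(1) P.finV by (auto dest: finite_subset)
      then have "good B K = good ?B K" by (rule good_cong)
      ultimately show ?thesis by (simp only:)
    qed
    then show ?case by blast
  qed simp
  from this[of "Suc (card V)"] obtain B where B: "\<And>K. K \<subseteq> V \<Longrightarrow> card K < Suc (card V) \<Longrightarrow> good B K"
    by blast
  have gB: "good B K" if "K \<subseteq> V" for K
    using B[OF that] card_mono[OF P.finV that] by simp
  have nz: "e K * b \<noteq> 0" if K: "K \<subseteq> V" "b \<in> B K i" for K i b
  proof
    assume z: "e K * b = 0"
    have fK: "finite K" using K(1) P.finV finite_subset by blast
    let ?t = "(i, b, \<lambda>_. 0)"
    have t: "?t \<in> fam K (CF B K) i" using K fK by (auto simp: fam_def CF_def)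
    have f: "finite (fam K (CF B K) i)"
      by (rule finite_fam[OF fK]) (use gB[OF K(1)] in \<open>simp add: good_def\<close>)
    have "(\<Sum>t\<in>fam K (CF B K) i. (if t = ?t then 1 else 0) *\<^sub>R fval K \<theta> ((*) (e K)) t) =
        fval K \<theta> ((*) (e K)) ?t"
      using f t by (simp add: if_distrib[of "\<lambda>r. r *\<^sub>R _"] cong: if_cong)
    also have "\<dots> = 0" using z by (simp add: fval_def)
    finally have "(if ?t = ?t then 1 else 0) = (0::real)"
      using gB[OF K(1)] t
        indep_modD[of "{0}" "fam K (CF B K) i" "fval K \<theta> ((*) (e K))" "\<lambda>t. if t = ?t then 1 else 0" ?t]
      by (auto simp: good_def)
    then show False by simp
  qed
  \<comment> \<open>By independence an element of \<open>B K\<close> is non-zero over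
    \<open>K\<close>, whereas the elements of \<open>B K'\<close> vanish there unless
    \<open>K'\<close> is contained in \<open>K\<close>. So the parts are disjoint and their sizes
    add up.\<close>
  have dis: "B K i \<inter> B K' i = {}" if "K \<subseteq> V" "K' \<subseteq> V" "\<not> K' \<subseteq> K" for K K' i
  proof -
    have "e K * b = 0" if "b \<in> B K' i" for b
    proof -
      have "B K' i \<subseteq> interior_part K' i" using gB[OF \<open>K' \<subseteq> V\<close>] by (simp add: good_def)
      then show ?thesis using that \<open>K \<subseteq> V\<close> \<open>\<not> K' \<subseteq> K\<close> by (auto simp: interior_part_def)
    qed
    then show ?thesis using nz[OF \<open>K \<subseteq> V\<close>] by blast
  qed
  have "h F i = (\<Sum>K\<in>Pow F. int (card (B K i)))" if F: "F \<subseteq> V" for F i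
  proof -
    have fF: "finite F" using F P.finV finite_subset by blast
    have fin: "finite (CF B F i)" using gB[OF F] by (simp add: good_def)
    have "card (CF B F i) = (\<Sum>K\<in>Pow F. card (B K i))"
      unfolding CF_def
    proof (rule card_UN_disjoint)
      show "\<forall>K\<in>Pow F. finite (B K i)"
      proof
        fix K assume "K \<in> Pow F"
        then have "B K i \<subseteq> CF B F i" by (auto simp: CF_def)
        then show "finite (B K i)" using fin by (rule finite_subset)
      qed
      show "\<forall>K\<in>Pow F. \<forall>K'\<in>Pow F. K \<noteq> K' \<longrightarrow> B K i \<inter> B K' i = {}"
      proof (intro ballI impI)
        fix K K' assume "K \<in> Pow F" "K' \<in> Pow F" "K \<noteq> K'"
        then consider "K \<subseteq> V" "K' \<subseteq> V" "\<not> K' \<subseteq> K" | "K \<subseteq> V" "K' \<subseteq> V" "\<not> K \<subseteq> K'" using F by blast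
        then show "B K i \<inter> B K' i = {}" using dis[of K K' i] dis[of K' K i] by cases (simp_all add: Int_commute)
      qed
    qed (use fF in simp)
    moreover have "int (card (CF B F i)) = h F i" using gB[OF F] by (simp add: good_def)
    ultimately show ?thesis by (simp flip: of_nat_sum)
  qed
  then show ?thesis by (intro exI[of _ "\<lambda>K i. card (B K i)"]) simp
qed

end

section \<open>Functions under pointwise operations as a real algebra\<close>

instantiation "fun" :: (type, real_vector) real_vector
begin

definition scaleR_fun_def: "r *\<^sub>R f = (\<lambda>x. r *\<^sub>R f x)"

instance
  by standard (simp_all add: scaleR_fun_def plus_fun_def fun_eq_iff scaleR_add_left scaleR_add_right)

end

instance "fun" :: (type, real_algebra_1) real_algebra_1
  by standard (simp_all add: scaleR_fun_def times_fun_def fun_eq_iff)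

lemma scaleR_fun_apply [simp]: "(r *\<^sub>R f) x = r *\<^sub>R f x"
  by (simp add: scaleR_fun_def)

lemma sum_fun_apply: "(sum f I) x = (\<Sum>i\<in>I. f i x)"
  by (induction I rule: infinite_finite_induct) auto

lemma prod_fun_apply: "(prod f I) x = (\<Prod>i\<in>I. f i x)"
  by (induction I rule: infinite_finite_induct) auto

lemma power_fun_apply: "(f ^ n) x = f x ^ n" for f :: "'a \<Rightarrow> 'b::monoid_mult"
  by (induction n) auto

section \<open>Hilbert functions\<close>

lemma card_multi_idx_insert:
  assumes A: "finite A" "a \<notin> A"
  shows "card (multi_idx (insert a A) k) = (\<Sum>i\<le>k. card (multi_idx A i))"
proof -
  let ?f = "\<lambda>i \<alpha>. \<alpha>(a := k - i)"
  have eq: "multi_idx (insert a A) k = (\<Union>i\<in>{..k}. ?f i ` multi_idx A i)"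
  proof (intro equalityI subsetI)
    fix \<alpha> assume \<alpha>: "\<alpha> \<in> multi_idx (insert a A) k"
    then have s: "\<alpha> a + sum \<alpha> A = k" using A by (simp add: multi_idx_def)
    have "sum (\<alpha>(a := 0)) A = sum \<alpha> A" using A by (intro sum.cong) auto
    then have "\<alpha>(a := 0) \<in> multi_idx A (sum \<alpha> A)" using \<alpha> A by (auto simp: multi_idx_def)
    moreover have "\<alpha> = ?f (sum \<alpha> A) (\<alpha>(a := 0))" using s by auto
    moreover have "sum \<alpha> A \<le> k" using s by simp
    ultimately show "\<alpha> \<in> (\<Union>i\<in>{..k}. ?f i ` multi_idx A i)" by blast
  next
    fix \<alpha> assume "\<alpha> \<in> (\<Union>i\<in>{..k}. ?f i ` multi_idx A i)"
    then obtain i \<beta> where b: "i \<le> k" "\<beta> \<in> multi_idx A i" "\<alpha> = ?f i \<beta>" by auto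
    have "sum \<alpha> A = sum \<beta> A" using A b(3) by (intro sum.cong) auto
    then show "\<alpha> \<in> multi_idx (insert a A) k" using A b by (auto simp: multi_idx_def)
  qed
  have inj: "inj_on (?f i) (multi_idx A i)" for i
  proof (rule inj_onI)
    fix \<alpha> \<beta> assume "\<alpha> \<in> multi_idx A i" "\<beta> \<in> multi_idx A i" "?f i \<alpha> = ?f i \<beta>"
    moreover then have "\<alpha> a = \<beta> a" using A by (simp add: multi_idx_def)
    ultimately show "\<alpha> = \<beta>" by (metis fun_upd_triv fun_upd_upd)
  qed
  have "card (multi_idx (insert a A) k) = (\<Sum>i\<in>{..k}. card (?f i ` multi_idx A i))"
    unfolding eq
  proof (rule card_UN_disjoint)
    show "\<forall>i\<in>{..k}. \<forall>j\<in>{..k}. i \<noteq> j \<longrightarrow> ?f i ` multi_idx A i \<inter> ?f j ` multi_idx A j = {}"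
    proof (intro ballI impI)
      fix i j assume ij: "i \<in> {..k}" "j \<in> {..k}" "i \<noteq> j"
      then have "k - i \<noteq> k - j" by auto
      then show "?f i ` multi_idx A i \<inter> ?f j ` multi_idx A j = {}"
        by (auto simp: fun_upd_eqD dest: fun_upd_eqD)
    qed
  qed (use A finite_multi_idx in auto)
  also have "\<dots> = (\<Sum>i\<le>k. card (multi_idx A i))"
    using inj by (intro sum.cong) (auto simp: card_image)
  finally show ?thesis .
qed

definition idx_fps :: "'v set \<Rightarrow> int fps" where
  "idx_fps A = Abs_fps (\<lambda>k. int (card (multi_idx A k)))"

lemma multi_idx_empty: "multi_idx {} k = (if k = 0 then {\<lambda>_. 0} else {})"
  by (auto simp: multi_idx_def)

lemma idx_fps_inverse:
  assumes "finite A"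
  shows "idx_fps A * (1 - fps_X) ^ card A = 1"
  using assms
proof (induction A)
  case empty
  then show ?case by (intro fps_ext) (simp add: idx_fps_def multi_idx_empty)
next
  case (insert a A)
  have "idx_fps (insert a A) * (1 - fps_X) = idx_fps A"
  proof (rule fps_ext)
    fix k
    show "fps_nth (idx_fps (insert a A) * (1 - fps_X)) k = fps_nth (idx_fps A) k"
      using insert by (cases k) (simp_all add: idx_fps_def card_multi_idx_insert right_diff_distrib)
  qed
  then show ?case using insert by (simp add: mult.assoc[symmetric])
qed

lemma idx_fps_split:
  assumes "finite A" "finite B" "card B \<le> card A"
  shows "idx_fps B = (1 - fps_X) ^ (card A - card B) * idx_fps A"
proof -
  define x :: "int fps" where "x = 1 - fps_X"
  have x: "idx_fps A * x ^ card A = 1" "idx_fps B * x ^ card B = 1"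
    using assms by (simp_all only: x_def idx_fps_inverse)
  have "x ^ card A = x ^ (card A - card B) * x ^ card B"
    using assms(3) by (simp add: power_add[symmetric])
  then have "idx_fps B = idx_fps B * (idx_fps A * (x ^ (card A - card B) * x ^ card B))"
    using x(1) by simp
  also have "\<dots> = idx_fps B * x ^ card B * (x ^ (card A - card B) * idx_fps A)"
    by (simp only: ac_simps)
  also have "\<dots> = x ^ (card A - card B) * idx_fps A" by (simp only: x(2) mult_1_left)
  finally show ?thesis by (simp only: x_def)
qed

text \<open>Dividing by the product of the variables of \<open>G\<close> turns monomials of support
  exactly \<open>G\<close> into arbitrary monomials in these variables.\<close>

lemma card_multi_idx_exact:
  assumes G: "finite W" "G \<subseteq> W"
  shows "card {\<alpha> \<in> multi_idx W j. {w. \<alpha> w \<noteq> 0} = G} = (if card G \<le> j then card (multi_idx G (j - card G)) else 0)"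
proof -
  have fG: "finite G" using G finite_subset by blast
  let ?E = "{\<alpha> \<in> multi_idx W j. {w. \<alpha> w \<noteq> 0} = G}"
  have E: "?E = {\<alpha> \<in> multi_idx G j. \<forall>w\<in>G. \<alpha> w \<noteq> 0}"
  proof (intro Collect_cong)
    fix \<alpha>
    show "\<alpha> \<in> multi_idx W j \<and> {w. \<alpha> w \<noteq> 0} = G \<longleftrightarrow> \<alpha> \<in> multi_idx G j \<and> (\<forall>w\<in>G. \<alpha> w \<noteq> 0)"
      using multi_idx_support[OF G, of \<alpha> j] by auto
  qed
  let ?f = "\<lambda>\<alpha> w. if w \<in> G then Suc (\<alpha> w) else 0"
  have fs: "sum (?f \<beta>) G = sum \<beta> G + card G" for \<beta>
  proof -
    have "sum (?f \<beta>) G = (\<Sum>w\<in>G. \<beta> w + 1)" by (rule sum.cong) auto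
    then show ?thesis by (simp only: sum.distrib) simp
  qed
  show ?thesis
  proof (cases "card G \<le> j")
    case True
    have "bij_betw ?f (multi_idx G (j - card G)) ?E"
      unfolding E
    proof (rule bij_betwI')
      fix x y assume "x \<in> multi_idx G (j - card G)" "y \<in> multi_idx G (j - card G)"
      then have "x w = 0" "y w = 0" if "w \<notin> G" for w using that by (auto simp: multi_idx_def)
      then show "(?f x = ?f y) = (x = y)" unfolding fun_eq_iff by (metis old.nat.inject)
    next
      fix x assume "x \<in> multi_idx G (j - card G)"
      then show "?f x \<in> {\<alpha> \<in> multi_idx G j. \<forall>w\<in>G. \<alpha> w \<noteq> 0}"
        using fs[of x] True by (simp add: multi_idx_def)
    next
      fix y assume y: "y \<in> {\<alpha> \<in> multi_idx G j. \<forall>w\<in>G. \<alpha> w \<noteq> 0}"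
      let ?x = "\<lambda>w. y w - 1"
      have yx: "y = ?f ?x" using y by (auto simp: fun_eq_iff multi_idx_def)
      have "j = sum ?x G + card G" using fs[of ?x] y yx by (simp add: multi_idx_def)
      then have "?x \<in> multi_idx G (j - card G)" using y by (simp add: multi_idx_def)
      then show "\<exists>x\<in>multi_idx G (j - card G). y = ?f x" using yx by (intro bexI[of _ ?x])
    qed
    then show ?thesis using True by (simp add: bij_betw_same_card)
  next
    case False
    have "?E = {}"
      unfolding E
    proof (rule ccontr)
      assume "{\<alpha> \<in> multi_idx G j. \<forall>w\<in>G. \<alpha> w \<noteq> 0} \<noteq> {}"
      then obtain \<alpha> where \<alpha>: "\<alpha> \<in> multi_idx G j" "\<forall>w\<in>G. \<alpha> w \<noteq> 0" by blast
      have "card G = (\<Sum>w\<in>G. 1)" by simp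
      also have "\<dots> \<le> sum \<alpha> G" using \<alpha>(2) by (intro sum_mono) (simp add: Suc_le_eq)
      finally show False using \<alpha>(1) False by (simp add: multi_idx_def)
    qed
    then show ?thesis using False by (simp only:) simp
  qed
qed

text \<open>The \<open>h\<close>-polynomial summed over faces, with the degree given explicitly; it
  agrees with \<open>h_poly\<close> when \<open>n\<close> is the rank.\<close>

definition hvec :: "'w set set \<Rightarrow> nat \<Rightarrow> int poly" where
  "hvec \<Delta> n = (\<Sum>G\<in>\<Delta>. [:0, 1:] ^ card G * [:1, -1:] ^ (n - card G))"

text \<open>The Hilbert series of a Stanley-Reisner ring: monomials of support \<open>G\<close>
  contribute \<open>t^|G| / (1-t)^|G|\<close>, brought here to the common denominator
  \<open>(1-t)^|A|\<close>.\<close>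

lemma hilbert_hvec:
  assumes W: "finite W" "finite \<Delta>" "\<And>G. G \<in> \<Delta> \<Longrightarrow> G \<subseteq> W" "\<And>G. G \<in> \<Delta> \<Longrightarrow> card G \<le> card A"
    and A: "finite A"
  shows "int (card {\<alpha> \<in> multi_idx W j. {w. \<alpha> w \<noteq> 0} \<in> \<Delta>}) =
    (\<Sum>i\<le>j. coeff (hvec \<Delta> (card A)) i * int (card (multi_idx A (j - i))))"
proof -
  have "{\<alpha> \<in> multi_idx W j. {w. \<alpha> w \<noteq> 0} \<in> \<Delta>} = (\<Union>G\<in>\<Delta>. {\<alpha> \<in> multi_idx W j. {w. \<alpha> w \<noteq> 0} = G})"
    by blast
  then have "card {\<alpha> \<in> multi_idx W j. {w. \<alpha> w \<noteq> 0} \<in> \<Delta>} =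
      (\<Sum>G\<in>\<Delta>. card {\<alpha> \<in> multi_idx W j. {w. \<alpha> w \<noteq> 0} = G})"
    using W(2) finite_multi_idx[OF W(1)] by (simp only:) (subst card_UN_disjoint, auto)
  also have "\<dots> = (\<Sum>G\<in>\<Delta>. if card G \<le> j then card (multi_idx G (j - card G)) else 0)"
    by (rule sum.cong[OF refl]) (rule card_multi_idx_exact[OF W(1,3)])
  also have "int \<dots> = (\<Sum>G\<in>\<Delta>. fps_nth (fps_X ^ card G * idx_fps G) j)"
    by (auto intro!: sum.cong simp: fps_X_power_mult_nth idx_fps_def)
  also have "\<dots> = (\<Sum>G\<in>\<Delta>. fps_nth (fps_X ^ card G * (1 - fps_X) ^ (card A - card G) * idx_fps A) j)"
  proof (rule sum.cong[OF refl])
    fix G assume "G \<in> \<Delta>"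
    then have "idx_fps G = (1 - fps_X) ^ (card A - card G) * idx_fps A"
      using W by (intro idx_fps_split[OF A]) (auto intro: finite_subset)
    then show "fps_nth (fps_X ^ card G * idx_fps G) j =
        fps_nth (fps_X ^ card G * (1 - fps_X) ^ (card A - card G) * idx_fps A) j"
      by (simp only: mult.assoc)
  qed
  also have "\<dots> = fps_nth (fps_of_poly (hvec \<Delta> (card A)) * idx_fps A) j"
  proof -
    have x: "fps_of_poly [:0, 1 :: int:] = fps_X"
      by (rule fps_ext) (simp add: coeff_pCons split: nat.split)
    have x': "fps_of_poly [:1, -1 :: int:] = 1 - fps_X"
      by (rule fps_ext) (auto simp: coeff_pCons split: nat.split)
    show ?thesis
      by (simp only: hvec_def fps_of_poly_sum fps_of_poly_mult fps_of_poly_power fps_sum_nth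
          sum_distrib_right x x')
  qed
  also have "\<dots> = (\<Sum>i\<le>j. coeff (hvec \<Delta> (card A)) i * int (card (multi_idx A (j - i))))"
    by (simp add: fps_mult_nth idx_fps_def atLeast0AtMost)
  finally show ?thesis .
qed

section \<open>Polynomial functions on a simplicial complex\<close>

text \<open>Real polynomial functions on the union of the coordinate subspaces \<open>pts \<Delta>\<close> form the
  Stanley--Reisner ring of \<open>\<Delta>\<close>. They are extended by \<open>0\<close> outside \<open>pts \<Delta>\<close>, so that distinct elements
  are distinct functions.\<close>

definition pts :: "'w set set \<Rightarrow> ('w \<Rightarrow> real) set" where
  "pts \<Delta> = {y. {w. y w \<noteq> 0} \<in> \<Delta>}"

definition var :: "'w \<Rightarrow> ('w \<Rightarrow> real) \<Rightarrow> real" where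
  "var w = (\<lambda>y. y w)"

definition ind :: "'p set \<Rightarrow> 'p \<Rightarrow> real" where
  "ind X = (\<lambda>y. if y \<in> X then 1 else 0)"

definition hpolys :: "'w set \<Rightarrow> nat \<Rightarrow> (('w \<Rightarrow> real) \<Rightarrow> real) set" where
  "hpolys W j = span (mpow var W ` multi_idx W j)"

definition srdeg :: "'w set set \<Rightarrow> 'w set \<Rightarrow> nat \<Rightarrow> (('w \<Rightarrow> real) \<Rightarrow> real) set" where
  "srdeg \<Delta> W j = (*) (ind (pts \<Delta>)) ` hpolys W j"

lemma mpow_var: "mpow var W \<alpha> y = (\<Prod>w\<in>W. y w ^ \<alpha> w)"
  by (simp add: mpow_def prod_fun_apply power_fun_apply var_def)

text \<open>The weights are the powers of \<open>N + 1\<close>: exponents bounded by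
  \<open>N\<close> are the digits of the weighted sum, and the digit of \<open>a\<close> is its
  remainder modulo \<open>N + 1\<close>.\<close>

lemma separating_weights:
  assumes "finite W"
  shows "\<exists>k :: 'w \<Rightarrow> nat. inj_on (\<lambda>\<alpha>. \<Sum>w\<in>W. \<alpha> w * k w) {\<alpha>. (\<forall>w. w \<notin> W \<longrightarrow> \<alpha> w = 0) \<and> (\<forall>w. \<alpha> w \<le> N)}"
  using assms
proof (induction W)
  case empty
  then show ?case by (auto simp: inj_on_def)
next
  case (insert a W)
  then obtain k where k: "inj_on (\<lambda>\<alpha>. \<Sum>w\<in>W. \<alpha> w * k w) {\<alpha>. (\<forall>w. w \<notin> W \<longrightarrow> \<alpha> w = 0) \<and> (\<forall>w. \<alpha> w \<le> N)}"
    by blast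
  let ?k = "\<lambda>w. if w = a then 1 else Suc N * k w"
  have eq: "(\<Sum>w\<in>insert a W. \<alpha> w * ?k w) = \<alpha> a + Suc N * (\<Sum>w\<in>W. \<alpha> w * k w)" for \<alpha>
  proof -
    have "(\<Sum>w\<in>W. \<alpha> w * ?k w) = (\<Sum>w\<in>W. Suc N * (\<alpha> w * k w))"
      using insert by (intro sum.cong refl) (auto simp del: mult_Suc)
    then show ?thesis using insert by (simp add: sum_distrib_left del: mult_Suc)
  qed
  have "inj_on (\<lambda>\<alpha>. \<Sum>w\<in>insert a W. \<alpha> w * ?k w) {\<alpha>. (\<forall>w. w \<notin> insert a W \<longrightarrow> \<alpha> w = 0) \<and> (\<forall>w. \<alpha> w \<le> N)}"
  proof (rule inj_onI)
    fix \<alpha> \<beta>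
    assume \<alpha>: "\<alpha> \<in> {\<alpha>. (\<forall>w. w \<notin> insert a W \<longrightarrow> \<alpha> w = 0) \<and> (\<forall>w. \<alpha> w \<le> N)}"
      and \<beta>: "\<beta> \<in> {\<alpha>. (\<forall>w. w \<notin> insert a W \<longrightarrow> \<alpha> w = 0) \<and> (\<forall>w. \<alpha> w \<le> N)}"
      and "(\<Sum>w\<in>insert a W. \<alpha> w * ?k w) = (\<Sum>w\<in>insert a W. \<beta> w * ?k w)"
    then have e: "\<alpha> a + Suc N * (\<Sum>w\<in>W. \<alpha> w * k w) = \<beta> a + Suc N * (\<Sum>w\<in>W. \<beta> w * k w)"
      by (simp only: eq)
    have le: "\<alpha> a < Suc N" "\<beta> a < Suc N" using \<alpha> \<beta> by (auto simp: le_imp_less_Suc)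
    have "(\<alpha> a + Suc N * (\<Sum>w\<in>W. \<alpha> w * k w)) mod Suc N = (\<beta> a + Suc N * (\<Sum>w\<in>W. \<beta> w * k w)) mod Suc N"
      using e by (simp only:)
    then have a: "\<alpha> a = \<beta> a" using le by (simp only: mod_mult_self2 mod_less)
    then have s: "(\<Sum>w\<in>W. \<alpha> w * k w) = (\<Sum>w\<in>W. \<beta> w * k w)" using e by (simp del: mult_Suc)
    have "(\<Sum>w\<in>W. (\<alpha>(a := 0)) w * k w) = (\<Sum>w\<in>W. (\<beta>(a := 0)) w * k w)"
    proof -
      have upd: "(\<Sum>w\<in>W. (\<gamma>(a := 0)) w * k w) = (\<Sum>w\<in>W. \<gamma> w * k w)" for \<gamma>
        using insert(2) by (intro sum.cong) auto
      show ?thesis by (simp only: upd s)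
    qed
    moreover have "\<alpha>(a := 0) \<in> {\<alpha>. (\<forall>w. w \<notin> W \<longrightarrow> \<alpha> w = 0) \<and> (\<forall>w. \<alpha> w \<le> N)}"
      "\<beta>(a := 0) \<in> {\<alpha>. (\<forall>w. w \<notin> W \<longrightarrow> \<alpha> w = 0) \<and> (\<forall>w. \<alpha> w \<le> N)}" using \<alpha> \<beta> by auto
    ultimately have "\<alpha>(a := 0) = \<beta>(a := 0)" by (rule inj_onD[OF k])
    then show "\<alpha> = \<beta>" using a by (metis fun_upd_triv fun_upd_upd)
  qed
  then show ?case by (intro exI[of _ ?k])
qed

text \<open>To extract the coefficient of a monomial, the relation is restricted to its own support
  face and then to a curve along which the surviving monomials become distinct powers of one
  variable.\<close>

lemma monomials_indep:
  assumes W: "finite W" and sub: "\<And>G. G \<in> \<Delta> \<Longrightarrow> G \<subseteq> W"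
  shows "indep_mod {0} {\<alpha> \<in> multi_idx W j. {w. \<alpha> w \<noteq> 0} \<in> \<Delta>} (\<lambda>\<alpha>. ind (pts \<Delta>) * mpow var W \<alpha>)"
proof (rule indep_modI)
  fix c \<beta>
  let ?I = "{\<alpha> \<in> multi_idx W j. {w. \<alpha> w \<noteq> 0} \<in> \<Delta>}"
  assume s: "(\<Sum>\<alpha>\<in>?I. c \<alpha> *\<^sub>R (ind (pts \<Delta>) * mpow var W \<alpha>)) \<in> {0}" and \<beta>: "\<beta> \<in> ?I"
  have fI: "finite ?I" using finite_multi_idx[OF W] by simp
  define G where "G = {w. \<beta> w \<noteq> 0}"
  have G: "G \<in> \<Delta>" "G \<subseteq> W" using \<beta> sub by (auto simp: G_def)
  obtain k :: "'a \<Rightarrow> nat" where k: "inj_on (\<lambda>\<alpha>. \<Sum>w\<in>W. \<alpha> w * k w) {\<alpha>. (\<forall>w. w \<notin> W \<longrightarrow> \<alpha> w = 0) \<and> (\<forall>w. \<alpha> w \<le> j)}"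
    using separating_weights[OF W] by blast
  define e where "e \<alpha> = (\<Sum>w\<in>W. \<alpha> w * k w)" for \<alpha>
  have inj: "inj_on e ?I"
    unfolding e_def
  proof (rule inj_on_subset[OF k], safe)
    fix \<alpha> w assume \<alpha>: "\<alpha> \<in> multi_idx W j"
    show "\<alpha> w \<le> j"
    proof (cases "w \<in> W")
      case True
      then have "\<alpha> w \<le> sum \<alpha> W" using W by (intro member_le_sum) auto
      then show ?thesis using \<alpha> by (simp add: multi_idx_def)
    qed (use \<alpha> in \<open>simp add: multi_idx_def\<close>)
  qed (auto simp: multi_idx_def)
  define J where "J = {\<alpha> \<in> ?I. {w. \<alpha> w \<noteq> 0} \<subseteq> G}"
  have fJ: "finite J" by (rule finite_subset[OF _ fI]) (auto simp: J_def)
  have injJ: "inj_on e J" using inj by (rule inj_on_subset) (auto simp: J_def)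
  define q where "q = (\<Sum>\<alpha>\<in>J. monom (c \<alpha>) (e \<alpha>))"
  have "poly q t = 0" if t: "t > 0" for t
  proof -
    \<comment> \<open>The point lies in the coordinate subspace of \<open>G\<close>, so monomials
      not supported in \<open>G\<close> vanish, and the others become \<open>t\<close> to their
      weight.\<close>
    define y where "y = (\<lambda>w. if w \<in> G then t ^ k w else 0)"
    have "{w. y w \<noteq> 0} = G" using t by (auto simp: y_def)
    then have yp: "y \<in> pts \<Delta>" using G by (simp add: pts_def)
    have mp: "mpow var W \<alpha> y = (if {w. \<alpha> w \<noteq> 0} \<subseteq> G then t ^ e \<alpha> else 0)" if \<alpha>: "\<alpha> \<in> ?I" for \<alpha>
    proof (cases "{w. \<alpha> w \<noteq> 0} \<subseteq> G")
      case True
      have "mpow var W \<alpha> y = (\<Prod>w\<in>W. t ^ (\<alpha> w * k w))"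
        unfolding mpow_var
      proof (rule prod.cong[OF refl])
        fix w show "y w ^ \<alpha> w = t ^ (\<alpha> w * k w)"
          using True by (cases "\<alpha> w = 0") (auto simp: y_def power_mult[symmetric] mult.commute)
      qed
      then show ?thesis using True by (simp add: e_def power_sum)
    next
      case False
      then obtain w where "\<alpha> w \<noteq> 0" "w \<notin> G" by blast
      moreover then have "w \<in> W" using \<alpha> by (auto simp: multi_idx_def)
      ultimately have "mpow var W \<alpha> y = 0"
        unfolding mpow_var using W by (intro prod_zero) (auto simp: y_def intro!: bexI[of _ w])
      then show ?thesis using False by simp
    qed
    have "0 = (\<Sum>\<alpha>\<in>?I. c \<alpha> *\<^sub>R (ind (pts \<Delta>) * mpow var W \<alpha>)) y" using s by simp
    also have "\<dots> = (\<Sum>\<alpha>\<in>?I. if {w. \<alpha> w \<noteq> 0} \<subseteq> G then c \<alpha> * t ^ e \<alpha> else 0)"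
      using mp yp by (auto simp: sum_fun_apply ind_def intro!: sum.cong)
    also have "\<dots> = (\<Sum>\<alpha>\<in>J. c \<alpha> * t ^ e \<alpha>)"
      unfolding J_def by (rule sum.inter_filter[OF fI, symmetric])
    also have "\<dots> = poly q t" by (simp add: q_def poly_sum poly_monom)
    finally show ?thesis by simp
  qed
  then have "{0<..} \<subseteq> {t. poly q t = 0}" by auto
  then have "q = 0"
    using poly_roots_finite[of q] infinite_Ioi[of "0::real"] finite_subset by blast
  moreover have "\<beta> \<in> J" using \<beta> by (simp add: J_def G_def)
  then have "coeff q (e \<beta>) = c \<beta>"
  proof -
    have "coeff q (e \<beta>) = (\<Sum>\<alpha>\<in>J. if \<alpha> = \<beta> then c \<alpha> else 0)"
      unfolding q_def coeff_sum coeff_monom using injJ \<open>\<beta> \<in> J\<close>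
      by (intro sum.cong refl) (auto dest: inj_onD)
    then show ?thesis using fJ \<open>\<beta> \<in> J\<close> by simp
  qed
  ultimately show "c \<beta> = 0" by simp
qed

lemma linear_mult_left: "linear ((*) (c :: 'm::real_algebra_1))"
  by (auto intro!: linearI simp: distrib_left)

lemma subspace_hpolys: "subspace (hpolys W j)"
  by (simp add: hpolys_def)

lemma mpow_var_hpolys: "\<alpha> \<in> multi_idx W j \<Longrightarrow> mpow var W \<alpha> \<in> hpolys W j"
  by (simp add: hpolys_def span_base)

lemma hpolys_finite_span:
  "finite W \<Longrightarrow> \<exists>F. finite F \<and> hpolys W j \<subseteq> span F"
  unfolding hpolys_def using finite_multi_idx by (intro exI[of _ "mpow var W ` multi_idx W j"]) auto

lemma var_mult_hpolys:
  assumes "finite W" "w \<in> W" "p \<in> hpolys W j"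
  shows "var w * p \<in> hpolys W (Suc j)"
  using assms(3) unfolding hpolys_def
proof (induction rule: span_induct_alt)
  case base
  show ?case by (simp only: mult_zero_right span_zero)
next
  case (step c x y)
  then obtain \<alpha> where "\<alpha> \<in> multi_idx W j" "x = mpow var W \<alpha>" by auto
  then have "var w * x \<in> mpow var W ` multi_idx W (Suc j)"
    using multi_idx_inc[OF assms(1,2), of \<alpha> j] mpow_inc[OF assms(1,2), of var \<alpha>]
    by (intro image_eqI[of _ _ "\<alpha>(w := Suc (\<alpha> w))"]) (auto simp del: fun_upd_apply)
  then have "c *\<^sub>R (var w * x) + var w * y \<in> span (mpow var W ` multi_idx W (Suc j))"
    using step by (intro span_add[OF span_scale[OF span_base]])
  then show ?case by (simp only: distrib_left mult_scaleR_right)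
qed

definition lform :: "'w set \<Rightarrow> ('w \<Rightarrow> real) \<Rightarrow> ('w \<Rightarrow> real) \<Rightarrow> real" where
  "lform W c = (\<Sum>w\<in>W. c w *\<^sub>R var w)"

lemma lform_apply: "lform W c y = (\<Sum>w\<in>W. c w * y w)"
  by (simp add: lform_def sum_fun_apply var_def)

lemma lform_mult_hpolys:
  assumes "finite W" "p \<in> hpolys W j"
  shows "lform W c * p \<in> hpolys W (Suc j)"
  unfolding lform_def sum_distrib_right using assms subspace_hpolys
  by (auto intro!: subspace_sum subspace_scale var_mult_hpolys)

lemma srdeg_mult_cong:
  assumes "m \<in> srdeg \<Delta> W j" "\<And>y. y \<in> pts \<Delta> \<Longrightarrow> f y = g y"
  shows "f * m = g * m"
  using assms by (auto simp: srdeg_def ind_def fun_eq_iff)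

lemma monomial_vanish:
  assumes W: "finite W" and down: "\<And>F G. F \<in> \<Delta> \<Longrightarrow> G \<subseteq> F \<Longrightarrow> G \<in> \<Delta>"
    and \<alpha>: "\<alpha> \<in> multi_idx W j" "{w. \<alpha> w \<noteq> 0} \<notin> \<Delta>"
  shows "ind (pts \<Delta>) * mpow var W \<alpha> = 0"
proof
  fix y
  show "(ind (pts \<Delta>) * mpow var W \<alpha>) y = 0 y"
  proof (cases "y \<in> pts \<Delta>")
    case True
    then have "\<not> {w. \<alpha> w \<noteq> 0} \<subseteq> {w. y w \<noteq> 0}" using down \<alpha>(2) by (auto simp: pts_def)
    then obtain w where w: "\<alpha> w \<noteq> 0" "y w = 0" by blast
    then have "w \<in> W" using \<alpha> by (auto simp: multi_idx_def)
    then have "mpow var W \<alpha> y = 0"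
      unfolding mpow_var using W w by (intro prod_zero) (auto intro!: bexI[of _ w])
    then show ?thesis by simp
  qed (simp add: ind_def)
qed

lemma srdeg_eq_span:
  assumes "finite W" and down: "\<And>F G. F \<in> \<Delta> \<Longrightarrow> G \<subseteq> F \<Longrightarrow> G \<in> \<Delta>"
  shows "srdeg \<Delta> W j =
    span ((\<lambda>\<alpha>. ind (pts \<Delta>) * mpow var W \<alpha>) ` {\<alpha> \<in> multi_idx W j. {w. \<alpha> w \<noteq> 0} \<in> \<Delta>})"
    (is "_ = span (?f ` ?I)")
proof -
  have "srdeg \<Delta> W j = span (?f ` multi_idx W j)"
    unfolding srdeg_def hpolys_def
    by (simp only: linear_span_image[OF linear_mult_left, symmetric] image_image)
  also have "\<dots> = span (?f ` ?I)"
  proof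
    show "span (?f ` ?I) \<subseteq> span (?f ` multi_idx W j)" by (rule real_vector.span_mono) auto
    show "span (?f ` multi_idx W j) \<subseteq> span (?f ` ?I)"
    proof (rule span_minimal)
      show "?f ` multi_idx W j \<subseteq> span (?f ` ?I)"
      proof
        fix x assume "x \<in> ?f ` multi_idx W j"
        then obtain \<alpha> where \<alpha>: "\<alpha> \<in> multi_idx W j" "x = ?f \<alpha>" by blast
        show "x \<in> span (?f ` ?I)"
        proof (cases "{w. \<alpha> w \<noteq> 0} \<in> \<Delta>")
          case True
          then have "x \<in> ?f ` ?I" using \<alpha> by (intro image_eqI[of _ _ \<alpha>]) auto
          then show ?thesis by (rule span_base)
        next
          case False
          then have "x = 0" using monomial_vanish[OF assms \<alpha>(1)] \<alpha>(2) by simp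
          then show ?thesis by (simp only: span_zero)
        qed
      qed
    qed simp
  qed
  finally show ?thesis .
qed

text \<open>Variables that are not vertices of \<open>\<Delta>\<close> vanish on
  \<open>pts \<Delta>\<close>. Restrictions to faces can thus be treated with the variables of the
  whole fan or with their own.\<close>

lemma srdeg_cong:
  assumes "finite W" "finite W'" "\<Union>\<Delta> \<subseteq> W" "\<Union>\<Delta> \<subseteq> W'" and down: "\<And>F G. F \<in> \<Delta> \<Longrightarrow> G \<subseteq> F \<Longrightarrow> G \<in> \<Delta>"
  shows "srdeg \<Delta> W j = srdeg \<Delta> W' j"
proof -
  have "srdeg \<Delta> U j = srdeg \<Delta> (\<Union>\<Delta>) j" if U: "finite U" "\<Union>\<Delta> \<subseteq> U" for U
  proof -
    have f: "finite (\<Union>\<Delta>)" by (rule finite_subset[OF U(2,1)])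
    let ?I = "\<lambda>U. {\<alpha> \<in> multi_idx U j. {w. \<alpha> w \<noteq> 0} \<in> \<Delta>}"
    have "?I U = ?I (\<Union>\<Delta>)"
    proof (rule Collect_cong)
      fix \<alpha> :: "'a \<Rightarrow> nat"
      have "\<forall>w. w \<notin> \<Union>\<Delta> \<longrightarrow> \<alpha> w = 0" if "{w. \<alpha> w \<noteq> 0} \<in> \<Delta>"
        using that by blast
      then show "\<alpha> \<in> multi_idx U j \<and> {w. \<alpha> w \<noteq> 0} \<in> \<Delta> \<longleftrightarrow>
          \<alpha> \<in> multi_idx (\<Union>\<Delta>) j \<and> {w. \<alpha> w \<noteq> 0} \<in> \<Delta>"
        unfolding multi_idx_support[OF U] by argo
    qed
    moreover have "mpow var U \<alpha> = mpow var (\<Union>\<Delta>) \<alpha>" if "\<alpha> \<in> ?I (\<Union>\<Delta>)" for \<alpha>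
      using that by (intro mpow_cong_support[OF U]) (auto simp: multi_idx_def)
    ultimately have "(\<lambda>\<alpha>. ind (pts \<Delta>) * mpow var U \<alpha>) ` ?I U =
        (\<lambda>\<alpha>. ind (pts \<Delta>) * mpow var (\<Union>\<Delta>) \<alpha>) ` ?I (\<Union>\<Delta>)"
      by (intro image_cong arg_cong[where f = "(*) _"]) auto
    then show ?thesis
      by (simp only: srdeg_eq_span[OF U(1) down] srdeg_eq_span[OF f down])
  qed
  then show ?thesis using assms(1-4) by simp
qed

lemma low_cong:
  assumes "\<And>v m j. v \<in> V \<Longrightarrow> m \<in> M j \<Longrightarrow> \<theta> v * m = \<theta>' v * m"
  shows "low V \<theta> M j = low V \<theta>' M j"
proof (cases j)
  case (Suc i)
  have "(\<Union>v\<in>V. (*) (\<theta> v) ` M i) = (\<Union>v\<in>V. (*) (\<theta>' v) ` M i)"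
    using assms by (intro SUP_cong refl image_cong) auto
  then show ?thesis by (simp add: low_def Suc)
qed (simp add: low_0)

lemma graded_srdeg:
  assumes "finite W" "finite A"
  shows "graded_module A (\<lambda>a. lform W (c a)) (srdeg \<Delta> W)"
proof
  show "finite A" by (rule assms)
  show "subspace (srdeg \<Delta> W j)" for j
    unfolding srdeg_def by (intro linear_subspace_image linear_mult_left subspace_hpolys)
  show "lform W (c a) * m \<in> srdeg \<Delta> W (Suc j)" if m: "m \<in> srdeg \<Delta> W j" for a m j
  proof -
    obtain p where "p \<in> hpolys W j" "m = ind (pts \<Delta>) * p" using m by (auto simp: srdeg_def)
    then show ?thesis using lform_mult_hpolys[OF assms(1), of p j "c a"]
      by (auto simp: srdeg_def mult.left_commute intro!: image_eqI[of _ _ "lform W (c a) * p"])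
  qed
  show "\<exists>F. finite F \<and> srdeg \<Delta> W j \<subseteq> span F" for j
  proof -
    obtain X where "finite X" "hpolys W j \<subseteq> span X" using hpolys_finite_span[OF assms(1)] by blast
    then show ?thesis
      by (intro exI[of _ "(*) (ind (pts \<Delta>)) ` X"])
        (auto simp: srdeg_def linear_span_image[OF linear_mult_left])
  qed
qed

lemma hilbert_srdeg:
  assumes W: "finite W" "\<Union>\<Delta> \<subseteq> W" and A: "finite A"
    and D: "abstract_complex \<Delta>" "\<And>G. G \<in> \<Delta> \<Longrightarrow> card G \<le> card A"
    and gm: "graded_module A \<theta> (srdeg \<Delta> W)"
  shows "graded_module.hilbert A (srdeg \<Delta> W) (coeff (hvec \<Delta> (card A)))"
  unfolding graded_module.hilbert_def[OF gm]
proof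
  fix j
  let ?I = "{\<alpha> \<in> multi_idx W j. {w. \<alpha> w \<noteq> 0} \<in> \<Delta>}"
  have f: "finite ?I" using finite_multi_idx[OF W(1)] by simp
  have sub: "G \<subseteq> W" if "G \<in> \<Delta>" for G using W(2) that by blast
  have "dim (srdeg \<Delta> W j) = card ?I"
    using indep_mod_0_dim[OF f monomials_indep[OF W(1) sub]] srdeg_eq_span[OF W(1), of \<Delta> j] D(1)
    unfolding abstract_complex_def by simp
  then show "int (dim (srdeg \<Delta> W j)) =
      (\<Sum>i\<le>j. coeff (hvec \<Delta> (card A)) i * int (card (multi_idx A (j - i))))"
    using hilbert_hvec[OF W(1) _ sub D(2) A] D(1) by (simp add: abstract_complex_def)
qed

section \<open>Fans\<close>

definition ncone :: "'e::real_vector set \<Rightarrow> 'e set" where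
  "ncone A = {p. \<exists>c. (\<forall>a\<in>A. 0 \<le> c a) \<and> p = (\<Sum>a\<in>A. c a *\<^sub>R a)}"

text \<open>Only the values on the span of \<open>S\<close> are determined; the extension beyond it
  is an arbitrary choice.\<close>

definition dual :: "'e::real_vector set \<Rightarrow> 'e \<Rightarrow> 'e \<Rightarrow> real" where
  "dual S w = (SOME g. linear g \<and> (\<forall>u\<in>S. g u = (if u = w then 1 else 0)))"

lemma dual_props:
  assumes "independent S"
  shows "linear (dual S w)" "\<And>u. u \<in> S \<Longrightarrow> dual S w u = (if u = w then 1 else 0)"
proof -
  have "\<exists>g. linear g \<and> (\<forall>u\<in>S. g u = (if u = w then 1 else (0::real)))"
    by (rule linear_independent_extend[OF assms])
  from someI_ex[OF this] show "linear (dual S w)" "\<And>u. u \<in> S \<Longrightarrow> dual S w u = (if u = w then 1 else 0)"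
    by (auto simp: dual_def)
qed

lemma dual_comb:
  assumes "independent S" "finite S" "w \<in> S"
  shows "dual S w (\<Sum>u\<in>S. c u *\<^sub>R u) = c w"
proof -
  have "dual S w (\<Sum>u\<in>S. c u *\<^sub>R u) = (\<Sum>u\<in>S. c u * dual S w u)"
    using dual_props(1)[OF assms(1)] by (simp add: linear_sum linear_scale)
  also have "\<dots> = (\<Sum>u\<in>S. if u = w then c u else 0)"
    using dual_props(2)[OF assms(1)] by (intro sum.cong) auto
  finally show ?thesis using assms by simp
qed

lemma dual_sum:
  assumes "independent S" "finite S" "p \<in> span S"
  shows "(\<Sum>w\<in>S. dual S w p *\<^sub>R w) = p"
proof -
  obtain c where c: "p = (\<Sum>u\<in>S. c u *\<^sub>R u)"
    using assms(3) in_span_image[OF assms(2), of p "\<lambda>x. x"] by auto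
  show ?thesis using dual_comb[OF assms(1,2)] by (simp add: c cong: sum.cong)
qed

lemma ncone_span: "ncone A \<subseteq> span A"
proof
  fix p assume "p \<in> ncone A"
  then obtain c where "p = (\<Sum>a\<in>A. c a *\<^sub>R a)" by (auto simp: ncone_def)
  moreover have "(\<Sum>a\<in>A. c a *\<^sub>R a) \<in> span A" by (intro span_sum span_scale span_base)
  ultimately show "p \<in> span A" by simp
qed

lemma ncone_iff_dual:
  assumes "independent S" "finite S"
  shows "p \<in> ncone S \<longleftrightarrow> p \<in> span S \<and> (\<forall>w\<in>S. 0 \<le> dual S w p)"
proof
  assume "p \<in> ncone S"
  then show "p \<in> span S \<and> (\<forall>w\<in>S. 0 \<le> dual S w p)"
    using ncone_span dual_comb[OF assms] by (auto simp: ncone_def)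
next
  assume "p \<in> span S \<and> (\<forall>w\<in>S. 0 \<le> dual S w p)"
  then show "p \<in> ncone S"
    using dual_sum[OF assms, of p] by (auto simp: ncone_def intro!: exI[of _ "\<lambda>w. dual S w p"])
qed

lemma ncone_add: "p \<in> ncone A \<Longrightarrow> q \<in> ncone A \<Longrightarrow> p + q \<in> ncone A"
proof -
  assume "p \<in> ncone A" "q \<in> ncone A"
  then obtain c d where "\<forall>a\<in>A. 0 \<le> c a" "p = (\<Sum>a\<in>A. c a *\<^sub>R a)" "\<forall>a\<in>A. 0 \<le> d a" "q = (\<Sum>a\<in>A. d a *\<^sub>R a)"
    by (auto simp: ncone_def)
  then show ?thesis
    by (auto simp: ncone_def sum.distrib scaleR_add_left intro!: exI[of _ "\<lambda>a. c a + d a"])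
qed

lemma ncone_scale: "0 \<le> r \<Longrightarrow> p \<in> ncone A \<Longrightarrow> r *\<^sub>R p \<in> ncone A"
proof -
  assume r: "0 \<le> r" and "p \<in> ncone A"
  then obtain c where "\<forall>a\<in>A. 0 \<le> c a" "p = (\<Sum>a\<in>A. c a *\<^sub>R a)" by (auto simp: ncone_def)
  then show ?thesis using r
    by (auto simp: ncone_def scaleR_sum_right intro!: exI[of _ "\<lambda>a. r * c a"])
qed

lemma ncone_0: "0 \<in> ncone A"
  by (auto simp: ncone_def intro!: exI[of _ "\<lambda>_. 0"])

lemma ncone_sum: "(\<And>i. i \<in> I \<Longrightarrow> f i \<in> ncone A) \<Longrightarrow> sum f I \<in> ncone A"
  by (induction I rule: infinite_finite_induct) (auto simp: ncone_0 ncone_add)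

lemma ncone_subset: "S \<subseteq> ncone A \<Longrightarrow> ncone S \<subseteq> ncone A"
  by (auto simp: ncone_def[of S] intro!: ncone_sum ncone_scale)

lemma in_ncone: "finite A \<Longrightarrow> a \<in> A \<Longrightarrow> a \<in> ncone A"
  by (auto simp: ncone_def if_distrib[of "\<lambda>r. r *\<^sub>R _"] cong: if_cong
      intro!: exI[of _ "\<lambda>b. if b = a then 1 else 0"])

lemma ncone_mono: "finite A \<Longrightarrow> B \<subseteq> A \<Longrightarrow> ncone B \<subseteq> ncone A"
  using in_ncone by (intro ncone_subset) auto

text \<open>The \<open>y w\<close> are the piecewise linear coordinates of \<open>p\<close>; their support is the smallest cone
  containing \<open>p\<close>, so that \<open>fan\<close> asks for a partition of \<open>ncone A\<close> into relatively open cones.\<close>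

definition repr :: "'e::real_vector set set \<Rightarrow> ('e \<Rightarrow> real) \<Rightarrow> 'e \<Rightarrow> bool" where
  "repr \<Delta> y p \<longleftrightarrow> (\<forall>w. 0 \<le> y w) \<and> {w. y w \<noteq> 0} \<in> \<Delta> \<and> p = (\<Sum>w\<in>\<Union>\<Delta>. y w *\<^sub>R w)"

definition fan :: "'e::euclidean_space set \<Rightarrow> 'e set set \<Rightarrow> bool" where
  "fan A \<Delta> \<longleftrightarrow> finite A \<and> independent A \<and> abstract_complex \<Delta> \<and> \<Union>\<Delta> \<subseteq> ncone A \<and>
     (\<forall>p\<in>ncone A. \<exists>!y. repr \<Delta> y p)"

lemma sum_support:
  fixes f :: "'a \<Rightarrow> 'b::real_vector"
  assumes "finite W" "S \<subseteq> W" "\<And>w. w \<notin> S \<Longrightarrow> y w = (0::real)"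
  shows "(\<Sum>w\<in>W. y w *\<^sub>R f w) = (\<Sum>w\<in>S. y w *\<^sub>R f w)"
  using assms by (intro sum.mono_neutral_right) auto

text \<open>On a curve with coordinates distinct powers of \<open>t\<close>, each functional becomes
  a non-zero polynomial in \<open>t\<close>. Only finitely many \<open>t\<close> are bad, and
  \<open>t > 0\<close> keeps the point in the cone.\<close>

lemma generic_vector:
  fixes A :: "'e::real_vector set"
  assumes A: "finite A" and H: "finite H" "\<And>g. g \<in> H \<Longrightarrow> linear g" "\<And>g. g \<in> H \<Longrightarrow> \<exists>a\<in>A. g a \<noteq> (0::real)"
  shows "\<exists>q\<in>ncone A. \<forall>g\<in>H. g q \<noteq> 0"
proof -
  obtain idx :: "'e \<Rightarrow> nat" where idx: "inj_on idx A"
    using finite_imp_inj_to_nat_seg[OF A] by blast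
  define q where "q t = (\<Sum>a\<in>A. t ^ idx a *\<^sub>R a)" for t :: real
  define P where "P g = (\<Sum>a\<in>A. monom (g a) (idx a))" for g :: "'e \<Rightarrow> real"
  have P: "poly (P g) t = g (q t)" if "g \<in> H" for g t
    using H(2)[OF that] by (simp add: P_def q_def poly_sum poly_monom linear_sum linear_scale mult.commute)
  have "P g \<noteq> 0" if g: "g \<in> H" for g
  proof -
    obtain a where a: "a \<in> A" "g a \<noteq> 0" using H(3)[OF g] by blast
    have "coeff (P g) (idx a) = (\<Sum>b\<in>A. if b = a then g b else 0)"
      unfolding P_def coeff_sum coeff_monom using idx a by (intro sum.cong refl) (auto dest: inj_onD)
    then have "coeff (P g) (idx a) = g a" using A a by simp
    then show ?thesis using a by auto
  qed
  then have "finite (\<Union>g\<in>H. {t. poly (P g) t = 0})"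
    using H(1) by (auto intro: poly_roots_finite)
  then obtain t where t: "t > 0" "t \<notin> (\<Union>g\<in>H. {t. poly (P g) t = 0})"
    using infinite_Ioi[of "0::real"] by (metis finite_subset greaterThan_iff subsetI)
  have "q t \<in> ncone A" using t(1) by (auto simp: q_def ncone_def intro!: exI[of _ "\<lambda>a. t ^ idx a"])
  moreover have "g (q t) \<noteq> 0" if "g \<in> H" for g using t(2) P[OF that] that by auto
  ultimately show ?thesis by blast
qed

section \<open>Representations, independence and purity in a fan\<close>

locale fan_loc =
  fixes A :: "'e::euclidean_space set" and \<Delta> :: "'e set set"
  assumes fan: "fan A \<Delta>"
begin

abbreviation W where "W \<equiv> \<Union>\<Delta>"

lemma finA: "finite A" and indA: "independent A" and cpx: "abstract_complex \<Delta>" and W_cone: "W \<subseteq> ncone A"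
  using fan by (auto simp: fan_def)

lemma finD: "finite \<Delta>" and emptyD: "{} \<in> \<Delta>" and fin_face: "F \<in> \<Delta> \<Longrightarrow> finite F"
  and down: "F \<in> \<Delta> \<Longrightarrow> G \<subseteq> F \<Longrightarrow> G \<in> \<Delta>"
  using cpx by (auto simp: abstract_complex_def)

lemma finW: "finite W" using finD fin_face by blast

lemma face_sub: "F \<in> \<Delta> \<Longrightarrow> F \<subseteq> W" by blast

lemma ex_repr: "p \<in> ncone A \<Longrightarrow> \<exists>y. repr \<Delta> y p"
  using fan by (auto simp: fan_def)

lemma repr_unique: "repr \<Delta> y p \<Longrightarrow> repr \<Delta> y' p \<Longrightarrow> y = y'"
proof -
  assume a: "repr \<Delta> y p" "repr \<Delta> y' p"
  then have "p \<in> ncone A" using W_cone by (auto simp: repr_def intro!: ncone_sum ncone_scale)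
  then show ?thesis using a fan by (auto simp: fan_def)
qed

lemma repr_face:
  assumes S: "S \<in> \<Delta>" and c: "\<And>w. w \<in> S \<Longrightarrow> 0 \<le> c w"
  shows "repr \<Delta> (\<lambda>w. if w \<in> S then c w else 0) (\<Sum>w\<in>S. c w *\<^sub>R w)"
proof -
  let ?y = "\<lambda>w. if w \<in> S then c w else 0"
  have "{w. ?y w \<noteq> 0} \<in> \<Delta>" by (rule down[OF S]) auto
  moreover have "(\<Sum>w\<in>W. ?y w *\<^sub>R w) = (\<Sum>w\<in>S. c w *\<^sub>R w)"
    using sum_support[OF finW face_sub[OF S], of ?y "\<lambda>w. w"] by simp
  ultimately show ?thesis using c by (auto simp: repr_def)
qed

lemma face_unique:
  assumes "S \<in> \<Delta>" "T \<in> \<Delta>" "\<And>w. w \<in> S \<Longrightarrow> 0 \<le> c w" "\<And>w. w \<in> T \<Longrightarrow> 0 \<le> d w"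
    and "(\<Sum>w\<in>S. c w *\<^sub>R w) = (\<Sum>w\<in>T. d w *\<^sub>R w)"
  shows "(if w \<in> S then c w else 0) = (if w \<in> T then d w else 0)"
proof -
  have "repr \<Delta> (\<lambda>w. if w \<in> S then c w else 0) (\<Sum>w\<in>S. c w *\<^sub>R w)"
    using assms(1,3) by (rule repr_face)
  moreover have "repr \<Delta> (\<lambda>w. if w \<in> T then d w else 0) (\<Sum>w\<in>S. c w *\<^sub>R w)"
    unfolding assms(5) using assms(2,4) by (rule repr_face)
  ultimately have "(\<lambda>w. if w \<in> S then c w else 0) = (\<lambda>w. if w \<in> T then d w else 0)"
    by (rule repr_unique)
  from fun_cong[OF this, of w] show ?thesis .
qed

text \<open>Adding a large constant to all coefficients of a relation gives two non-negative
  representations of one vector, which must coincide.\<close>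

lemma face_indep:
  assumes S: "S \<in> \<Delta>"
  shows "independent S"
  unfolding real_vector.independent_explicit_finite_subsets
proof (intro allI impI ballI)
  fix B u v assume B: "B \<subseteq> S" "finite B" and s: "(\<Sum>v\<in>B. u v *\<^sub>R v) = 0" and v: "v \<in> B"
  define K where "K = (\<Sum>w\<in>B. \<bar>u w\<bar>)"
  have K: "\<bar>u w\<bar> \<le> K" if "w \<in> B" for w
    unfolding K_def using that B(2) by (intro member_le_sum) auto
  have BD: "B \<in> \<Delta>" using down[OF S B(1)] .
  have "(\<Sum>w\<in>B. K *\<^sub>R w) = (\<Sum>w\<in>B. (K + u w) *\<^sub>R w)"
    using s by (simp add: scaleR_add_left sum.distrib)
  moreover have "0 \<le> K" using K[OF v] by simp
  moreover have "0 \<le> K + u w" if "w \<in> B" for w using K[OF that] by linarith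
  ultimately have "(if v \<in> B then K else 0) = (if v \<in> B then K + u v else 0)"
    by (intro face_unique[OF BD BD]) auto
  then show "u v = 0" using v by simp
qed

lemma face_span: "S \<in> \<Delta> \<Longrightarrow> S \<subseteq> span A"
  using W_cone ncone_span by blast

lemma face_card: "S \<in> \<Delta> \<Longrightarrow> card S \<le> card A"
  using real_vector.independent_span_bound[OF finA face_indep face_span] by blast

lemma facet_span:
  assumes "S \<in> \<Delta>" "card S = card A"
  shows "span S = span A"
proof (rule subspace_dim_equal)
  show "span S \<subseteq> span A" using face_span[OF assms(1)] by (simp add: span_minimal)
  show "dim (span A) \<le> dim (span S)"
    using assms(2) indA face_indep[OF assms(1)] by (simp add: dim_eq_card_independent)
qed auto

text \<open>From a generic \<open>q\<close> one moves far in the direction \<open>s\<close> interior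
  to the cone of \<open>G\<close>. Some cone contains infinitely many of the points reached. It
  contains \<open>q\<close> in its span, so it is full-dimensional, and in the limit it contains
  \<open>s\<close>, so \<open>G\<close> is a face of it.\<close>

lemma pure:
  assumes G: "G \<in> \<Delta>"
  shows "\<exists>S\<in>\<Delta>. G \<subseteq> S \<and> card S = card A"
proof -
  \<comment> \<open>The faces that are too small: each lies in a hyperplane not containing all of
    \<open>A\<close>, and \<open>q\<close> is chosen off these hyperplanes.\<close>
  let ?Sm = "{T\<in>\<Delta>. card T \<noteq> card A}"
  have "\<exists>g. linear g \<and> (\<forall>u\<in>T. g u = 0) \<and> (\<exists>a\<in>A. g a \<noteq> (0::real))" if T: "T \<in> ?Sm" for T
  proof -
    have lt: "card T < card A" using face_card[of T] T by auto
    have "\<not> A \<subseteq> span T"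
    proof
      assume "A \<subseteq> span T"
      then have "card A \<le> card T"
        using real_vector.independent_span_bound[of T A] fin_face[of T] T indA by auto
      then show False using lt by simp
    qed
    then obtain a where a: "a \<in> A" "a \<notin> span T" by blast
    have "independent (insert a T)" using a face_indep[of T] T by (simp add: independent_insert)
    then obtain g where g: "linear g" "\<forall>u\<in>insert a T. g u = (if u = a then 1 else (0::real))"
      using linear_independent_extend[of "insert a T" "\<lambda>u. if u = a then 1 else (0::real)"] by blast
    have "a \<notin> T" using a by (auto intro: span_base)
    then have "\<forall>u\<in>T. g u = 0" "g a \<noteq> 0" using g(2) by auto
    then show ?thesis using g(1) a(1) by blast
  qed
  then have "\<forall>T\<in>?Sm. \<exists>g. linear g \<and> (\<forall>u\<in>T. g u = 0) \<and> (\<exists>a\<in>A. g a \<noteq> (0::real))" by blast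
  from bchoice[OF this] obtain g where
    g: "\<forall>T\<in>?Sm. linear (g T) \<and> (\<forall>u\<in>T. g T u = 0) \<and> (\<exists>a\<in>A. g T a \<noteq> (0::real))" by blast
  obtain q where q: "q \<in> ncone A" "\<forall>h\<in>g ` ?Sm. h q \<noteq> 0"
    using generic_vector[OF finA, of "g ` ?Sm"] finD g by auto
  define s where "s = (\<Sum>w\<in>G. w)"
  have sA: "s \<in> ncone A" unfolding s_def using W_cone face_sub[OF G] by (intro ncone_sum) auto
  define r where "r N = q + real N *\<^sub>R s" for N
  have rA: "r N \<in> ncone A" for N
    unfolding r_def using q(1) sA by (intro ncone_add ncone_scale) auto
  define Y where "Y N = (SOME y. repr \<Delta> y (r N))" for N
  have Y: "repr \<Delta> (Y N) (r N)" for N unfolding Y_def by (rule someI_ex[OF ex_repr[OF rA]])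
  define T where "T N = {w. Y N w \<noteq> 0}" for N
  have T: "T N \<in> \<Delta>" for N using Y by (simp add: T_def repr_def)
  have rT: "r N = (\<Sum>w\<in>T N. Y N w *\<^sub>R w)" for N
    using Y[of N] sum_support[OF finW face_sub[OF T], of N "Y N" "\<lambda>w. w"] by (simp add: T_def repr_def)
  have "finite (range T)" using finD T by (metis finite_subset image_subsetI)
  then obtain N0 where inf: "infinite {N \<in> UNIV. T N = T N0}"
    using pigeonhole_infinite[of UNIV T] by auto
  define S where "S = T N0"
  have S: "S \<in> \<Delta>" "independent S" "finite S" using T face_indep fin_face by (auto simp: S_def)
  have rS: "r N \<in> span S" if "T N = S" for N
    unfolding rT that by (intro span_sum span_scale span_base)
  obtain N1 where N1: "T N1 = S" "N1 \<noteq> N0"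
  proof -
    have "infinite ({N \<in> UNIV. T N = T N0} - {N0})" using inf by simp
    then have "{N \<in> UNIV. T N = T N0} - {N0} \<noteq> {}" by (metis finite.emptyI)
    then show ?thesis using that by (auto simp: S_def)
  qed
  \<comment> \<open>Two points of the ray in the same span recover its direction \<open>s\<close>,
    and then its starting point \<open>q\<close>.\<close>
  have "r N1 - r N0 \<in> span S" using rS N1(1) S_def by (intro span_diff) auto
  moreover have "r N1 - r N0 = (real N1 - real N0) *\<^sub>R s" by (simp add: r_def scaleR_diff_left)
  moreover have "(1 / (real N1 - real N0)) *\<^sub>R ((real N1 - real N0) *\<^sub>R s) = s"
    using N1(2) by simp
  ultimately have sS: "s \<in> span S" by (metis span_scale)
  have "r N0 - real N0 *\<^sub>R s \<in> span S" using rS[of N0] sS by (intro span_diff span_scale) (auto simp: S_def)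
  then have qS: "q \<in> span S" by (simp add: r_def)
  have cS: "card S = card A"
  proof (rule ccontr)
    assume "card S \<noteq> card A"
    then have Sm: "S \<in> ?Sm" using S(1) by simp
    then have "linear (g S)" "\<forall>u\<in>S. g S u = 0" using g by auto
    then have "g S q = 0" using qS linear_eq_0_on_span[of "g S" S q] by blast
    then show False using q(2) Sm by auto
  qed
  \<comment> \<open>Along the ray the coordinate of \<open>w\<close> is affine in \<open>N\<close>
    with slope \<open>dual S w s\<close>; a negative slope would make it negative at one of the
    infinitely many points that lie in the cone.\<close>
  have nn: "0 \<le> dual S w s" if w: "w \<in> S" for w
  proof (rule ccontr)
    assume "\<not> 0 \<le> dual S w s"
    then have neg: "dual S w s < 0" by simp
    obtain M :: nat where M: "real M > dual S w q / (- dual S w s)" using reals_Archimedean2 by blast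
    have "infinite ({N \<in> UNIV. T N = T N0} - {..M})" using inf by simp
    then have "{N \<in> UNIV. T N = T N0} - {..M} \<noteq> {}" by (metis finite.emptyI)
    then obtain N where "T N = T N0" "\<not> N \<le> M" by auto
    then have N: "T N = S" "M < N" by (auto simp: S_def)
    have "dual S w (r N) = Y N w"
      using rT[of N] N(1) dual_comb[OF S(2,3) w, of "Y N"] by simp
    then have "0 \<le> dual S w (r N)" using Y[of N] by (simp add: repr_def)
    also have "dual S w (r N) = dual S w q + real N * dual S w s"
      using dual_props(1)[OF S(2), of w] by (simp add: r_def linear_add linear_scale)
    finally have "real N * (- dual S w s) \<le> dual S w q" by simp
    moreover have "0 < - dual S w s" using neg by simp
    ultimately have "real N \<le> dual S w q / (- dual S w s)" by (simp only: pos_le_divide_eq)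
    then show False using M N(2) by linarith
  qed
  have "G \<subseteq> S"
  proof
    fix w assume w: "w \<in> G"
    have "(\<Sum>w\<in>G. 1 *\<^sub>R w) = (\<Sum>w\<in>S. dual S w s *\<^sub>R w)"
      using dual_sum[OF S(2,3) sS] by (simp add: s_def)
    then have "(if w \<in> G then 1 else 0) = (if w \<in> S then dual S w s else 0)"
      using nn by (intro face_unique[OF G S(1)]) auto
    then show "w \<in> S" using w by (auto split: if_splits)
  qed
  then show ?thesis using S(1) cS by blast
qed

end

section \<open>Freeness for regular fans\<close>

definition fan_cm :: "'e::euclidean_space set \<Rightarrow> 'e set set \<Rightarrow> bool" where
  "fan_cm A \<Delta> \<longleftrightarrow> graded_module.cm A (\<lambda>a. lform (\<Union>\<Delta>) (dual A a)) (srdeg \<Delta> (\<Union>\<Delta>))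
     (coeff (hvec \<Delta> (card A)))"

lemma sum_Pow_binomial:
  fixes x y :: "'r::comm_ring_1"
  assumes "finite D"
  shows "(\<Sum>G\<in>Pow D. x ^ card G * y ^ (card D - card G)) = (x + y) ^ card D"
  using assms
proof (induction D)
  case (insert a D)
  have inj: "inj_on (insert a) (Pow D)" using insert(2) by (auto simp: inj_on_def)
  have fin: "finite G" if "G \<subseteq> D" for G using that insert(1) finite_subset by blast
  have "(\<Sum>G\<in>Pow (insert a D). x ^ card G * y ^ (card (insert a D) - card G)) =
      (\<Sum>G\<in>Pow D. x ^ card G * y ^ (card (insert a D) - card G)) +
      (\<Sum>G\<in>insert a ` Pow D. x ^ card G * y ^ (card (insert a D) - card G))"
    unfolding Pow_insert using insert by (intro sum.union_disjoint) auto
  also have "(\<Sum>G\<in>insert a ` Pow D. x ^ card G * y ^ (card (insert a D) - card G)) =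
      (\<Sum>G\<in>Pow D. x * (x ^ card G * y ^ (card D - card G)))"
    unfolding sum.reindex[OF inj] o_def
  proof (rule sum.cong[OF refl])
    fix G assume "G \<in> Pow D"
    then have "card (insert a G) = Suc (card G)" using insert(2) fin by (subst card_insert_disjoint) auto
    then show "x ^ card (insert a G) * y ^ (card (insert a D) - card (insert a G)) =
        x * (x ^ card G * y ^ (card D - card G))"
      using insert by (simp add: mult.assoc)
  qed
  also have "(\<Sum>G\<in>Pow D. x ^ card G * y ^ (card (insert a D) - card G)) =
      (\<Sum>G\<in>Pow D. y * (x ^ card G * y ^ (card D - card G)))"
  proof (rule sum.cong[OF refl])
    fix G assume "G \<in> Pow D"
    then have "card G \<le> card D" using insert(1) by (simp add: card_mono)
    then show "x ^ card G * y ^ (card (insert a D) - card G) =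
        y * (x ^ card G * y ^ (card D - card G))"
      using insert by (simp add: Suc_diff_le ac_simps)
  qed
  finally show ?case
    using insert(1,2) by (simp only: insert.IH sum_distrib_left[symmetric]) (simp add: distrib_right add.commute)
qed simp

context fan_loc
begin

lemma graded_W: "graded_module A (\<lambda>a. lform W (dual A a)) (srdeg \<Delta> W)"
  by (rule graded_srdeg[OF finW finA])

text \<open>Since \<open>A\<close> spans all vertices, the form of any linear functional is a
  combination of the parameters; so a product with such a form is available when reducing modulo
  \<open>low\<close>.\<close>

lemma lform_comb:
  assumes g: "linear g"
  shows "lform W g = (\<Sum>a\<in>A. g a *\<^sub>R lform W (dual A a))"
proof
  fix y
  have gw: "g w = (\<Sum>a\<in>A. g a * dual A a w)" if "w \<in> W" for w
  proof -
    have "w \<in> span A" using W_cone ncone_span that by blast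
    from dual_sum[OF indA finA this] have "g w = g (\<Sum>a\<in>A. dual A a w *\<^sub>R a)" by simp
    then show ?thesis using g by (simp add: linear_sum linear_scale mult.commute)
  qed
  have "lform W g y = (\<Sum>w\<in>W. \<Sum>a\<in>A. g a * dual A a w * y w)"
    by (simp add: lform_apply gw sum_distrib_right)
  also have "\<dots> = (\<Sum>a\<in>A. \<Sum>w\<in>W. g a * dual A a w * y w)" by (rule sum.swap)
  finally show "lform W g y = (\<Sum>a\<in>A. g a *\<^sub>R lform W (dual A a)) y"
    by (simp add: sum_fun_apply lform_apply sum_distrib_left mult.assoc)
qed

definition facets where "facets = {S\<in>\<Delta>. card S = card A}"

definition regular :: "('e \<Rightarrow> real) \<Rightarrow> bool" where
  "regular \<psi> \<longleftrightarrow> (\<forall>S\<in>facets. \<exists>L. linear L \<and> (\<forall>w\<in>S. L w = \<psi> w) \<and> (\<forall>w\<in>W - S. L w < \<psi> w))"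

text \<open>A generic vector \<open>q\<close> orders the facets by the value at \<open>q\<close> of the linear function supporting \<open>\<psi>\<close>
  there. This is a shelling, and \<open>U S\<close> is the minimal new face of the facet \<open>S\<close>, which contributes
  the generator \<open>\<Prod>w\<in>U S. var w\<close>.\<close>
lemma regular_cm:
  assumes reg: "regular \<psi>"
  shows "fan_cm A \<Delta>"
proof -
  have fF: "finite facets" using finD by (simp add: facets_def)
  have facet: "S \<in> \<Delta>" "card S = card A" "independent S" "finite S" "span S = span A" if "S \<in> facets" for S
    using that face_indep fin_face facet_span by (auto simp: facets_def)
  obtain L where L: "\<forall>S\<in>facets. linear (L S) \<and> (\<forall>w\<in>S. L S w = \<psi> w) \<and> (\<forall>w\<in>W - S. L S w < \<psi> w)"
    using bchoice[OF reg[unfolded regular_def]] by blast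
  have Lin: "linear (L S)" and L1: "w \<in> S \<Longrightarrow> L S w = \<psi> w" and L2: "w \<in> W \<Longrightarrow> w \<notin> S \<Longrightarrow> L S w < \<psi> w"
    if "S \<in> facets" for S w using L that by auto
  have L3: "L S w \<le> \<psi> w" if "S \<in> facets" "w \<in> W" for S w
    using L1[OF that(1), of w] L2[OF that] by (cases "w \<in> S") auto
  have dnz: "\<exists>a\<in>A. dual S w a \<noteq> 0" if "S \<in> facets" "w \<in> S" for S w
  proof (rule ccontr)
    assume "\<not> (\<exists>a\<in>A. dual S w a \<noteq> 0)"
    moreover have "w \<in> span A" using facet(5)[OF that(1)] that(2) by (metis span_base)
    ultimately have "dual S w w = 0"
      using linear_eq_0_on_span[OF dual_props(1)[OF facet(3)[OF that(1)]], of A w w] by blast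
    then show False using dual_props(2)[OF facet(3)[OF that(1)] that(2)] by simp
  qed
  have "\<exists>q\<in>ncone A. \<forall>g\<in>(\<lambda>(S, w). dual S w) ` (SIGMA S:facets. S). g q \<noteq> 0"
  proof (rule generic_vector[OF finA])
    show "finite ((\<lambda>(S, w). dual S w) ` (SIGMA S:facets. S))"
      using fF facet(4) by (intro finite_imageI finite_SigmaI)
    show "linear g" if "g \<in> (\<lambda>(S, w). dual S w) ` (SIGMA S:facets. S)" for g
      using that dual_props(1)[OF facet(3)] by auto
    show "\<exists>a\<in>A. g a \<noteq> 0" if "g \<in> (\<lambda>(S, w). dual S w) ` (SIGMA S:facets. S)" for g
      using that dnz by auto
  qed
  then obtain q where q: "q \<in> ncone A" "\<And>S w. S \<in> facets \<Longrightarrow> w \<in> S \<Longrightarrow> dual S w q \<noteq> 0"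
    by auto
  define U where "U S = {w\<in>S. dual S w q < 0}" for S
  have Lsum: "L S (\<Sum>w\<in>G. c w *\<^sub>R w) = (\<Sum>w\<in>G. c w * L S w)" if "S \<in> facets" for S G c
    using Lin[OF that] by (simp add: linear_sum linear_scale)
  \<comment> \<open>The linear function of a facet lies under the piecewise linear
    \<open>\<psi>\<close>, strictly so at a point that uses a vertex off the facet.\<close>
  have below: "L T (\<Sum>w\<in>S. y w *\<^sub>R w) < (\<Sum>w\<in>S. y w * \<psi> w)"
    if T: "T \<in> facets" and S: "S \<in> \<Delta>" and y: "\<And>w. w \<in> S \<Longrightarrow> 0 \<le> y w" and u: "u \<in> S" "u \<notin> T" "0 < y u" for S T y u
    unfolding Lsum[OF T]
  proof (rule sum_strict_mono_ex1)
    show "\<forall>w\<in>S. y w * L T w \<le> y w * \<psi> w"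
      using y L3[OF T] S by (auto intro!: mult_left_mono)
    show "\<exists>w\<in>S. y w * L T w < y w * \<psi> w"
      using u L2[OF T, of u] S by (intro bexI[of _ u] mult_strict_left_mono) auto
  qed (use fin_face S in auto)
  \<comment> \<open>Among the facets containing \<open>G\<close>, the one with \<open>U S\<close>
    inside \<open>G\<close> has strictly the largest value at \<open>q\<close>. Indeed
    \<open>q + K *\<^sub>R s\<close> is interior to its cone, where its function exceeds the others,
    and on \<open>s\<close> the functions of all facets containing \<open>G\<close> agree.\<close>
  have P1: "L T q < L S q"
    if G: "G \<in> \<Delta>" and S: "S \<in> facets" "G \<subseteq> S" "U S \<subseteq> G" and T: "T \<in> facets" "G \<subseteq> T" "T \<noteq> S" for G S T
  proof -
    define s where "s = (\<Sum>w\<in>G. w)"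
    have sS: "s \<in> span S" unfolding s_def using S(2) by (intro span_sum span_base) auto
    have qS: "q \<in> span S" using q(1) ncone_span facet(5)[OF S(1)] by auto
    have ds: "dual S w s = (if w \<in> G then 1 else 0)" if "w \<in> S" for w
    proof -
      have "s = (\<Sum>w\<in>S. (if w \<in> G then 1 else 0) *\<^sub>R w)"
        using S(2) facet(4)[OF S(1)] by (simp add: s_def if_distrib[of "\<lambda>r. r *\<^sub>R _"] sum.If_cases Int_absorb1 cong: if_cong)
      then show ?thesis using dual_comb[OF facet(3,4)[OF S(1)] that, of "\<lambda>w. if w \<in> G then 1 else 0"] by simp
    qed
    \<comment> \<open>Exceeds every coordinate of \<open>q\<close>, so those at \<open>G\<close>
      become positive. The remaining ones are positive already, because \<open>U S\<close> is inside
      \<open>G\<close> and \<open>q\<close> is generic.\<close>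
    define K where "K = 1 + (\<Sum>w\<in>S. \<bar>dual S w q\<bar>)"
    have K: "\<bar>dual S w q\<bar> < K" if "w \<in> S" for w
      using member_le_sum[of w S "\<lambda>w. \<bar>dual S w q\<bar>"] that facet(4)[OF S(1)] by (simp add: K_def)
    define y where "y w = dual S w (q + K *\<^sub>R s)" for w
    have yw: "y w = dual S w q + K * dual S w s" for w
      using dual_props(1)[OF facet(3)[OF S(1)]] by (simp add: y_def linear_add linear_scale)
    have ypos: "0 < y w" if w: "w \<in> S" for w
    proof (cases "w \<in> G")
      case True
      then show ?thesis using K[OF w] ds[OF w] by (simp add: yw)
    next
      case False
      then have "\<not> dual S w q < 0" using S(3) w by (auto simp: U_def)
      then show ?thesis using q(2)[OF S(1) w] ds[OF w] False by (simp add: yw)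
    qed
    have r: "(\<Sum>w\<in>S. y w *\<^sub>R w) = q + K *\<^sub>R s"
      unfolding y_def using qS sS by (intro dual_sum[OF facet(3,4)[OF S(1)]] span_add span_scale)
    have "\<not> S \<subseteq> T"
      using card_subset_eq[OF facet(4)[OF T(1)], of S] facet(2)[OF S(1)] facet(2)[OF T(1)] T(3) by auto
    then obtain u where u: "u \<in> S" "u \<notin> T" by blast
    have "L T (q + K *\<^sub>R s) < (\<Sum>w\<in>S. y w * \<psi> w)"
      using below[OF T(1) facet(1)[OF S(1)], of y u] ypos u less_imp_le unfolding r by blast
    also have "(\<Sum>w\<in>S. y w * \<psi> w) = L S (q + K *\<^sub>R s)"
      unfolding r[symmetric] Lsum[OF S(1)] using L1[OF S(1)] by simp
    finally have "L T q + K * L T s < L S q + K * L S s"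
      using Lin[OF T(1)] Lin[OF S(1)] by (simp add: linear_add linear_scale)
    moreover have "L T w = L S w" if "w \<in> G" for w
      using L1[OF T(1), of w] L1[OF S(1), of w] S(2) T(2) that by (metis subsetD)
    then have "L T s = L S s"
      using Lin[OF T(1)] Lin[OF S(1)] by (simp add: s_def linear_sum)
    ultimately show ?thesis by simp
  qed
  \<comment> \<open>If \<open>w0\<close> in \<open>U S\<close> were missing from \<open>G\<close>,
    the point \<open>q\<close> plus \<open>N\<close> times \<open>s\<close> would have a negative
    \<open>w0\<close>-coordinate and lie in the cone of another facet \<open>T\<close>, with larger
    function value. For large \<open>N\<close> this forces \<open>G\<close> into \<open>T\<close>,
    and then \<open>T\<close> beats \<open>S\<close> at \<open>q\<close>.\<close>
  have P2: "U S \<subseteq> G"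
    if G: "G \<in> \<Delta>" and S: "S \<in> facets" "G \<subseteq> S" and max: "\<And>T. T \<in> facets \<Longrightarrow> G \<subseteq> T \<Longrightarrow> L T q \<le> L S q" for G S
  proof (rule ccontr)
    assume "\<not> U S \<subseteq> G"
    then obtain w0 where w0: "w0 \<in> S" "w0 \<notin> G" "dual S w0 q < 0" by (auto simp: U_def)
    define s where "s = (\<Sum>w\<in>G. w)"
    have sA: "s \<in> ncone A" unfolding s_def using W_cone face_sub[OF G] by (intro ncone_sum) auto
    have Ls: "L T s = (\<Sum>w\<in>G. L T w)" if "T \<in> facets" for T
      using Lin[OF that] by (simp add: s_def linear_sum)
    have LSs: "L S s = (\<Sum>w\<in>G. \<psi> w)" unfolding Ls[OF S(1)] using L1[OF S(1)] S(2) by (intro sum.cong) auto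
    have lt: "L T s < L S s" if T: "T \<in> facets" "\<not> G \<subseteq> T" for T
    proof -
      obtain u where "u \<in> G" "u \<notin> T" using T(2) by blast
      then have "L T (\<Sum>w\<in>G. 1 *\<^sub>R w) < (\<Sum>w\<in>G. 1 * \<psi> w)"
        using below[OF T(1) G, of "\<lambda>_. 1" u] by simp
      then show ?thesis by (simp add: LSs[unfolded s_def] s_def)
    qed
    have "\<forall>T\<in>{T\<in>facets. \<not> G \<subseteq> T}. \<forall>\<^sub>F N in sequentially. L T q - L S q < real N * (L S s - L T s)"
    proof
      fix T assume "T \<in> {T\<in>facets. \<not> G \<subseteq> T}"
      then have p: "0 < L S s - L T s" using lt by simp
      obtain M :: nat where M: "real M > (L T q - L S q) / (L S s - L T s)" using reals_Archimedean2 by blast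
      show "\<forall>\<^sub>F N in sequentially. L T q - L S q < real N * (L S s - L T s)"
        using eventually_ge_at_top[of M]
      proof eventually_elim
        case (elim N)
        then have "(L T q - L S q) / (L S s - L T s) < real N" using M by linarith
        then show ?case using p by (simp add: pos_divide_less_eq)
      qed
    qed
    then have "\<forall>\<^sub>F N in sequentially. \<forall>T\<in>{T\<in>facets. \<not> G \<subseteq> T}. L T q - L S q < real N * (L S s - L T s)"
      using fF by (intro eventually_ball_finite) auto
    then obtain N where N: "\<And>T. T \<in> facets \<Longrightarrow> \<not> G \<subseteq> T \<Longrightarrow> L T q - L S q < real N * (L S s - L T s)"
      by (auto simp: eventually_sequentially)
    define r where "r = q + real N *\<^sub>R s"
    have "r \<in> ncone A" unfolding r_def using q(1) sA by (intro ncone_add ncone_scale) auto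
    then obtain y where y: "repr \<Delta> y r" using ex_repr by blast
    obtain T where T: "T \<in> facets" "{w. y w \<noteq> 0} \<subseteq> T"
      using pure[of "{w. y w \<noteq> 0}"] y by (auto simp: repr_def facets_def)
    have y0: "0 \<le> y w" for w using y by (simp add: repr_def)
    have rT: "r = (\<Sum>w\<in>T. y w *\<^sub>R w)"
    proof -
      have "r = (\<Sum>w\<in>W. y w *\<^sub>R w)" using y by (simp add: repr_def)
      also have "\<dots> = (\<Sum>w\<in>T. y w *\<^sub>R w)"
        using T facet(1)[OF T(1)] by (intro sum_support[OF finW face_sub]) auto
      finally show ?thesis .
    qed
    have dS: "dual S w0 r < 0"
    proof -
      have "dual S w0 s = 0"
      proof -
        have "dual S w0 w = 0" if "w \<in> G" for w
          using dual_props(2)[OF facet(3)[OF S(1)], of w w0] that w0(2) S(2) by auto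
        then show ?thesis
          using dual_props(1)[OF facet(3)[OF S(1)], of w0] by (simp add: s_def linear_sum)
      qed
      then show ?thesis
        using dual_props(1)[OF facet(3)[OF S(1)], of w0] w0(3) by (simp add: r_def linear_add linear_scale)
    qed
    have "\<exists>u\<in>T. u \<notin> S \<and> 0 < y u"
    proof (rule ccontr)
      assume "\<not> (\<exists>u\<in>T. u \<notin> S \<and> 0 < y u)"
      then have "y w = 0" if "w \<notin> S" for w using y0[of w] that T(2) by (cases "w \<in> T") force+
      then have "(\<Sum>w\<in>W. y w *\<^sub>R w) = (\<Sum>w\<in>S. y w *\<^sub>R w)"
        using facet(1)[OF S(1)] by (intro sum_support[OF finW face_sub]) auto
      then have "r = (\<Sum>w\<in>S. y w *\<^sub>R w)" using y by (simp add: repr_def)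
      then have "dual S w0 r = y w0" using dual_comb[OF facet(3,4)[OF S(1)] w0(1)] by simp
      then show False using dS y0[of w0] by simp
    qed
    then obtain u where u: "u \<in> T" "u \<notin> S" "0 < y u" by blast
    have "L S r < (\<Sum>w\<in>T. y w * \<psi> w)"
      using below[OF S(1) facet(1)[OF T(1)], of y u] y0 u unfolding rT by blast
    also have "\<dots> = L T r" unfolding rT Lsum[OF T(1)] using L1[OF T(1)] by simp
    finally have lt2: "L S q + real N * L S s < L T q + real N * L T s"
      using Lin[OF T(1)] Lin[OF S(1)] by (simp add: r_def linear_add linear_scale)
    show False
    proof (cases "G \<subseteq> T")
      case True
      then have "L T s = L S s"
        unfolding Ls[OF T(1)] LSs using L1[OF T(1)] by (intro sum.cong) auto
      then show False using lt2 max[OF T(1) True] by simp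
    next
      case False
      then show False using lt2 N[OF T(1) False] by (simp add: right_diff_distrib)
    qed
  qed
  have ex_max: "\<exists>S\<in>facets. G \<subseteq> S \<and> U S \<subseteq> G" if G: "G \<in> \<Delta>" for G
  proof -
    let ?X = "{S\<in>facets. G \<subseteq> S}"
    have ne: "?X \<noteq> {}" using pure[OF G] by (auto simp: facets_def)
    have fX: "finite ?X" using fF by simp
    then have "Max ((\<lambda>S. L S q) ` ?X) \<in> (\<lambda>S. L S q) ` ?X" using ne by (intro Max_in) auto
    then obtain S where S: "S \<in> ?X" "Max ((\<lambda>S. L S q) ` ?X) = L S q" by blast
    have "L T q \<le> L S q" if "T \<in> facets" "G \<subseteq> T" for T
      unfolding S(2)[symmetric] using fX that by (intro Max_ge) auto
    then have "U S \<subseteq> G" using P2[OF G, of S] S(1) by blast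
    then show ?thesis using S(1) by blast
  qed
  have uniq: "S = T" if "G \<in> \<Delta>" "S \<in> facets" "G \<subseteq> S" "U S \<subseteq> G" "T \<in> facets" "G \<subseteq> T" "U T \<subseteq> G" for G S T
    using P1[OF that(1-6)] P1[OF that(1) that(5-7) that(2,3)] by force
  have US: "U S \<subseteq> S" for S by (auto simp: U_def)
  have hv: "hvec \<Delta> (card A) = (\<Sum>S\<in>facets. monom 1 (card (U S)))"
  proof -
    \<comment> \<open>The intervals from \<open>U S\<close> to \<open>S\<close> partition the faces.
      By the binomial theorem each contributes the single power of degree
      \<open>card (U S)\<close>.\<close>
    have part: "\<Delta> = (\<Union>S\<in>facets. {G. U S \<subseteq> G \<and> G \<subseteq> S})"
      using ex_max down facet(1) by fastforce
    let ?t = "\<lambda>G. [:0, 1:] ^ card G * [:1, -1:] ^ (card A - card G) :: int poly"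
    have "hvec \<Delta> (card A) = (\<Sum>S\<in>facets. \<Sum>G\<in>{G. U S \<subseteq> G \<and> G \<subseteq> S}. ?t G)"
      unfolding hvec_def
    proof (subst part, rule sum.UNION_disjoint[OF fF])
      show "\<forall>S\<in>facets. finite {G. U S \<subseteq> G \<and> G \<subseteq> S}"
        using facet(4) by (auto intro: finite_subset[OF _ finite_Pow_iff[THEN iffD2]])
      show "\<forall>S\<in>facets. \<forall>T\<in>facets. S \<noteq> T \<longrightarrow> {G. U S \<subseteq> G \<and> G \<subseteq> S} \<inter> {G. U T \<subseteq> G \<and> G \<subseteq> T} = {}"
        using uniq down facet(1) by blast
    qed
    also have "\<dots> = (\<Sum>S\<in>facets. monom 1 (card (U S)))"
    proof (rule sum.cong[OF refl])
      fix S assume S: "S \<in> facets"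
      note fS = facet(4)[OF S]
      have fU: "finite (U S)" using US fS finite_subset by blast
      let ?D = "S - U S"
      have bij: "bij_betw ((\<union>) (U S)) (Pow ?D) {G. U S \<subseteq> G \<and> G \<subseteq> S}"
        by (rule bij_betw_byWitness[where f' = "\<lambda>G. G - U S"]) (use US[of S] in auto)
      have cD: "card A = card (U S) + card ?D"
        using card_Diff_subset[OF fU US] card_mono[OF fS US] facet(2)[OF S] by simp
      have "(\<Sum>G\<in>{G. U S \<subseteq> G \<and> G \<subseteq> S}. ?t G) = (\<Sum>G\<in>Pow ?D. ?t (U S \<union> G))"
        by (rule sum.reindex_bij_betw[OF bij, symmetric])
      also have "\<dots> = (\<Sum>G\<in>Pow ?D. [:0, 1:] ^ card (U S) * ([:0, 1:] ^ card G * (1 - [:0, 1:]) ^ (card ?D - card G)))"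
      proof (rule sum.cong[OF refl])
        fix G assume G: "G \<in> Pow ?D"
        then have "finite G" using fS finite_subset by blast
        then have "card (U S \<union> G) = card (U S) + card G" using G fU by (intro card_Un_disjoint) auto
        then show "?t (U S \<union> G) = [:0, 1:] ^ card (U S) * ([:0, 1:] ^ card G * (1 - [:0, 1:]) ^ (card ?D - card G))"
          unfolding cD by (simp add: power_add mult.assoc one_pCons)
      qed
      also have "\<dots> = [:0, 1:] ^ card (U S)"
        using sum_Pow_binomial[of ?D "[:0, 1:] :: int poly" "1 - [:0, 1:]"] fS by (simp flip: sum_distrib_left)
      finally show "(\<Sum>G\<in>{G. U S \<subseteq> G \<and> G \<subseteq> S}. ?t G) = monom 1 (card (U S))"
        by (simp add: monom_altdef)
    qed
    finally show ?thesis .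
  qed
  have hc: "coeff (hvec \<Delta> (card A)) j = int (card {S\<in>facets. card (U S) = j})" for j
    using fF by (simp add: hv coeff_sum coeff_monom sum.If_cases Int_def)
  define f where "f \<alpha> = ind (pts \<Delta>) * mpow var W \<alpha>" for \<alpha>
  define chi where "chi S = (\<lambda>w. if w \<in> U S then 1 else (0::nat))" for S
  define D where "D j = (\<lambda>S. f (chi S)) ` {S\<in>facets. card (U S) = j}" for j
  define rk where "rk S = card {T\<in>facets. L T q < L S q}" for S
  let ?low = "low A (\<lambda>a. lform W (dual A a)) (srdeg \<Delta> W)"
  \<comment> \<open>One variable \<open>w\<close> is rewritten modulo \<open>low\<close> by means of
    the coordinate functional of \<open>w\<close> over \<open>S\<close>, which vanishes on the rest
    of \<open>S\<close>. What appears instead are variables outside \<open>S\<close>, and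
    \<open>P1\<close> places the new monomials in facets with a smaller value at \<open>q\<close>;
    hence the induction on \<open>rk\<close>.\<close>
  have gen: "f \<alpha> \<in> span (?low j \<union> D j)"
    if "\<alpha> \<in> multi_idx W j" "{w. \<alpha> w \<noteq> 0} \<in> \<Delta>" "S \<in> facets" "{w. \<alpha> w \<noteq> 0} \<subseteq> S" "U S \<subseteq> {w. \<alpha> w \<noteq> 0}" for \<alpha> j S
    using that
  proof (induction "rk S" arbitrary: \<alpha> S rule: less_induct)
    case less
    note \<alpha> = less.prems
    show ?case
    proof (cases "\<alpha> = chi S")
      case True
      have "sum (chi S) W = card (U S)"
        using US[of S] facet(1)[OF \<alpha>(3)] finW by (simp add: chi_def sum.If_cases) (metis Int_absorb1 face_sub subset_trans)
      then have "j = card (U S)" using \<alpha>(1) True by (simp add: multi_idx_def)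
      then have "f \<alpha> \<in> D j" using True \<alpha>(3) by (auto simp: D_def)
      then show ?thesis by (intro span_base) simp
    next
      case False
      \<comment> \<open>A monomial other than the generator has a variable whose exponent can be
        lowered with \<open>U S\<close> still in the support; this is what keeps \<open>P1\<close>
        applicable to \<open>\<beta>\<close>.\<close>
      have "\<exists>w. \<alpha> w \<noteq> 0 \<and> (w \<notin> U S \<or> \<alpha> w \<noteq> 1)"
      proof (rule ccontr)
        assume n: "\<not> ?thesis"
        have "\<alpha> w = chi S w" for w
        proof (cases "\<alpha> w = 0")
          case True
          then show ?thesis using \<alpha>(5) by (auto simp: chi_def)
        next
          case False
          then have "w \<in> U S \<and> \<alpha> w = 1" using n by blast
          then show ?thesis by (simp add: chi_def)
        qed
        then show False using False by (simp add: fun_eq_iff)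
      qed
      then obtain w where w: "\<alpha> w \<noteq> 0" "w \<notin> U S \<or> \<alpha> w \<noteq> 1" by blast
      define \<beta> where "\<beta> = \<alpha>(w := \<alpha> w - 1)"
      have wS: "w \<in> S" using w \<alpha>(4) by blast
      have wW: "w \<in> W" using wS facet(1)[OF \<alpha>(3)] by blast
      have \<alpha>\<beta>: "\<alpha> = \<beta>(w := Suc (\<beta> w))" using w(1) by (auto simp: \<beta>_def)
      have "sum \<alpha> W = Suc (sum \<beta> W)"
        using finW wW w(1) by (simp add: sum.remove[of W w] \<beta>_def)
      then obtain i where j: "j = Suc i" and \<beta>: "\<beta> \<in> multi_idx W i"
        using \<alpha>(1) by (auto simp: multi_idx_def \<beta>_def)
      have supp: "{w. \<beta> w \<noteq> 0} \<subseteq> {w. \<alpha> w \<noteq> 0}" by (auto simp: \<beta>_def)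
      have U\<beta>: "U S \<subseteq> {w. \<beta> w \<noteq> 0}" using \<alpha>(5) w(2) by (auto simp: \<beta>_def)
      have \<beta>D: "{w. \<beta> w \<noteq> 0} \<in> \<Delta>" using down[OF \<alpha>(2) supp] .
      define g where "g = dual S w"
      have g: "linear g" using dual_props(1)[OF facet(3)[OF \<alpha>(3)]] by (simp add: g_def)
      have gS: "g u = (if u = w then 1 else 0)" if "u \<in> S" for u
        using dual_props(2)[OF facet(3)[OF \<alpha>(3)] that] by (simp add: g_def)
      have fup: "var u * f \<beta> = f (\<beta>(u := Suc (\<beta> u)))" if "u \<in> W" for u
        using mpow_inc[OF finW that, of var \<beta>] by (simp add: f_def mult.left_commute del: fun_upd_apply)
      have lf: "lform W g * f \<beta> \<in> ?low j"
      proof -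
        have "f \<beta> \<in> srdeg \<Delta> W i" using \<beta> by (auto simp: f_def srdeg_def mpow_var_hpolys)
        then have "lform W (dual A a) * f \<beta> \<in> ?low j" if "a \<in> A" for a
          unfolding j low_def using that by (intro span_base) auto
        then have "(\<Sum>a\<in>A. g a *\<^sub>R (lform W (dual A a) * f \<beta>)) \<in> ?low j"
          by (intro subspace_sum subspace_scale subspace_low)
        then show ?thesis unfolding lform_comb[OF g] by (simp add: sum_distrib_right)
      qed
      have rest: "g u *\<^sub>R (var u * f \<beta>) \<in> span (?low j \<union> D j)" if u: "u \<in> W - {w}" for u
      proof (cases "u \<in> S")
        case True
        then have "g u = 0" using gS u by auto
        then show ?thesis by (simp only: scaleR_zero_left span_zero)
      next
        case False
        let ?\<gamma> = "\<beta>(u := Suc (\<beta> u))"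
        have \<gamma>: "?\<gamma> \<in> multi_idx W j" using multi_idx_inc[OF finW _ \<beta>, of u] u j by auto
        show ?thesis
        proof (cases "{w. ?\<gamma> w \<noteq> 0} \<in> \<Delta>")
          case True
          obtain T where T: "T \<in> facets" "{w. ?\<gamma> w \<noteq> 0} \<subseteq> T" "U T \<subseteq> {w. ?\<gamma> w \<noteq> 0}"
            using ex_max[OF True] by blast
          have "{w. \<beta> w \<noteq> 0} \<subseteq> {w. ?\<gamma> w \<noteq> 0}" by auto
          then have "{w. \<beta> w \<noteq> 0} \<subseteq> T" using T(2) by blast
          moreover have "T \<noteq> S" using T(2) False by auto
          moreover have "{w. \<beta> w \<noteq> 0} \<subseteq> S" using supp \<alpha>(4) by blast
          ultimately have "L T q < L S q" using P1[OF \<beta>D \<alpha>(3) _ U\<beta> T(1)] by blast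
          then have "rk T < rk S"
            unfolding rk_def using fF T(1) by (intro psubset_card_mono) auto
          from less.hyps[OF this \<gamma> True T] have "f ?\<gamma> \<in> span (?low j \<union> D j)" .
          moreover have "var u * f \<beta> = f ?\<gamma>" using u by (intro fup) simp
          ultimately have "var u * f \<beta> \<in> span (?low j \<union> D j)" by (simp only:)
          then show ?thesis by (rule span_scale)
        next
          case False
          have "f ?\<gamma> = 0" unfolding f_def
            by (rule monomial_vanish[OF finW _ \<gamma> False]) (rule down)
          moreover have "var u * f \<beta> = f ?\<gamma>" using u by (intro fup) simp
          ultimately have "var u * f \<beta> = 0" by (simp only:)
          then show ?thesis by (simp only: scaleR_zero_right span_zero)
        qed
      qed
      have "lform W g * f \<beta> = (\<Sum>u\<in>W. g u *\<^sub>R (var u * f \<beta>))"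
        by (simp add: lform_def sum_distrib_right)
      also have "\<dots> = g w *\<^sub>R (var w * f \<beta>) + (\<Sum>u\<in>W - {w}. g u *\<^sub>R (var u * f \<beta>))"
        using finW wW by (rule sum.remove)
      also have "g w *\<^sub>R (var w * f \<beta>) = f \<alpha>" using gS[OF wS] fup[OF wW] \<alpha>\<beta> by simp
      finally have eq: "f \<alpha> = lform W g * f \<beta> - (\<Sum>u\<in>W - {w}. g u *\<^sub>R (var u * f \<beta>))"
        by (simp only: add_diff_cancel_right')
      have "lform W g * f \<beta> \<in> span (?low j \<union> D j)" using lf by (intro span_base) simp
      moreover have "(\<Sum>u\<in>W - {w}. g u *\<^sub>R (var u * f \<beta>)) \<in> span (?low j \<union> D j)"
        by (rule span_sum) (rule rest)
      ultimately show ?thesis unfolding eq by (rule span_diff)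
    qed
  qed
  have "\<exists>X. finite X \<and> int (card X) \<le> coeff (hvec \<Delta> (card A)) j \<and> srdeg \<Delta> W j \<subseteq> span (?low j \<union> X)" for j
  proof (intro exI[of _ "D j"] conjI)
    show "finite (D j)" using fF by (simp add: D_def)
    show "int (card (D j)) \<le> coeff (hvec \<Delta> (card A)) j"
      unfolding hc D_def using fF by (simp add: card_image_le)
    have "span ((\<lambda>\<alpha>. ind (pts \<Delta>) * mpow var W \<alpha>) ` {\<alpha> \<in> multi_idx W j. {w. \<alpha> w \<noteq> 0} \<in> \<Delta>})
        \<subseteq> span (?low j \<union> D j)"
    proof (rule span_minimal)
      show "(\<lambda>\<alpha>. ind (pts \<Delta>) * mpow var W \<alpha>) ` {\<alpha> \<in> multi_idx W j. {w. \<alpha> w \<noteq> 0} \<in> \<Delta>} \<subseteq> span (?low j \<union> D j)"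
      proof (rule image_subsetI)
        fix \<alpha> assume \<alpha>: "\<alpha> \<in> {\<alpha> \<in> multi_idx W j. {w. \<alpha> w \<noteq> 0} \<in> \<Delta>}"
        then obtain S where "S \<in> facets" "{w. \<alpha> w \<noteq> 0} \<subseteq> S" "U S \<subseteq> {w. \<alpha> w \<noteq> 0}"
          using ex_max by blast
        then show "ind (pts \<Delta>) * mpow var W \<alpha> \<in> span (?low j \<union> D j)"
          using gen[of \<alpha> j S] \<alpha> by (simp add: f_def)
      qed
    qed simp
    moreover have "srdeg \<Delta> W j =
        span ((\<lambda>\<alpha>. ind (pts \<Delta>) * mpow var W \<alpha>) ` {\<alpha> \<in> multi_idx W j. {w. \<alpha> w \<noteq> 0} \<in> \<Delta>})"
      by (rule srdeg_eq_span[OF finW down])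
    ultimately show "srdeg \<Delta> W j \<subseteq> span (?low j \<union> D j)" by (simp only:)
  qed
  then show ?thesis
    unfolding fan_cm_def graded_module.cm_def[OF graded_W] by blast
qed

end

section \<open>Stellar subdivision of an edge\<close>

definition stellar :: "'w set set \<Rightarrow> 'w \<Rightarrow> 'w \<Rightarrow> 'w \<Rightarrow> 'w set set" where
  "stellar \<Delta> u w z = {G \<in> \<Delta>. \<not> {u, w} \<subseteq> G} \<union> insert z ` {G. G \<union> {u, w} \<in> \<Delta> \<and> \<not> {u, w} \<subseteq> G}"

locale edge_loc = fan_loc +
  fixes u w z :: "'a::euclidean_space" and a b :: real
  assumes edge: "{u, w} \<in> \<Delta>" "u \<noteq> w" and ab: "0 < a" "0 < b" and z: "z = a *\<^sub>R u + b *\<^sub>R w"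
begin

abbreviation \<Delta>' where "\<Delta>' \<equiv> stellar \<Delta> u w z"

lemma uw: "u \<in> W" "w \<in> W" using edge by auto

lemma z_notin: "z \<notin> W"
proof
  assume "z \<in> W"
  then have zD: "{z} \<in> \<Delta>" using down by blast
  have e: "(if v \<in> {z} then 1 else 0) = (if v \<in> {u, w} then (if v = u then a else b) else 0)" for v
    by (rule face_unique[OF zD edge(1)]) (use ab edge(2) in \<open>auto simp: z\<close>)
  from e[of u] e[of w] ab edge(2) show False by (auto split: if_splits)
qed

lemma stellar_faces:
  assumes "G \<in> \<Delta>'"
  shows "(G - {z}) \<in> \<Delta>" "\<not> {u, w} \<subseteq> G" "z \<in> G \<Longrightarrow> (G - {z}) \<union> {u, w} \<in> \<Delta>"
proof -
  have zu: "z \<noteq> u" "z \<noteq> w" using z_notin uw by auto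
  have G': "z \<notin> G" if "G \<in> \<Delta>" for G using z_notin that by auto
  consider "G \<in> \<Delta>" "\<not> {u, w} \<subseteq> G" | H where "G = insert z H" "H \<union> {u, w} \<in> \<Delta>" "\<not> {u, w} \<subseteq> H"
    using assms by (auto simp: stellar_def)
  note c = this
  show 1: "\<not> {u, w} \<subseteq> G" using c zu by cases auto
  show 3: "z \<in> G \<Longrightarrow> (G - {z}) \<union> {u, w} \<in> \<Delta>"
    using c
  proof cases
    case 2
    then have "z \<notin> H" using z_notin by blast
    then have "G - {z} = H" unfolding 2(1) by simp
    then show ?thesis using 2 by simp
  next
    case 1
    assume "z \<in> G"
    then show ?thesis using G'[OF 1(1)] by simp
  qed
  show "G - {z} \<in> \<Delta>"
    using c
  proof cases
    case 2
    then have "z \<in> G" by simp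
    then show ?thesis by (intro down[OF 3]) auto
  next
    case 1
    then show ?thesis using G'[OF 1(1)] by simp
  qed
qed

lemma stellarI:
  assumes "G - {z} \<in> \<Delta>" "\<not> {u, w} \<subseteq> G" "z \<in> G \<Longrightarrow> (G - {z}) \<union> {u, w} \<in> \<Delta>"
  shows "G \<in> \<Delta>'"
proof (cases "z \<in> G")
  case True
  have "\<not> {u, w} \<subseteq> G - {z}" using assms(2) by auto
  then have "insert z (G - {z}) \<in> \<Delta>'" unfolding stellar_def using assms(3)[OF True] by blast
  then show ?thesis using True by (simp add: insert_absorb)
next
  case False
  then show ?thesis using assms by (auto simp: stellar_def)
qed

lemma stellar_iff:
  "G \<in> \<Delta>' \<longleftrightarrow> G - {z} \<in> \<Delta> \<and> \<not> {u, w} \<subseteq> G \<and> (z \<in> G \<longrightarrow> (G - {z}) \<union> {u, w} \<in> \<Delta>)"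
  using stellar_faces stellarI by blast

lemma W': "\<Union>\<Delta>' = insert z W"
proof
  show "\<Union>\<Delta>' \<subseteq> insert z W" using stellar_faces(1) by fastforce
  have "v \<in> \<Union>\<Delta>'" if "v \<in> W" for v
  proof -
    have "{v} \<in> \<Delta>" "v \<noteq> z" using that down z_notin by auto
    then have "{v} \<in> \<Delta>'" using edge(2) by (auto simp: stellar_iff)
    then show ?thesis by blast
  qed
  moreover have "{z} \<in> \<Delta>'" using edge emptyD z_notin uw by (auto simp: stellar_iff)
  ultimately show "insert z W \<subseteq> \<Union>\<Delta>'" by blast
qed

lemma stellar_complex: "abstract_complex \<Delta>'"
  unfolding abstract_complex_def
proof (intro conjI ballI allI impI)
  have "\<Delta>' \<subseteq> Pow (insert z W)" using W' by blast
  then show "finite \<Delta>'" using finW by (meson finite_Pow_iff finite_insert finite_subset)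
  show "{} \<in> \<Delta>'" using emptyD by (simp add: stellar_iff)
  show "finite F" if "F \<in> \<Delta>'" for F
    using fin_face[OF stellar_faces(1)[OF that]] by simp
  show "G \<in> \<Delta>'" if F: "F \<in> \<Delta>'" and GF: "G \<subseteq> F" for F G
  proof (rule stellarI)
    show "G - {z} \<in> \<Delta>" by (rule down[OF stellar_faces(1)[OF F]]) (use GF in blast)
    show "\<not> {u, w} \<subseteq> G" using stellar_faces(2)[OF F] GF by blast
    assume "z \<in> G"
    then have "z \<in> F" using GF by blast
    then show "G - {z} \<union> {u, w} \<in> \<Delta>"
      by (rule down[OF stellar_faces(3)[OF F]]) (use GF in blast)
  qed
qed

lemma z_cone: "z \<in> ncone A"
  unfolding z using uw W_cone ab by (intro ncone_add ncone_scale) auto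

definition co where "co v = (if v = u then a else if v = w then b else 0)"

text \<open>Passage from coordinates over the subdivision to coordinates over the original fan: the
  linear map sending the unit vector of \<open>z\<close> to \<open>a\<close> times that of
  \<open>u\<close> plus \<open>b\<close> times that of \<open>w\<close>, and fixing the
  others.\<close>

definition proj where "proj y = (\<lambda>v. if v = z then 0 else y v + y z * co v)"

lemma co_simps: "co u = a" "co w = b" "co z = 0" "v \<noteq> u \<Longrightarrow> v \<noteq> w \<Longrightarrow> co v = 0"
  using edge(2) z_notin uw by (auto simp: co_def)

lemma sum_co: "(\<Sum>v\<in>W. co v *\<^sub>R v) = z"
proof -
  have "(\<Sum>v\<in>W. co v *\<^sub>R v) = (\<Sum>v\<in>{u, w}. co v *\<^sub>R v)"
    using uw co_simps by (intro sum_support[OF finW]) auto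
  then show ?thesis using edge(2) co_simps by (simp add: z)
qed

lemma proj_pts:
  assumes "y \<in> pts \<Delta>'"
  shows "proj y \<in> pts \<Delta>"
proof -
  let ?G = "{v. y v \<noteq> 0}"
  have G: "?G \<in> \<Delta>'" using assms by (simp add: pts_def)
  show ?thesis
  proof (cases "y z = 0")
    case True
    then have "{v. proj y v \<noteq> 0} \<subseteq> ?G - {z}" by (auto simp: proj_def)
    then show ?thesis using down[OF stellar_faces(1)[OF G]] by (simp add: pts_def)
  next
    case False
    then have "{v. proj y v \<noteq> 0} \<subseteq> ?G - {z} \<union> {u, w}" by (auto simp: proj_def co_def)
    moreover have "?G - {z} \<union> {u, w} \<in> \<Delta>" using stellar_faces(3)[OF G] False by simp
    ultimately show ?thesis using down by (simp add: pts_def)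
  qed
qed

lemma uw_0: "y \<in> pts \<Delta>' \<Longrightarrow> y u = 0 \<or> y w = 0"
  using stellar_faces(2) by (auto simp: pts_def)

text \<open>Taken for the identity it says that the represented point is unchanged; taken for a
  coordinate functional it matches the parameters of the two fans.\<close>

lemma sum_proj: 
  fixes g :: "'a \<Rightarrow> 'b::real_vector"
  assumes "(\<Sum>v\<in>W. co v *\<^sub>R g v) = g z"
  shows "(\<Sum>v\<in>W. proj y v *\<^sub>R g v) = (\<Sum>v\<in>insert z W. y v *\<^sub>R g v)"
proof -
  have "(\<Sum>v\<in>W. proj y v *\<^sub>R g v) = (\<Sum>v\<in>W. y v *\<^sub>R g v + y z *\<^sub>R (co v *\<^sub>R g v))"
    using z_notin by (intro sum.cong) (auto simp: proj_def scaleR_add_left)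
  also have "\<dots> = (\<Sum>v\<in>W. y v *\<^sub>R g v) + y z *\<^sub>R g z"
    by (simp only: sum.distrib scaleR_sum_right[symmetric] assms)
  finally show ?thesis using finW z_notin by (simp add: add.commute)
qed

lemma repr_proj:
  assumes "repr \<Delta>' y p"
  shows "repr \<Delta> (proj y) p"
proof -
  have y: "\<And>v. 0 \<le> y v" "y \<in> pts \<Delta>'" "p = (\<Sum>v\<in>insert z W. y v *\<^sub>R v)"
    using assms by (auto simp: repr_def pts_def W')
  have "0 \<le> proj y v" for v using y(1) ab by (simp add: proj_def co_def)
  moreover have "{v. proj y v \<noteq> 0} \<in> \<Delta>" using proj_pts[OF y(2)] by (simp add: pts_def)
  moreover have "p = (\<Sum>v\<in>W. proj y v *\<^sub>R v)" using sum_proj[of "\<lambda>v. v" y] sum_co y(3) by simp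
  ultimately show ?thesis by (simp add: repr_def)
qed

text \<open>At a non-negative point one of the coordinates of \<open>u\<close> and \<open>w\<close>
  is zero, so the \<open>z\<close>-coordinate is the largest multiple of \<open>z\<close> that can
  be split off. It is recovered from \<open>proj y\<close>, which makes representations
  unique.\<close>

lemma min_proj:
  assumes "\<And>v. 0 \<le> y v" "y \<in> pts \<Delta>'"
  shows "y z = min (proj y u / a) (proj y w / b)"
proof -
  have "proj y u = y u + y z * a" "proj y w = y w + y z * b"
    using co_simps uw z_notin by (auto simp: proj_def)
  then have "proj y u / a = y u / a + y z" "proj y w / b = y w / b + y z"
    using ab by (simp_all add: add_divide_distrib)
  moreover have "0 \<le> y u / a" "0 \<le> y w / b" using assms(1) ab by auto
  moreover have "y u / a = 0 \<or> y w / b = 0" using uw_0[OF assms(2)] by auto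
  ultimately show ?thesis by (auto simp: min_def)
qed

lemma repr_lift:
  assumes "repr \<Delta> y p"
  shows "\<exists>y'. repr \<Delta>' y' p"
proof -
  have y: "\<And>v. 0 \<le> y v" "{v. y v \<noteq> 0} \<in> \<Delta>" "p = (\<Sum>v\<in>W. y v *\<^sub>R v)"
    using assms by (auto simp: repr_def)
  have yz: "y z = 0" using y(2) z_notin by blast
  \<comment> \<open>The largest multiple of \<open>z\<close> that leaves the coordinates of
    \<open>u\<close> and \<open>w\<close> non-negative; one of them becomes zero.\<close>
  define t where "t = min (y u / a) (y w / b)"
  have t: "0 \<le> t" using y(1) ab by (simp add: t_def)
  have ta: "t * a \<le> y u" "t * b \<le> y w" using ab by (auto simp: t_def min_def field_simps)
  have teq: "t * a = y u \<or> t * b = y w" using ab by (auto simp: t_def min_def)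
  define y' where "y' v = (if v = z then t else y v - t * co v)" for v
  have pr: "proj y' = y" using yz co_simps by (auto simp: proj_def y'_def)
  have nn: "0 \<le> y' v" for v
    using y(1)[of v] ta t by (auto simp: y'_def co_def)
  have "{v. y' v \<noteq> 0} \<in> \<Delta>'"
  proof (rule stellarI)
    have sub: "{v. y' v \<noteq> 0} - {z} \<subseteq> {v. y v \<noteq> 0} \<union> (if t = 0 then {} else {u, w})"
      by (auto simp: y'_def co_def)
    have uw_in: "{u, w} \<subseteq> {v. y v \<noteq> 0}" if "t \<noteq> 0"
    proof -
      have "0 < t * a" "0 < t * b" using that t ab by auto
      then show ?thesis using ta by auto
    qed
    have sub': "{v. y' v \<noteq> 0} - {z} \<subseteq> {v. y v \<noteq> 0}" using sub uw_in by (auto split: if_splits)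
    then show "{v. y' v \<noteq> 0} - {z} \<in> \<Delta>" using down[OF y(2)] by blast
    have "y' u = 0 \<or> y' w = 0" using teq co_simps z_notin uw by (auto simp: y'_def)
    then show "\<not> {u, w} \<subseteq> {v. y' v \<noteq> 0}" by auto
    assume "z \<in> {v. y' v \<noteq> 0}"
    then have "t \<noteq> 0" by (simp add: y'_def)
    then show "{v. y' v \<noteq> 0} - {z} \<union> {u, w} \<in> \<Delta>" using down[OF y(2)] sub' uw_in by auto
  qed
  moreover have "p = (\<Sum>v\<in>insert z W. y' v *\<^sub>R v)"
    using sum_proj[of "\<lambda>v. v" y'] sum_co y(3) pr by simp
  ultimately show ?thesis using nn by (auto simp: repr_def W')
qed

lemma stellar_fan: "fan A \<Delta>'"
  unfolding fan_def
proof (intro conjI ballI)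
  show "\<Union>\<Delta>' \<subseteq> ncone A" using W_cone z_cone by (simp add: W')
  fix p assume p: "p \<in> ncone A"
  obtain y' where "repr \<Delta>' y' p" using repr_lift ex_repr[OF p] by blast
  moreover have "y = y'" if "repr \<Delta>' y p" "repr \<Delta>' y' p" for y y'
  proof -
    have pr: "proj y = proj y'" using repr_unique[OF repr_proj[OF that(1)] repr_proj[OF that(2)]] .
    have zz: "y z = y' z"
      using min_proj[of y] min_proj[of y'] that pr by (simp add: repr_def pts_def)
    show ?thesis
    proof
      fix v show "y v = y' v" using fun_cong[OF pr, of v] zz by (simp add: proj_def split: if_splits)
    qed
  qed
  ultimately show "\<exists>!y. repr \<Delta>' y p" by blast
qed (auto simp: finA indA stellar_complex)

text \<open>Without positivity, when both coordinates on the edge are non-zero, either ratio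
  \<open>y u / a\<close> or \<open>y w / b\<close> may serve as the \<open>z\<close>-coordinate
  \<open>r\<close>. Such points generally have two preimages.\<close>

lemma proj_surj:
  assumes y: "y \<in> pts \<Delta>" and r: "r \<noteq> 0 \<Longrightarrow> {u, w} \<subseteq> {v. y v \<noteq> 0}" and uw0: "y u = r * a \<or> y w = r * b"
  shows "\<exists>y'\<in>pts \<Delta>'. proj y' = y \<and> y' z = r"
proof -
  have yD: "{v. y v \<noteq> 0} \<in> \<Delta>" using y by (simp add: pts_def)
  then have yz: "y z = 0" using z_notin by blast
  define y' where "y' v = (if v = z then r else y v - r * co v)" for v
  have "proj y' = y" using yz co_simps by (auto simp: proj_def y'_def)
  moreover have "y' \<in> pts \<Delta>'"
    unfolding pts_def mem_Collect_eq
  proof (rule stellarI)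
    have sub: "{v. y' v \<noteq> 0} - {z} \<subseteq> {v. y v \<noteq> 0}"
    proof (cases "r = 0")
      case False
      have "y v \<noteq> 0" if "y' v \<noteq> 0" "v \<noteq> z" for v
      proof (cases "v = u \<or> v = w")
        case True
        then show ?thesis using r False by auto
      next
        case no: False
        then show ?thesis using that co_simps(4)[of v] by (simp add: y'_def)
      qed
      then show ?thesis by auto
    qed (auto simp: y'_def)
    then show "{v. y' v \<noteq> 0} - {z} \<in> \<Delta>" using down[OF yD] by blast
    have "y' u = 0 \<or> y' w = 0" using uw0 co_simps z_notin uw by (auto simp: y'_def)
    then show "\<not> {u, w} \<subseteq> {v. y' v \<noteq> 0}" by auto
    assume "z \<in> {v. y' v \<noteq> 0}"
    then have "r \<noteq> 0" by (simp add: y'_def)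
    then show "{v. y' v \<noteq> 0} - {z} \<union> {u, w} \<in> \<Delta>" using down[OF yD] sub r by auto
  qed
  moreover have "y' z = r" by (simp add: y'_def)
  ultimately show ?thesis by blast
qed

section \<open>The face ring under a stellar subdivision\<close>

definition pull :: "(('a \<Rightarrow> real) \<Rightarrow> real) \<Rightarrow> ('a \<Rightarrow> real) \<Rightarrow> real" where
  "pull f = (\<lambda>y. if y \<in> pts \<Delta>' then f (proj y) else 0)"

lemma linear_pull: "linear pull"
  by (rule linearI) (auto simp: pull_def fun_eq_iff)

lemma pull_mult: "pull (f * g) = (f \<circ> proj) * pull g"
  by (auto simp: pull_def fun_eq_iff)

lemma proj_hpolys:
  assumes "p \<in> hpolys W j"
  shows "p \<circ> proj \<in> hpolys (insert z W) j"
  using assms unfolding hpolys_def[of W]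
proof (induction rule: span_induct_alt)
  case base
  have "(0 :: ('a \<Rightarrow> real) \<Rightarrow> real) \<circ> proj = 0" by (auto simp: fun_eq_iff)
  then show ?case using subspace_0[OF subspace_hpolys] by (simp only:)
next
  case (step c x y)
  have fW: "finite (insert z W)" using finW by simp
  have mono: "mpow var W \<alpha> \<circ> proj \<in> hpolys (insert z W) j" if "\<alpha> \<in> multi_idx W j" for \<alpha> j
    using that
  proof (induction j arbitrary: \<alpha>)
    case 0
    have "(1 :: ('a \<Rightarrow> real) \<Rightarrow> real) \<circ> proj = 1" by (auto simp: fun_eq_iff)
    moreover have "1 \<in> hpolys (insert z W) 0"
      using mpow_var_hpolys[of "\<lambda>_. 0" "insert z W" 0] fW by simp
    moreover have "\<alpha> = (\<lambda>_. 0)" using 0 finW by simp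
    ultimately show ?case by (simp only: mpow_0)
  next
    case (Suc j)
    obtain v \<beta> where v: "v \<in> W" "\<beta> \<in> multi_idx W j" "\<alpha> = \<beta>(v := Suc (\<beta> v))"
      using multi_idx_pos[OF finW Suc.prems] by blast
    have vz: "v \<noteq> z" using v(1) z_notin by blast
    have "mpow var W \<alpha> \<circ> proj = (var v \<circ> proj) * (mpow var W \<beta> \<circ> proj)"
      unfolding v(3) mpow_inc[OF finW v(1)] by (auto simp: fun_eq_iff)
    moreover have "var v \<circ> proj = lform (insert z W) (\<lambda>x. if x = v then 1 else if x = z then co v else 0)"
    proof
      fix y
      have "lform (insert z W) (\<lambda>x. if x = v then 1 else if x = z then co v else 0) y =
          co v * y z + (\<Sum>x\<in>W. (if x = v then 1 else if x = z then co v else 0) * y x)"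
        using finW z_notin vz by (simp add: lform_apply)
      also have "(\<Sum>x\<in>W. (if x = v then 1 else if x = z then co v else 0) * y x) = (\<Sum>x\<in>W. if x = v then y x else 0)"
        using z_notin by (intro sum.cong) auto
      also have "\<dots> = y v" using finW v(1) by simp
      finally show "(var v \<circ> proj) y = lform (insert z W) (\<lambda>x. if x = v then 1 else if x = z then co v else 0) y"
        using vz by (simp add: var_def proj_def mult.commute)
    qed
    ultimately show ?case using lform_mult_hpolys[OF fW Suc.IH[OF v(2)]] by (simp only:)
  qed
  then have "x \<circ> proj \<in> hpolys (insert z W) j" using step(1) by auto
  moreover have "(c *\<^sub>R x + y) \<circ> proj = c *\<^sub>R (x \<circ> proj) + (y \<circ> proj)" by (auto simp: fun_eq_iff)
  ultimately show ?case
    using subspace_add[OF subspace_hpolys subspace_scale[OF subspace_hpolys] step(2)] by (simp only:)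
qed

abbreviation M where "M \<equiv> srdeg \<Delta> W"
abbreviation M' where "M' \<equiv> srdeg \<Delta>' (insert z W)"
abbreviation th where "th \<equiv> \<lambda>x. lform W (dual A x)"
abbreviation th' where "th' \<equiv> \<lambda>x. lform (insert z W) (dual A x)"

lemma pull_M: "pull ` M j \<subseteq> M' j"
proof (rule image_subsetI)
  fix m assume "m \<in> M j"
  then obtain p where p: "p \<in> hpolys W j" "m = ind (pts \<Delta>) * p" by (auto simp: srdeg_def)
  have "pull m = ind (pts \<Delta>') * (p \<circ> proj)"
    using proj_pts by (auto simp: p(2) pull_def ind_def fun_eq_iff)
  then show "pull m \<in> M' j" using proj_hpolys[OF p(1)] by (auto simp: srdeg_def)
qed

lemma M_vanish: "m \<in> M j \<Longrightarrow> y \<notin> pts \<Delta> \<Longrightarrow> m y = 0"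
  by (auto simp: srdeg_def ind_def)

lemma ratio:
  assumes y: "y \<in> pts \<Delta>"
  obtains r where "r \<noteq> 0 \<Longrightarrow> {u, w} \<subseteq> {v. y v \<noteq> 0}" "y u = r * a \<or> y w = r * b"
proof (cases "y u = 0 \<or> y w = 0")
  case True
  then show ?thesis using that[of 0] by auto
next
  case False
  then show ?thesis using that[of "y u / a"] ab by auto
qed

lemma pull_ker:
  assumes "m \<in> M j" "pull m = 0"
  shows "m = 0"
proof
  fix y show "m y = 0 y"
  proof (cases "y \<in> pts \<Delta>")
    case True
    obtain r where r: "r \<noteq> 0 \<Longrightarrow> {u, w} \<subseteq> {v. y v \<noteq> 0}" "y u = r * a \<or> y w = r * b"
      using ratio[OF True] by blast
    then obtain y' where "y' \<in> pts \<Delta>'" "proj y' = y" using proj_surj[OF True] by blast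
    then show ?thesis using fun_cong[OF assms(2), of y'] by (simp add: pull_def)
  qed (use M_vanish[OF assms(1)] in simp)
qed

lemma th_proj: "th x \<circ> proj = th' x"
proof
  fix y
  have lin: "linear (dual A x)" by (rule dual_props(1)[OF indA])
  have "dual A x z = (\<Sum>v\<in>W. co v *\<^sub>R dual A x v)"
    using lin by (simp add: sum_co[symmetric] linear_sum linear_scale)
  from sum_proj[of "dual A x" y, OF this[symmetric]]
  show "(th x \<circ> proj) y = th' x y" by (simp add: lform_apply mult.commute)
qed

lemma pull_act: "pull (th x * m) = th' x * pull m"
  by (simp only: pull_mult th_proj)

lemma hpolys_continuous:
  assumes "p \<in> hpolys W j"
  shows "isCont (\<lambda>t. p (y(u := y u + t))) t0"
  using assms unfolding hpolys_def
proof (induction rule: span_induct_alt)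
  case (step c x p)
  obtain \<alpha> where \<alpha>: "x = mpow var W \<alpha>" using step(1) by auto
  have "isCont (\<lambda>t. \<Prod>v\<in>W. (y(u := y u + t)) v ^ \<alpha> v) t0"
  proof (rule continuous_prod)
    fix v show "isCont (\<lambda>t. (y(u := y u + t)) v ^ \<alpha> v) t0"
      by (cases "v = u") auto
  qed
  then have "isCont (\<lambda>t. x (y(u := y u + t))) t0" by (simp add: \<alpha> mpow_var)
  then show ?case unfolding plus_fun_apply scaleR_fun_apply
    by (intro continuous_add continuous_scaleR continuous_const step(2))
qed simp

text \<open>The sum of the image of \<open>pull\<close> and its multiples by \<open>var z\<close> is
  direct. A point with two preimages gives \<open>f y = s * r y\<close> for two values of
  \<open>s\<close>, so \<open>r\<close> and \<open>f\<close> vanish there; where an edge coordinate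
  is zero, \<open>s = 0\<close> works. The remaining points are reached by continuity of
  \<open>f\<close> along a coordinate direction.\<close>

lemma pull_zeta:
  assumes f: "f \<in> M j" and eq: "pull f = var z * pull r"
  shows "f = 0"
proof
  have off: "f y = 0" if y: "y \<in> pts \<Delta>" and ne: "y u / a \<noteq> y w / b \<or> y u = 0 \<or> y w = 0" for y
  proof -
    have val: "f y = s * r y" if s: "s \<noteq> 0 \<Longrightarrow> {u, w} \<subseteq> {v. y v \<noteq> 0}" "y u = s * a \<or> y w = s * b" for s
    proof -
      obtain y' where "y' \<in> pts \<Delta>'" "proj y' = y" "y' z = s" using proj_surj[OF y s] by blast
      then show ?thesis using fun_cong[OF eq, of y'] by (simp add: pull_def var_def)
    qed
    show ?thesis
    proof (cases "y u = 0 \<or> y w = 0")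
      case True
      then show ?thesis using val[of 0] by auto
    next
      case False
      have "f y = y u / a * r y" "f y = y w / b * r y"
        using val[of "y u / a"] val[of "y w / b"] False ab by auto
      then have "(y u / a - y w / b) * r y = 0" by (simp add: left_diff_distrib)
      then have "r y = 0" using ne False by auto
      then show ?thesis using \<open>f y = y u / a * r y\<close> by simp
    qed
  qed
  fix y show "f y = 0 y"
  proof (cases "y \<in> pts \<Delta>")
    case False
    then show ?thesis using M_vanish[OF f] by simp
  next
    case y: True
    show ?thesis
    proof (cases "y u / a \<noteq> y w / b \<or> y u = 0 \<or> y w = 0")
      case True
      then show ?thesis using off[OF y] by simp
    next
      case False
      obtain p where p: "p \<in> hpolys W j" "f = ind (pts \<Delta>) * p" using f by (auto simp: srdeg_def)
      \<comment> \<open>Moving in the direction of \<open>u\<close> leaves the hyperplane where the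
        two ratios agree, but stays in the coordinate subspace of the support of
        \<open>y\<close>.\<close>
      define yt where "yt t = y(u := y u + t)" for t
      have ytp: "yt t \<in> pts \<Delta>" for t
      proof -
        have "{v. yt t v \<noteq> 0} \<subseteq> {v. y v \<noteq> 0}" using False by (auto simp: yt_def)
        then show ?thesis using y down by (auto simp: pts_def)
      qed
      have pt: "p (yt t) = 0" if "t \<noteq> 0" for t
      proof -
        have "yt t u / a \<noteq> yt t w / b"
          using False that ab edge(2) by (auto simp: yt_def add_divide_distrib)
        then have "f (yt t) = 0" using off[OF ytp] by blast
        then show ?thesis using ytp by (simp add: p(2) ind_def)
      qed
      have "isCont (\<lambda>t. p (yt t)) 0" unfolding yt_def by (rule hpolys_continuous[OF p(1)])
      then have "(\<lambda>t. p (yt t)) \<midarrow>0\<rightarrow> p (yt 0)" by (simp add: isCont_def)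
      moreover have "(\<lambda>t. p (yt t)) \<midarrow>0\<rightarrow> 0"
        by (rule tendsto_eventually) (auto simp: eventually_at_filter pt)
      ultimately have "p (yt 0) = 0" by (rule LIM_unique)
      then show ?thesis using y by (simp add: p(2) ind_def yt_def)
    qed
  qed
qed

text \<open>\<open>M\<close> shifted by one degree, since a multiple of \<open>var z\<close> in
  degree \<open>j\<close> has a cofactor of degree \<open>j - 1\<close>.\<close>

definition Mp where "Mp j = (case j of 0 \<Rightarrow> {0} | Suc i \<Rightarrow> M i)"

text \<open>The face ring of the subdivision is generated by \<open>1\<close> and \<open>var z\<close> over the original one, since
  \<open>(pull (var u) - a * var z) * (pull (var w) - b * var z) = 0\<close>: the factors are the coordinates of
  \<open>u\<close> and \<open>w\<close>, which span no face of the subdivision.\<close>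

definition dec where "dec j g \<longleftrightarrow> (\<exists>p\<in>M j. \<exists>r\<in>Mp j. g = pull p + var z * pull r)"

lemma subspace_M: "subspace (M j)"
  using graded_module.sub[OF graded_W] .

lemma subspace_Mp: "subspace (Mp j)"
  using subspace_M by (auto simp: Mp_def split: nat.split)

lemma var_M:
  assumes "v \<in> W" "m \<in> M j"
  shows "var v * m \<in> M (Suc j)"
proof -
  obtain p where p: "p \<in> hpolys W j" "m = ind (pts \<Delta>) * p" using assms(2) by (auto simp: srdeg_def)
  then show ?thesis using var_mult_hpolys[OF finW assms(1) p(1)]
    by (auto simp: srdeg_def mult.left_commute intro!: image_eqI[of _ _ "var v * p"])
qed

lemma var_Mp: "v \<in> W \<Longrightarrow> m \<in> Mp j \<Longrightarrow> var v * m \<in> M j"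
  using var_M subspace_0[OF subspace_M] by (auto simp: Mp_def split: nat.splits)

lemma dec_add: "dec j g \<Longrightarrow> dec j h \<Longrightarrow> dec j (c *\<^sub>R g + h)"
proof -
  assume "dec j g" "dec j h"
  then obtain p r p' r' where *: "p \<in> M j" "r \<in> Mp j" "g = pull p + var z * pull r"
    "p' \<in> M j" "r' \<in> Mp j" "h = pull p' + var z * pull r'" by (auto simp: dec_def)
  have "c *\<^sub>R g + h = pull (c *\<^sub>R p + p') + var z * pull (c *\<^sub>R r + r')"
    unfolding * linear_add[OF linear_pull] linear_scale[OF linear_pull]
    by (auto simp: fun_eq_iff algebra_simps)
  then show ?thesis unfolding dec_def using * subspace_M subspace_Mp
    by (metis subspace_add subspace_scale)
qed

lemma dec_proj:
  assumes "v \<in> W" "dec j g"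
  shows "dec (Suc j) ((var v \<circ> proj) * g)"
proof -
  obtain p r where *: "p \<in> M j" "r \<in> Mp j" "g = pull p + var z * pull r" using assms(2) by (auto simp: dec_def)
  have "(var v \<circ> proj) * g = pull (var v * p) + var z * pull (var v * r)"
    unfolding * pull_mult by (simp only: distrib_left mult.left_commute)
  moreover have "var v * r \<in> Mp (Suc j)" using var_Mp[OF assms(1) *(2)] by (simp add: Mp_def)
  ultimately show ?thesis using var_M[OF assms(1) *(1)] by (auto simp: dec_def)
qed

lemma dec_zeta:
  assumes "dec j g"
  shows "dec (Suc j) (var z * g)"
proof -
  obtain p r where *: "p \<in> M j" "r \<in> Mp j" "g = pull p + var z * pull r" using assms by (auto simp: dec_def)
  \<comment> \<open>The coefficients come from solving the quadratic relation for the square of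
    \<open>var z\<close>; the product of the pulled back variables of \<open>u\<close> and
    \<open>w\<close> goes into \<open>?p\<close>, the terms linear in \<open>var z\<close> into
    \<open>?r\<close>.\<close>
  let ?p = "(- 1 / (a * b)) *\<^sub>R (var u * (var w * r))"
  let ?r = "p + (1 / a) *\<^sub>R (var u * r) + (1 / b) *\<^sub>R (var w * r)"
  have "var z * g = pull ?p + var z * pull ?r"
  proof
    fix y
    show "(var z * g) y = (pull ?p + var z * pull ?r) y"
    proof (cases "y \<in> pts \<Delta>'")
      case True
      have pu: "proj y u = y u + y z * a" "proj y w = y w + y z * b"
        using co_simps uw z_notin by (auto simp: proj_def)
      have "y u * y w = 0" using uw_0[OF True] by auto
      have "(- 1 / (a * b)) * (proj y u * (proj y w * r (proj y))) +
          y z * ((1 / a) * (proj y u * r (proj y)) + (1 / b) * (proj y w * r (proj y))) =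
          (y z * y z - y u * y w / (a * b)) * r (proj y)"
        unfolding pu using ab by (simp add: field_simps)
      also have "\<dots> = y z * y z * r (proj y)" using \<open>y u * y w = 0\<close> by simp
      finally have "y z * y z * r (proj y) = (- 1 / (a * b)) * (proj y u * (proj y w * r (proj y))) +
          y z * ((1 / a) * (proj y u * r (proj y)) + (1 / b) * (proj y w * r (proj y)))" by simp
      then show ?thesis using True by (simp add: *(3) pull_def var_def algebra_simps)
    qed (simp add: *(3) pull_def)
  qed
  moreover have "?p \<in> M (Suc j)"
    using var_M[OF uw(1) var_Mp[OF uw(2) *(2)]] subspace_M by (intro subspace_scale)
  moreover have "?r \<in> Mp (Suc j)"
    using *(1) var_Mp[OF uw(1) *(2)] var_Mp[OF uw(2) *(2)] subspace_M
    by (simp only: Mp_def nat.case) (intro subspace_add subspace_scale)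
  ultimately show ?thesis by (auto simp: dec_def)
qed

lemma dec_var:
  assumes v: "v \<in> insert z W" and g: "dec j g"
  shows "dec (Suc j) (var v * g)"
proof (cases "v = z")
  case True
  then show ?thesis using dec_zeta[OF g] by simp
next
  case False
  then have vW: "v \<in> W" using v by blast
  have "var v * g = (- co v) *\<^sub>R (var z * g) + (var v \<circ> proj) * g"
    using False by (auto simp: fun_eq_iff var_def proj_def algebra_simps)
  then show ?thesis using dec_add[OF dec_zeta[OF g] dec_proj[OF vW g]] by (simp only:)
qed

lemma dec_M':
  assumes "g \<in> M' j"
  shows "dec j g"
proof -
  have fW: "finite (insert z W)" using finW by simp
  have mono: "dec j (ind (pts \<Delta>') * mpow var (insert z W) \<alpha>)" if "\<alpha> \<in> multi_idx (insert z W) j" for \<alpha> j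
    using that
  proof (induction j arbitrary: \<alpha>)
    case 0
    have "1 \<in> hpolys W 0" using mpow_var_hpolys[of "\<lambda>_. 0" W 0] finW by simp
    then have "ind (pts \<Delta>) * 1 \<in> M 0" unfolding srdeg_def by (rule imageI)
    moreover have "ind (pts \<Delta>') * mpow var (insert z W) \<alpha> = pull (ind (pts \<Delta>) * 1) + var z * pull 0"
    proof -
      have "\<alpha> = (\<lambda>_. 0)" using 0 fW by simp
      then have "mpow var (insert z W) \<alpha> = 1" by (simp only: mpow_0)
      then show ?thesis using proj_pts by (auto simp: fun_eq_iff ind_def pull_def)
    qed
    moreover have "0 \<in> Mp 0" by (simp add: Mp_def)
    ultimately show ?case unfolding dec_def by blast
  next
    case (Suc j)
    obtain v \<beta> where v: "v \<in> insert z W" "\<beta> \<in> multi_idx (insert z W) j" "\<alpha> = \<beta>(v := Suc (\<beta> v))"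
      using multi_idx_pos[OF fW Suc.prems] by blast
    have "ind (pts \<Delta>') * mpow var (insert z W) \<alpha> = var v * (ind (pts \<Delta>') * mpow var (insert z W) \<beta>)"
      unfolding v(3) mpow_inc[OF fW v(1)] by (simp only: mult.left_commute)
    then show ?case using dec_var[OF v(1) Suc.IH[OF v(2)]] by (simp only:)
  qed
  have "dec j 0"
    unfolding dec_def using subspace_0[OF subspace_M] subspace_0[OF subspace_Mp]
    by (intro bexI[of _ 0]) (auto simp: pull_def fun_eq_iff)
  have "dec j (ind (pts \<Delta>') * p)" if "p \<in> hpolys (insert z W) j" for p
    using that unfolding hpolys_def
  proof (induction rule: span_induct_alt)
    case base
    show ?case using \<open>dec j 0\<close> by (simp only: mult_zero_right)
  next
    case (step c x y)
    have "dec j (ind (pts \<Delta>') * x)" using step(1) mono by blast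
    from dec_add[OF this step(2), of c] show ?case by (simp only: distrib_left mult_scaleR_right)
  qed
  then show ?thesis using assms by (auto simp: srdeg_def)
qed

text \<open>Decomposing the cofactors splits \<open>pull m\<close> into the image of an element of
  \<open>low\<close> and a multiple of \<open>var z\<close>. The difference of \<open>m\<close> and
  that element has image a multiple of \<open>var z\<close>, so \<open>pull_zeta\<close> makes it
  zero.\<close>

lemma pull_low:
  assumes m: "m \<in> M j" and l: "pull m \<in> low A th' M' j"
  shows "m \<in> low A th M j"
proof (cases j)
  case 0
  then have "pull m = 0" using l by (simp add: low_0)
  then show ?thesis using pull_ker[OF m] 0 by (simp only: low_0) simp
next
  case (Suc i)
  have gm': "graded_module A th' M'" by (rule graded_srdeg) (auto simp: finW finA)
  obtain g where g: "\<forall>x\<in>A. g x \<in> M' i" "pull m = (\<Sum>x\<in>A. th' x * g x)"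
    using l unfolding Suc low_Suc_iff[where M = M', OF finA graded_module.sub[OF gm']] by blast
  have "\<forall>x\<in>A. \<exists>p r. p \<in> M i \<and> r \<in> Mp i \<and> g x = pull p + var z * pull r"
    using dec_M' g(1) unfolding dec_def by blast
  then obtain p r where pr: "\<And>x. x \<in> A \<Longrightarrow> p x \<in> M i" "\<And>x. x \<in> A \<Longrightarrow> g x = pull (p x) + var z * pull (r x)"
    by metis
  let ?p = "\<Sum>x\<in>A. th x * p x" and ?r = "\<Sum>x\<in>A. th x * r x"
  have "pull m = (\<Sum>x\<in>A. pull (th x * p x) + var z * pull (th x * r x))"
    unfolding g(2)
  proof (rule sum.cong[OF refl])
    fix x assume "x \<in> A"
    then show "th' x * g x = pull (th x * p x) + var z * pull (th x * r x)"
      unfolding pr(2)[OF \<open>x \<in> A\<close>] pull_act by (simp only: distrib_left mult.left_commute)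
  qed
  also have "\<dots> = pull ?p + var z * pull ?r"
    by (simp only: sum.distrib linear_sum[OF linear_pull] sum_distrib_left)
  finally have "pull (m - ?p) = var z * pull ?r"
    by (simp only: linear_diff[OF linear_pull] add_diff_cancel_left')
  moreover have pl: "?p \<in> low A th M j"
    unfolding Suc low_Suc_iff[where M = M, OF finA subspace_M] using pr(1) by blast
  moreover have "m - ?p \<in> M j"
    using m pl graded_module.low_subset[OF graded_W] subspace_M by (intro subspace_diff) auto
  ultimately have "m - ?p = 0" by (intro pull_zeta)
  then show ?thesis using pl by (simp only: right_minus_eq)
qed

lemma stellar_cm:
  assumes "fan_cm A \<Delta>'"
  shows "fan_cm A \<Delta>"
  unfolding fan_cm_def
proof (rule cm_retract[where \<theta>' = th' and M' = M' and \<iota> = pull and h' = "coeff (hvec \<Delta>' (card A))"])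
  interpret E: fan_loc A \<Delta>' by standard (rule stellar_fan)
  show "graded_module A th M" by (rule graded_W)
  show gm': "graded_module A th' M'" by (rule graded_srdeg) (auto simp: finW finA)
  show "graded_module.hilbert A M (coeff (hvec \<Delta> (card A)))"
    by (rule hilbert_srdeg[OF finW order_refl finA cpx face_card graded_W])
  show "graded_module.hilbert A M' (coeff (hvec \<Delta>' (card A)))"
    by (rule hilbert_srdeg[OF _ _ finA stellar_complex E.face_card gm']) (auto simp: finW W')
  show "graded_module.cm A th' M' (coeff (hvec \<Delta>' (card A)))"
    using assms by (simp add: fan_cm_def W')
  show "linear pull" by (rule linear_pull)
  show "pull ` M j \<subseteq> M' j" for j by (rule pull_M)
  show "m = 0" if "m \<in> M j" "pull m = 0" for m j using pull_ker that by blast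
  show "pull (th v * m) = th' v * pull m" for v m by (rule pull_act)
  show "m \<in> low A th M j" if "m \<in> M j" "pull m \<in> low A th' M' j" for m j using pull_low that by blast
qed

end

section \<open>Making a fan regular by stellar subdivisions\<close>

lemma eventually_small_mult:
  assumes "0 < (g::real)"
  shows "\<forall>\<^sub>F \<epsilon> in at_right 0. \<epsilon> * k < g"
proof -
  have "((\<lambda>\<epsilon>. \<epsilon> * k) \<longlongrightarrow> 0 * k) (at_right 0)" by (intro tendsto_intros)
  then show ?thesis using assms by (intro order_tendstoD(2)[of _ "0 * k"]) auto
qed

context fan_loc
begin

text \<open>\<open>E\<close> refines \<open>\<Delta>\<close>, and \<open>\<psi>\<close> is strictly convex with respect to \<open>E\<close> on every single cone of \<open>\<Delta>\<close>;
  across the cones of \<open>\<Delta>\<close> nothing is asked of \<open>\<psi>\<close>. The last conjunct carries the descent of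
  freeness along the sequence of subdivisions.\<close>

definition subdiv :: "'e set set \<Rightarrow> ('e \<Rightarrow> real) \<Rightarrow> bool" where
  "subdiv E \<psi> \<longleftrightarrow> fan A E \<and> (\<forall>S\<in>E. \<exists>S0\<in>\<Delta>. S \<subseteq> ncone S0) \<and>
     (\<forall>S\<in>E. card S = card A \<longrightarrow> (\<forall>S0\<in>\<Delta>. S \<subseteq> ncone S0 \<longrightarrow>
        (\<exists>L. linear L \<and> (\<forall>w\<in>S. L w = \<psi> w) \<and> (\<forall>w\<in>(\<Union>E \<inter> ncone S0) - S. L w < \<psi> w)))) \<and>
     (fan_cm A E \<longrightarrow> fan_cm A \<Delta>)"

lemma vertex_in_cone:
  assumes S0: "S0 \<in> \<Delta>" and w: "w \<in> W" "w \<in> ncone S0"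
  shows "w \<in> S0"
proof -
  obtain c where c: "\<forall>x\<in>S0. 0 \<le> c x" "w = (\<Sum>x\<in>S0. c x *\<^sub>R x)" using w(2) by (auto simp: ncone_def)
  have "{w} \<in> \<Delta>" using w(1) down by blast
  then have "(if w \<in> {w} then 1 else 0) = (if w \<in> S0 then c w else 0)"
    using c by (intro face_unique[OF _ S0]) auto
  then show ?thesis by (auto split: if_splits)
qed

lemma subdiv_refl: "subdiv \<Delta> (\<lambda>_. 0)"
  unfolding subdiv_def
proof (intro conjI ballI impI)
  show "\<exists>S0\<in>\<Delta>. S \<subseteq> ncone S0" if "S \<in> \<Delta>" for S
    using that in_ncone fin_face by blast
  show "\<exists>L. linear L \<and> (\<forall>w\<in>S. L w = 0) \<and> (\<forall>w\<in>(W \<inter> ncone S0) - S. L w < (0::real))"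
    if S: "S \<in> \<Delta>" "card S = card A" and S0: "S0 \<in> \<Delta>" "S \<subseteq> ncone S0" for S S0
  proof -
    have "S \<subseteq> S0" using vertex_in_cone[OF S0(1)] S(1) S0(2) by blast
    then have "S = S0" using card_seteq[OF fin_face[OF S0(1)]] face_card[OF S0(1)] S(2) by simp
    then have "\<forall>w\<in>(W \<inter> ncone S0) - S. (0::real) < 0" using vertex_in_cone[OF S0(1)] by blast
    then show ?thesis by (intro exI[of _ "\<lambda>_. 0"] conjI linear_zero) blast+
  qed
qed (rule fan)

text \<open>In the common cone \<open>S1\<close> no cancellation is possible in a positive
  combination, so by uniqueness of representations every vertex used by \<open>u\<close> or
  \<open>w\<close> belongs to \<open>S0\<close>. A new vertex thus enters a cone of
  \<open>\<Delta>\<close> only together with its whole edge.\<close>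

lemma cone_extreme:
  assumes S0: "S0 \<in> \<Delta>" and S1: "S1 \<in> \<Delta>" "u \<in> ncone S1" "w \<in> ncone S1"
    and ab: "0 < a" "0 < b" and z: "a *\<^sub>R u + b *\<^sub>R w \<in> ncone S0"
  shows "u \<in> ncone S0" "w \<in> ncone S0"
proof -
  obtain \<alpha> \<beta> \<gamma> where \<alpha>: "\<forall>x\<in>S1. 0 \<le> \<alpha> x" "u = (\<Sum>x\<in>S1. \<alpha> x *\<^sub>R x)"
    and \<beta>: "\<forall>x\<in>S1. 0 \<le> \<beta> x" "w = (\<Sum>x\<in>S1. \<beta> x *\<^sub>R x)"
    and \<gamma>: "\<forall>x\<in>S0. 0 \<le> \<gamma> x" "a *\<^sub>R u + b *\<^sub>R w = (\<Sum>x\<in>S0. \<gamma> x *\<^sub>R x)"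
    using S1(2,3) z by (auto simp: ncone_def)
  have "(\<Sum>x\<in>S1. (a * \<alpha> x + b * \<beta> x) *\<^sub>R x) = (\<Sum>x\<in>S0. \<gamma> x *\<^sub>R x)"
    unfolding \<gamma>(2)[symmetric] \<alpha>(2) \<beta>(2) by (simp add: scaleR_add_left sum.distrib scaleR_sum_right)
  then have e: "(if x \<in> S1 then a * \<alpha> x + b * \<beta> x else 0) = (if x \<in> S0 then \<gamma> x else 0)" for x
    using \<alpha>(1) \<beta>(1) \<gamma>(1) ab by (intro face_unique[OF S1(1) S0]) auto
  have 0: "\<alpha> x = 0 \<and> \<beta> x = 0" if "x \<in> S1" "x \<notin> S0" for x
  proof -
    have "a * \<alpha> x + b * \<beta> x = 0" using e[of x] that by simp
    moreover have "0 \<le> a * \<alpha> x" "0 \<le> b * \<beta> x" using \<alpha>(1) \<beta>(1) ab that by auto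
    ultimately have "a * \<alpha> x = 0" "b * \<beta> x = 0" by linarith+
    then show ?thesis using ab by simp
  qed
  have f: "finite S1" "finite S0" using fin_face S1(1) S0 by auto
  have "(\<Sum>x\<in>S1. \<delta> x *\<^sub>R x) \<in> ncone S0" if \<delta>: "\<forall>x\<in>S1. 0 \<le> \<delta> x" "\<And>x. x \<in> S1 \<Longrightarrow> x \<notin> S0 \<Longrightarrow> \<delta> x = 0" for \<delta>
  proof (rule ncone_sum)
    fix x assume x: "x \<in> S1"
    show "\<delta> x *\<^sub>R x \<in> ncone S0"
    proof (cases "x \<in> S0")
      case True
      then show ?thesis using \<delta>(1) x f by (intro ncone_scale in_ncone) auto
    qed (use \<delta>(2)[OF x] in \<open>simp add: ncone_0\<close>)
  qed
  then show "u \<in> ncone S0" "w \<in> ncone S0" using \<alpha> \<beta> 0 by auto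
qed

text \<open>\<open>\<psi>\<close> is kept at the old vertices and set slightly below its linear
  interpolation at the new one. Convexity amounts to finitely many strict inequalities, which hold
  for all sufficiently small \<open>\<epsilon>\<close>.\<close>

lemma subdiv_stellar:
  assumes sd: "subdiv E \<psi>" and edge: "{u, w} \<in> E" "u \<noteq> w" and ab: "0 < a" "0 < b"
  shows "\<exists>\<psi>'. subdiv (stellar E u w (a *\<^sub>R u + b *\<^sub>R w)) \<psi>'"
proof -
  define z where "z = a *\<^sub>R u + b *\<^sub>R w"
  interpret E: edge_loc A E u w z a b
    by standard (use sd edge ab z_def in \<open>auto simp: subdiv_def\<close>)
  have ref: "\<exists>S0\<in>\<Delta>. S \<subseteq> ncone S0" if "S \<in> E" for S using sd that by (simp add: subdiv_def)
  obtain S1 where S1: "S1 \<in> \<Delta>" "u \<in> ncone S1" "w \<in> ncone S1" using ref[OF edge(1)] by auto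
  have uwz: "u \<in> ncone S0" "w \<in> ncone S0" if "S0 \<in> \<Delta>" "z \<in> ncone S0" for S0
    using cone_extreme[OF that(1) S1 ab] that(2) by (auto simp: z_def)
  let ?P = "{(S, S0). S \<in> E \<and> card S = card A \<and> S0 \<in> \<Delta> \<and> S \<subseteq> ncone S0}"
  have finP: "finite ?P"
    by (rule finite_subset[of _ "E \<times> \<Delta>"]) (use finD E.finD in auto)
  have "\<forall>p\<in>?P. \<exists>L. linear L \<and> (\<forall>w\<in>fst p. L w = \<psi> w) \<and> (\<forall>w\<in>(\<Union>E \<inter> ncone (snd p)) - fst p. L w < \<psi> w)"
    using sd by (auto simp: subdiv_def)
  from bchoice[OF this] obtain L where LL: "\<forall>p\<in>?P. linear (L p) \<and> (\<forall>w\<in>fst p. L p w = \<psi> w) \<and>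
      (\<forall>w\<in>(\<Union>E \<inter> ncone (snd p)) - fst p. L p w < \<psi> w)"
    by (elim exE)
  note L = bspec[OF LL, THEN conjunct1] bspec[OF bspec[OF LL, THEN conjunct2, THEN conjunct1]]
    bspec[OF bspec[OF LL, THEN conjunct2, THEN conjunct2]]
  have Lle: "L p x \<le> \<psi> x" if "p \<in> ?P" "x \<in> \<Union>E" "x \<in> ncone (snd p)" for p x
    using L(2)[OF that(1), of x] L(3)[OF that(1), of x] that by (cases "x \<in> fst p") auto
  \<comment> \<open>An endpoint of the edge lies off the facet, so interpolation along the edge
    strictly exceeds the linear function of that facet.\<close>
  have gap: "0 < a * \<psi> u + b * \<psi> w - L p z"
    if p: "p \<in> ?P" "\<not> {u, w} \<subseteq> fst p" "z \<in> ncone (snd p)" for p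
  proof -
    have c: "u \<in> ncone (snd p)" "w \<in> ncone (snd p)" using uwz[of "snd p"] p by auto
    have "L p u \<le> \<psi> u" "L p w \<le> \<psi> w" using Lle[OF p(1)] E.uw c by auto
    moreover have "L p u < \<psi> u \<or> L p w < \<psi> w"
      using L(3)[OF p(1), of u] L(3)[OF p(1), of w] E.uw c p(2) by auto
    ultimately have "0 \<le> a * (\<psi> u - L p u)" "0 \<le> b * (\<psi> w - L p w)"
      "0 < a * (\<psi> u - L p u) \<or> 0 < b * (\<psi> w - L p w)" using ab by auto
    then have "0 < a * (\<psi> u - L p u) + b * (\<psi> w - L p w)" by linarith
    then have "a * L p u + b * L p w < a * \<psi> u + b * \<psi> w" by (simp add: right_diff_distrib)
    then show ?thesis using L(1)[OF p(1)] by (simp add: z_def linear_add linear_scale)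
  qed
  \<comment> \<open>The first family concerns facets that survive and must stay below the lowered
    value at \<open>z\<close>. The second concerns facets that are cut: their functions are tilted
    by a multiple of \<open>\<epsilon>\<close> and must stay below \<open>\<psi>\<close> at the
    vertices off the facet.\<close>
  have "\<forall>\<^sub>F \<epsilon> in at_right 0. 0 < \<epsilon> \<and>
      (\<forall>p\<in>{p\<in>?P. \<not> {u, w} \<subseteq> fst p \<and> z \<in> ncone (snd p)}. \<epsilon> * 1 < a * \<psi> u + b * \<psi> w - L p z) \<and>
      (\<forall>p\<in>{p\<in>?P. {u, w} \<subseteq> fst p}. \<forall>v\<in>{u, w}. \<forall>x\<in>(\<Union>E \<inter> ncone (snd p)) - fst p.
         \<epsilon> * (- dual (fst p) v x / E.co v) < \<psi> x - L p x)"
  proof (intro eventually_conj eventually_ball_finite ballI)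
    show "\<forall>\<^sub>F \<epsilon> in at_right 0. (0::real) < \<epsilon>" by (simp add: eventually_at_right_less)
    show "\<forall>\<^sub>F \<epsilon> in at_right 0. \<epsilon> * 1 < a * \<psi> u + b * \<psi> w - L p z"
      if "p \<in> {p\<in>?P. \<not> {u, w} \<subseteq> fst p \<and> z \<in> ncone (snd p)}" for p
      using gap[of p] that by (intro eventually_small_mult) blast
    show "\<forall>\<^sub>F \<epsilon> in at_right 0. \<epsilon> * (- dual (fst p) v x / E.co v) < \<psi> x - L p x"
      if "p \<in> {p\<in>?P. {u, w} \<subseteq> fst p}" "x \<in> (\<Union>E \<inter> ncone (snd p)) - fst p" for p v x
      using L(3)[of p x] that by (intro eventually_small_mult) simp
    show "finite ((\<Union>E \<inter> ncone (snd p)) - fst p)" for p :: "'e set \<times> 'e set" using E.finW by blast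
  qed (use finP in auto)
  from eventually_happens'[OF trivial_limit_at_right_real this] obtain \<epsilon> where \<epsilon>0: "0 < \<epsilon>"
      and \<epsilon>1: "\<forall>p\<in>{p\<in>?P. \<not> {u, w} \<subseteq> fst p \<and> z \<in> ncone (snd p)}. \<epsilon> * 1 < a * \<psi> u + b * \<psi> w - L p z"
      and \<epsilon>2: "\<forall>p\<in>{p\<in>?P. {u, w} \<subseteq> fst p}. \<forall>v\<in>{u, w}. \<forall>x\<in>(\<Union>E \<inter> ncone (snd p)) - fst p.
         \<epsilon> * (- dual (fst p) v x / E.co v) < \<psi> x - L p x"
    by (elim exE conjE)
  have \<epsilon>2': "\<epsilon> < a * \<psi> u + b * \<psi> w - L p z"
    if "p \<in> ?P" "\<not> {u, w} \<subseteq> fst p" "z \<in> ncone (snd p)" for p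
  proof -
    have "p \<in> {p\<in>?P. \<not> {u, w} \<subseteq> fst p \<and> z \<in> ncone (snd p)}" using that by blast
    from bspec[OF \<epsilon>1 this] show ?thesis by simp
  qed
  have \<epsilon>3: "\<epsilon> * (- dual (fst p) v x / E.co v) < \<psi> x - L p x"
    if "p \<in> ?P" "{u, w} \<subseteq> fst p" "v \<in> {u, w}" "x \<in> (\<Union>E \<inter> ncone (snd p)) - fst p" for p v x
  proof -
    have "p \<in> {p\<in>?P. {u, w} \<subseteq> fst p}" using that by blast
    from bspec[OF bspec[OF bspec[OF \<epsilon>2 this] that(3)] that(4)] show ?thesis .
  qed
  define \<psi>' where "\<psi>' = \<psi>(z := a * \<psi> u + b * \<psi> w - \<epsilon>)"
  have \<psi>': "\<psi>' x = \<psi> x" if "x \<in> \<Union>E" for x using that E.z_notin by (auto simp: \<psi>'_def)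
  have \<psi>'z: "\<psi>' z = a * \<psi> u + b * \<psi> w - \<epsilon>" by (simp add: \<psi>'_def)
  let ?E' = "stellar E u w z"
  have "subdiv ?E' \<psi>'"
    unfolding subdiv_def
  proof (intro conjI ballI impI)
    show "fan A ?E'" by (rule E.stellar_fan)
    show "fan_cm A \<Delta>" if "fan_cm A ?E'"
      using E.stellar_cm[OF that] sd by (simp add: subdiv_def)
    show "\<exists>S0\<in>\<Delta>. S \<subseteq> ncone S0" if S: "S \<in> ?E'" for S
    proof (cases "z \<in> S")
      case True
      obtain S0 where S0: "S0 \<in> \<Delta>" "S - {z} \<union> {u, w} \<subseteq> ncone S0"
        using ref[OF E.stellar_faces(3)[OF S True]] by blast
      then have "z \<in> ncone S0" unfolding z_def using ab by (intro ncone_add ncone_scale) auto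
      then show ?thesis using S0 by blast
    next
      case False
      then show ?thesis using ref[OF E.stellar_faces(1)[OF S]] by simp
    qed
    fix S S0 assume S: "S \<in> ?E'" "card S = card A" and S0: "S0 \<in> \<Delta>" "S \<subseteq> ncone S0"
    show "\<exists>L. linear L \<and> (\<forall>w\<in>S. L w = \<psi>' w) \<and> (\<forall>w\<in>(\<Union>?E' \<inter> ncone S0) - S. L w < \<psi>' w)"
    proof (cases "z \<in> S")
      case False
      then have SE: "S \<in> E" using E.stellar_faces(1)[OF S(1)] by simp
      then have p: "(S, S0) \<in> ?P" using S(2) S0 by simp
      have "L (S, S0) x = \<psi>' x" if "x \<in> S" for x
      proof -
        have "x \<in> \<Union>E" using that SE by blast
        then show ?thesis using L(2)[OF p, of x] that by (simp add: \<psi>')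
      qed
      moreover have "L (S, S0) x < \<psi>' x" if x: "x \<in> (\<Union>?E' \<inter> ncone S0) - S" for x
      proof (cases "x = z")
        case True
        then show ?thesis using \<epsilon>2'[OF p] E.stellar_faces(2)[OF S(1)] x by (simp add: \<psi>'z)
      next
        case False
        then have "x \<in> \<Union>E" using x E.W' by blast
        then show ?thesis using L(3)[OF p, of x] x by (simp add: \<psi>')
      qed
      ultimately show ?thesis using L(1)[OF p] by blast
    next
      case True
      define T where "T = S - {z} \<union> {u, w}"
      have TE: "T \<in> E" using E.stellar_faces(3)[OF S(1) True] by (simp add: T_def)
      have fS: "finite S" using E.stellar_faces(1)[OF S(1)] E.fin_face by (metis finite_Diff_insert finite_Diff2 finite.emptyI finite_insert)
      have fT: "finite T" "independent T" using E.fin_face[OF TE] E.face_indep[OF TE] by auto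
      have zu: "z \<noteq> u" "z \<noteq> w" using E.z_notin E.uw by auto
      have cSz: "Suc (card (S - {z})) = card A" using True fS S(2) by (metis card_Suc_Diff1)
      \<comment> \<open>\<open>S\<close> misses at least one endpoint. Missing both would give
        \<open>T\<close> more vertices than any face can have, so \<open>T\<close> is
        \<open>S\<close> with \<open>z\<close> replaced by the single missing endpoint
        \<open>v\<close>.\<close>
      have "\<exists>v\<in>{u, w}. v \<notin> S \<and> T = insert v (S - {z})"
      proof -
        consider "u \<notin> S" "w \<in> S" | "w \<notin> S" "u \<in> S" | "u \<notin> S" "w \<notin> S"
          using E.stellar_faces(2)[OF S(1)] by auto
        then show ?thesis
        proof cases
          case 3
          then have "card T = Suc (Suc (card (S - {z})))"
            using fS edge(2) by (simp add: T_def)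
          then show ?thesis using E.face_card[OF TE] cSz by simp
        qed (auto simp: T_def zu zu[symmetric])
      qed
      then obtain v where v: "v \<in> {u, w}" "v \<notin> S" "T = insert v (S - {z})" by blast
      have cT: "card T = card A" using v fS cSz by simp
      have zS0: "z \<in> ncone S0" using True S0 by blast
      then have "T \<subseteq> ncone S0" using uwz[OF S0(1)] S0(2) by (auto simp: T_def)
      then have p: "(T, S0) \<in> ?P" using TE cT S0 by simp
      have uwT: "{u, w} \<subseteq> T" by (auto simp: T_def)
      have vT: "v \<in> T" using v(1) uwT by blast
      have cv: "0 < E.co v" using v(1) E.co_simps ab by auto
      \<comment> \<open>Tilted about the wall \<open>T - {v}\<close>: \<open>dual T v\<close>
        vanishes there and equals \<open>E.co v\<close> at \<open>z\<close>, so the value at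
        \<open>z\<close> drops by exactly \<open>\<epsilon>\<close>.\<close>
      define L' where "L' x = L (T, S0) x - \<epsilon> / E.co v * dual T v x" for x
      have lin: "linear L'" unfolding L'_def
        using linear_compose_sub[OF L(1)[OF p]
            linear_compose_scale_right[OF dual_props(1)[OF fT(2), of v], of "\<epsilon> / E.co v"]] by simp
      have dz: "dual T v z = E.co v"
      proof -
        have "dual T v z = a * dual T v u + b * dual T v w"
          using dual_props(1)[OF fT(2), of v] by (simp add: z_def linear_add linear_scale)
        then show ?thesis using dual_props(2)[OF fT(2), of u v] dual_props(2)[OF fT(2), of w v] uwT v(1) edge(2) E.co_simps
          by auto
      qed
      have Lz: "L (T, S0) z = a * \<psi> u + b * \<psi> w"
        using L(1)[OF p] L(2)[OF p, of u] L(2)[OF p, of w] uwT by (simp add: z_def linear_add linear_scale)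
      have "L' x = \<psi>' x" if x: "x \<in> S" for x
      proof (cases "x = z")
        case True
        then show ?thesis using dz Lz cv by (simp add: L'_def \<psi>'z)
      next
        case False
        then have xT: "x \<in> T" "x \<noteq> v" using x v by auto
        then have "dual T v x = 0" using dual_props(2)[OF fT(2), of x v] by simp
        moreover have "x \<in> \<Union>E" using xT TE by blast
        ultimately show ?thesis using L(2)[OF p, of x] xT by (simp add: L'_def \<psi>')
      qed
      moreover have "L' x < \<psi>' x" if x: "x \<in> (\<Union>?E' \<inter> ncone S0) - S" for x
      proof (cases "x = v")
        case True
        have "v \<in> \<Union>E" using vT TE by blast
        then show ?thesis
          using True L(2)[OF p, of v] vT dual_props(2)[OF fT(2) vT, of v] \<epsilon>0 cv by (simp add: L'_def \<psi>')
      next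
        case False
        then have xT: "x \<notin> T" using x v(3) by auto
        have "x \<noteq> z" using x True by blast
        then have xE: "x \<in> \<Union>E" using x E.W' by blast
        then have "\<epsilon> * (- dual T v x / E.co v) < \<psi> x - L (T, S0) x"
          using \<epsilon>3[OF p _ v(1), of x] uwT xT x by simp
        then show ?thesis using xE by (simp add: L'_def \<psi>')
      qed
      ultimately show ?thesis using lin by blast
    qed
  qed
  then show ?thesis unfolding z_def by blast
qed

definition crossing where "crossing E h = {(u, w). {u, w} \<in> E \<and> (0::real) < h u \<and> h w < 0}"

text \<open>Subdividing a crossed edge where it meets the hyperplane removes that crossing and adds
  none for \<open>h\<close>, because every new edge ends at a zero of \<open>h\<close>. The number
  of crossings therefore decreases to zero, one hyperplane after the other.\<close>

lemma subdiv_uncrossed: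
  assumes "finite H" "\<And>h. h \<in> H \<Longrightarrow> linear h"
  shows "\<exists>E \<psi>. subdiv E \<psi> \<and> (\<forall>h\<in>H. crossing E h = {})"
  using assms
proof (induction H)
  case empty
  then show ?case using subdiv_refl by auto
next
  case (insert h H)
  have lin: "linear g" if "g \<in> insert h H" for g using insert.prems that by blast
  have "\<exists>E' \<psi>'. subdiv E' \<psi>' \<and> (\<forall>g\<in>insert h H. crossing E' g = {})"
    if "subdiv E \<psi>" "\<forall>g\<in>H. crossing E g = {}" for E \<psi>
    using that
  proof (induction "card (crossing E h)" arbitrary: E \<psi> rule: less_induct)
    case less
    show ?case
    proof (cases "crossing E h = {}")
      case True
      then show ?thesis using less.prems by blast
    next
      case False
      then obtain u w where uw: "{u, w} \<in> E" "0 < h u" "h w < 0" by (auto simp: crossing_def)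
      \<comment> \<open>These weights put \<open>z\<close> on the hyperplane:
        \<open>h z = - h w * h u + h u * h w = 0\<close>.\<close>
      define a where "a = - h w"
      define b where "b = h u"
      have ab: "0 < a" "0 < b" using uw by (auto simp: a_def b_def)
      have ne: "u \<noteq> w" using uw by auto
      define z where "z = a *\<^sub>R u + b *\<^sub>R w"
      obtain \<psi>' where \<psi>': "subdiv (stellar E u w z) \<psi>'"
        using subdiv_stellar[OF less.prems(1) uw(1) ne ab] by (auto simp: z_def)
      interpret E: edge_loc A E u w z a b
        by standard (use less.prems uw ne ab z_def in \<open>auto simp: subdiv_def\<close>)
      let ?E' = "stellar E u w z"
      have hz: "h z = 0" using lin[of h] by (simp add: z_def linear_add linear_diff linear_scale a_def b_def)
      have old: "{p, q} \<in> E" if "{p, q} \<in> ?E'" "p \<noteq> z" "q \<noteq> z" for p q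
      proof -
        have "{p, q} - {z} = {p, q}" using that by auto
        then show ?thesis using E.stellar_faces(1)[OF that(1)] by simp
      qed
      have new: "{u, q} \<in> E" "{w, q} \<in> E" if q: "{z, q} \<in> ?E'" "q \<noteq> z" for q
      proof -
        have "{z, q} - {z} \<union> {u, w} \<in> E" using E.stellar_faces(3)[OF q(1)] by simp
        then have "{u, w, q} \<in> E" using q(2) by (simp add: insert_Diff_if insert_commute)
        then show "{u, q} \<in> E" "{w, q} \<in> E" using E.down[of "{u, w, q}"] by auto
      qed
      have "crossing ?E' h \<subseteq> crossing E h - {(u, w)}"
      proof
        fix x assume "x \<in> crossing ?E' h"
        then obtain p q where x: "x = (p, q)" "{p, q} \<in> ?E'" "0 < h p" "h q < 0" by (auto simp: crossing_def)
        then have "p \<noteq> z" "q \<noteq> z" using hz by auto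
        moreover have "\<not> {u, w} \<subseteq> {p, q}" using E.stellar_faces(2)[OF x(2)] .
        ultimately show "x \<in> crossing E h - {(u, w)}" using old x by (auto simp: crossing_def)
      qed
      moreover have "(u, w) \<in> crossing E h" using uw by (simp add: crossing_def)
      ultimately have "crossing ?E' h \<subset> crossing E h" by blast
      moreover have "finite (crossing E h)"
        by (rule finite_subset[of _ "\<Union>E \<times> \<Union>E"]) (use E.finW in \<open>auto simp: crossing_def\<close>)
      ultimately have "card (crossing ?E' h) < card (crossing E h)" by (rule psubset_card_mono[rotated])
      \<comment> \<open>Hyperplanes treated before stay uncrossed: a strict sign of \<open>g\<close>
        at \<open>z\<close> occurs at \<open>u\<close> or \<open>w\<close> already, and both are
        joined in \<open>E\<close> to every neighbour of \<open>z\<close>.\<close>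
      moreover have "crossing ?E' g = {}" if g: "g \<in> H" for g
      proof (rule ccontr)
        have gz: "g z = a * g u + b * g w" using lin[of g] g by (simp add: z_def linear_add linear_scale)
        have none: "\<not> ({p, q} \<in> E \<and> 0 < g p \<and> g q < 0)" for p q
          using less.prems(2) g by (auto simp: crossing_def)
        assume "crossing ?E' g \<noteq> {}"
        then obtain p q where pq: "{p, q} \<in> ?E'" "0 < g p" "g q < 0" by (auto simp: crossing_def)
        then have "p \<noteq> q" by auto
        consider "p = z" | "q = z" | "p \<noteq> z" "q \<noteq> z" by blast
        then show False
        proof cases
          case 1
          then have "{u, q} \<in> E" "{w, q} \<in> E" using new pq(1) \<open>p \<noteq> q\<close> by auto
          moreover have "0 < g u \<or> 0 < g w"
          proof (rule ccontr)
            assume "\<not> ?thesis"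
            then have "a * g u \<le> 0" "b * g w \<le> 0" using ab by (auto simp: mult_le_0_iff)
            then show False using gz pq(2) 1 by simp
          qed
          ultimately show False using none pq(3) by blast
        next
          case 2
          then have "{u, p} \<in> E" "{w, p} \<in> E" using new[of p] pq(1) \<open>p \<noteq> q\<close> by (auto simp: insert_commute)
          moreover have "g u < 0 \<or> g w < 0"
          proof (rule ccontr)
            assume "\<not> ?thesis"
            then have "0 \<le> a * g u" "0 \<le> b * g w" using ab by auto
            then show False using gz pq(3) 2 by simp
          qed
          ultimately show False using none pq(2) by (metis insert_commute)
        next
          case 3
          then show False using old[OF pq(1)] none pq by blast
        qed
      qed
      ultimately show ?thesis using less.hyps[of ?E' \<psi>'] \<psi>' by blast
    qed
  qed
  then show ?case using insert.IH lin by blast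
qed

text \<open>Adding a large multiple of \<open>\<phi>\<close>, which is linear on the cones of \<open>E\<close> and bends along the hyperplanes
  spanned by the walls of \<open>\<Delta>\<close>, turns the convexity of \<open>\<psi>\<close> on single cones of \<open>\<Delta>\<close> into a global one.\<close>
theorem fan_cm_all: "fan_cm A \<Delta>"
proof -
  let ?H = "(\<lambda>(S, x). dual S x) ` (SIGMA S:facets. S)"
  have finH: "finite ?H"
    using finD fin_face by (intro finite_imageI finite_SigmaI) (auto simp: facets_def)
  have linH: "linear h" if "h \<in> ?H" for h
    using that dual_props(1)[OF face_indep] by (auto simp: facets_def)
  obtain E \<psi> where E: "subdiv E \<psi>" "\<forall>h\<in>?H. crossing E h = {}"
    using subdiv_uncrossed[OF finH linH] by blast
  interpret E: fan_loc A E by standard (use E(1) in \<open>simp add: subdiv_def\<close>)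
  define \<phi> where "\<phi> x = (\<Sum>h\<in>?H. \<bar>h x\<bar>)" for x
  \<comment> \<open>The sign of \<open>h\<close> on the cone \<open>S\<close>; without crossings, a
    cone with a negative value of \<open>h\<close> has no positive one, which justifies the default
    \<open>-1\<close>.\<close>
  define sg where "sg S h = (if \<forall>x\<in>S. 0 \<le> h x then 1 else -1 :: real)" for S :: "'e set" and h :: "'e \<Rightarrow> real"
  define \<Phi> where "\<Phi> S x = (\<Sum>h\<in>?H. sg S h * h x)" for S x
  have \<Phi>lin: "linear (\<Phi> S)" for S
  proof -
    have "linear (\<lambda>x. sg S h * h x)" if "h \<in> ?H" for h
      using linear_compose_scale_right[OF linH[OF that], of "sg S h"] by simp
    then show ?thesis unfolding \<Phi>_def by (intro linear_compose_sum ballI)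
  qed
  have sg_le: "sg S h * h x \<le> \<bar>h x\<bar>" for S h x by (simp add: sg_def abs_if)
  have \<Phi>le: "\<Phi> S x \<le> \<phi> x" for S x unfolding \<Phi>_def \<phi>_def by (intro sum_mono sg_le)
  have \<Phi>eq: "\<Phi> S x = \<phi> x" if S: "S \<in> E" and x: "x \<in> S" for S x
    unfolding \<Phi>_def \<phi>_def
  proof (rule sum.cong[OF refl])
    fix h assume h: "h \<in> ?H"
    show "sg S h * h x = \<bar>h x\<bar>"
    proof (cases "\<forall>x\<in>S. 0 \<le> h x")
      case True
      then show ?thesis using x by (simp add: sg_def)
    next
      case False
      then obtain q where q: "q \<in> S" "h q < 0" by (auto simp: not_le)
      have "{x, q} \<in> E" by (rule E.down[OF S]) (use x q in auto)
      moreover have "(x, q) \<notin> crossing E h" using E(2) h by blast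
      ultimately have "h x \<le> 0" using q(2) by (auto simp: crossing_def not_less)
      then show ?thesis unfolding sg_def if_not_P[OF False] by simp
    qed
  qed
  have "\<exists>S0\<in>facets. S \<subseteq> ncone S0" if S: "S \<in> E.facets" for S
  proof -
    have "S \<in> E" using S by (simp add: E.facets_def)
    then obtain S0 where S0: "S0 \<in> \<Delta>" "S \<subseteq> ncone S0" using E(1) by (auto simp: subdiv_def)
    obtain S1 where S1: "S1 \<in> \<Delta>" "S0 \<subseteq> S1" "card S1 = card A" using pure[OF S0(1)] by blast
    then have "ncone S0 \<subseteq> ncone S1" using fin_face by (intro ncone_mono) auto
    then show ?thesis using S0(2) S1 by (auto simp: facets_def)
  qed
  then obtain S0 where S0: "\<And>S. S \<in> E.facets \<Longrightarrow> S0 S \<in> facets" "\<And>S. S \<in> E.facets \<Longrightarrow> S \<subseteq> ncone (S0 S)"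
    by metis
  have "\<forall>S\<in>E.facets. \<exists>L. linear L \<and> (\<forall>w\<in>S. L w = \<psi> w) \<and> (\<forall>w\<in>(\<Union>E \<inter> ncone (S0 S)) - S. L w < \<psi> w)"
  proof
    fix S assume S: "S \<in> E.facets"
    then have "S \<in> E" "card S = card A" "S0 S \<in> \<Delta>" "S \<subseteq> ncone (S0 S)"
      using S0[OF S] by (auto simp: E.facets_def facets_def)
    then show "\<exists>L. linear L \<and> (\<forall>w\<in>S. L w = \<psi> w) \<and> (\<forall>w\<in>(\<Union>E \<inter> ncone (S0 S)) - S. L w < \<psi> w)"
      using E(1) unfolding subdiv_def by blast
  qed
  from bchoice[OF this] obtain L where LL: "\<forall>S\<in>E.facets. linear (L S) \<and> (\<forall>w\<in>S. L S w = \<psi> w) \<and>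
      (\<forall>w\<in>(\<Union>E \<inter> ncone (S0 S)) - S. L S w < \<psi> w)"
    by (elim exE)
  note L = bspec[OF LL, THEN conjunct1] bspec[OF bspec[OF LL, THEN conjunct2, THEN conjunct1]]
    bspec[OF bspec[OF LL, THEN conjunct2, THEN conjunct2]]
  \<comment> \<open>A vertex outside the cone of \<open>S0 S\<close> lies beyond one of its walls;
    the functional of that wall is non-negative on \<open>S\<close> and negative at
    \<open>x\<close>, so its absolute value bends in between.\<close>
  have gap: "\<Phi> S x < \<phi> x" if S: "S \<in> E.facets" and x: "x \<in> \<Union>E" "x \<notin> ncone (S0 S)" for S x
  proof -
    have f: "S0 S \<in> \<Delta>" "card (S0 S) = card A" using S0(1)[OF S] by (auto simp: facets_def)
    note i = face_indep[OF f(1)] fin_face[OF f(1)]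
    have "x \<in> span (S0 S)" using x(1) E.W_cone ncone_span facet_span[OF f] by blast
    then obtain y where y: "y \<in> S0 S" "dual (S0 S) y x < 0"
      using x(2) ncone_iff_dual[OF i] by (auto simp: not_le)
    have h: "dual (S0 S) y \<in> ?H" using S0(1)[OF S] y(1) by (auto intro!: image_eqI[of _ _ "(S0 S, y)"])
    have "\<forall>x\<in>S. 0 \<le> dual (S0 S) y x" using S0(2)[OF S] ncone_iff_dual[OF i] y(1) by blast
    then have "sg S (dual (S0 S) y) * dual (S0 S) y x < \<bar>dual (S0 S) y x\<bar>" using y(2) by (simp add: sg_def)
    then show ?thesis
      unfolding \<Phi>_def \<phi>_def by (intro sum_strict_mono_ex1 finH ballI sg_le bexI[OF _ h])
  qed
  have finF: "finite E.facets" using E.finD by (simp add: E.facets_def)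
  have "\<forall>\<^sub>F N in sequentially. \<forall>S\<in>E.facets. \<forall>x\<in>{x\<in>\<Union>E. x \<notin> ncone (S0 S)}. L S x - \<psi> x < real N * (\<phi> x - \<Phi> S x)"
  proof (intro eventually_ball_finite ballI)
    show "finite {x\<in>\<Union>E. x \<notin> ncone (S0 S)}" for S
      by (rule finite_subset[OF _ E.finW]) blast
    show "\<forall>\<^sub>F N in sequentially. L S x - \<psi> x < real N * (\<phi> x - \<Phi> S x)"
      if S: "S \<in> E.facets" and x: "x \<in> {x\<in>\<Union>E. x \<notin> ncone (S0 S)}" for S x
    proof -
      have p: "0 < \<phi> x - \<Phi> S x" using gap[OF S] x by simp
      obtain M :: nat where M: "real M > (L S x - \<psi> x) / (\<phi> x - \<Phi> S x)" using reals_Archimedean2 by blast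
      show ?thesis
        using eventually_ge_at_top[of M]
      proof eventually_elim
        case (elim N)
        then have "(L S x - \<psi> x) / (\<phi> x - \<Phi> S x) < real N" using M by linarith
        then show ?case using p by (simp add: pos_divide_less_eq)
      qed
    qed
  qed (rule finF)
  from eventually_happens'[OF sequentially_bot this]
  obtain N where NN: "\<forall>S\<in>E.facets. \<forall>x\<in>{x\<in>\<Union>E. x \<notin> ncone (S0 S)}. L S x - \<psi> x < real N * (\<phi> x - \<Phi> S x)"
    by (elim exE)
  have N: "L S x - \<psi> x < real N * (\<phi> x - \<Phi> S x)"
    if "S \<in> E.facets" "x \<in> \<Union>E" "x \<notin> ncone (S0 S)" for S x
    using bspec[OF bspec[OF NN that(1)], of x] that(2,3) by simp
  have "E.regular (\<lambda>x. \<psi> x + real N * \<phi> x)"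
    unfolding E.regular_def
  proof
    fix S assume S: "S \<in> E.facets"
    then have SE: "S \<in> E" by (simp add: E.facets_def)
    let ?L = "\<lambda>x. L S x + real N * \<Phi> S x"
    have "linear ?L" using linear_compose_add[OF L(1)[OF S] linear_compose_scale_right[OF \<Phi>lin]] by simp
    moreover have "?L x = \<psi> x + real N * \<phi> x" if "x \<in> S" for x
      using L(2)[OF S that] \<Phi>eq[OF SE that] by simp
    moreover have "?L x < \<psi> x + real N * \<phi> x" if x: "x \<in> \<Union>E - S" for x
    proof (cases "x \<in> ncone (S0 S)")
      case True
      then have "L S x < \<psi> x" using L(3)[OF S, of x] x by blast
      moreover have "real N * \<Phi> S x \<le> real N * \<phi> x" by (intro mult_left_mono \<Phi>le) simp
      ultimately show ?thesis by linarith
    next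
      case False
      then show ?thesis using N[OF S _ False] x by (simp add: right_diff_distrib)
    qed
    ultimately show "\<exists>L. linear L \<and> (\<forall>w\<in>S. L w = \<psi> w + real N * \<phi> w) \<and>
        (\<forall>w\<in>\<Union>E - S. L w < \<psi> w + real N * \<phi> w)"
      by (intro exI[of _ ?L]) blast
  qed
  then have "fan_cm A E" by (rule E.regular_cm)
  then show ?thesis using E(1) by (simp add: subdiv_def)
qed

end

section \<open>Restriction of a fan to the faces of its cone\<close>

context fan_loc
begin

definition rstr where "rstr F = {G\<in>\<Delta>. G \<subseteq> ncone F}"

lemma ncone_sub_iff:
  assumes F: "F \<subseteq> A" and p: "p \<in> ncone A"
  shows "p \<in> ncone F \<longleftrightarrow> (\<forall>a\<in>A - F. dual A a p = 0)"
proof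
  assume "p \<in> ncone F"
  then obtain c where c: "p = (\<Sum>a\<in>F. c a *\<^sub>R a)" by (auto simp: ncone_def)
  show "\<forall>a\<in>A - F. dual A a p = 0"
  proof
    fix a assume a: "a \<in> A - F"
    have "dual A a p = (\<Sum>x\<in>F. c x * dual A a x)"
      using dual_props(1)[OF indA, of a] by (simp add: c linear_sum linear_scale)
    also have "\<dots> = 0"
    proof (intro sum.neutral ballI)
      fix x assume "x \<in> F"
      then have "dual A a x = 0" using dual_props(2)[OF indA, of x a] F a by auto
      then show "c x * dual A a x = 0" by simp
    qed
    finally show "dual A a p = 0" .
  qed
next
  assume 0: "\<forall>a\<in>A - F. dual A a p = 0"
  have "p = (\<Sum>a\<in>A. dual A a p *\<^sub>R a)" using dual_sum[OF indA finA] p ncone_span by fastforce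
  also have "\<dots> = (\<Sum>a\<in>F. dual A a p *\<^sub>R a)"
    using 0 F finA by (intro sum.mono_neutral_right) auto
  finally have "p = (\<Sum>a\<in>F. dual A a p *\<^sub>R a)" .
  moreover have "\<forall>a\<in>F. 0 \<le> dual A a p" using p ncone_iff_dual[OF indA finA] F by blast
  ultimately show "p \<in> ncone F" by (auto simp: ncone_def)
qed

lemma rstr_Int: "F \<subseteq> A \<Longrightarrow> G \<subseteq> A \<Longrightarrow> rstr (F \<inter> G) = rstr F \<inter> rstr G"
proof -
  assume FG: "F \<subseteq> A" "G \<subseteq> A"
  have "p \<in> ncone (F \<inter> G) \<longleftrightarrow> p \<in> ncone F \<and> p \<in> ncone G" if "p \<in> W" for p
  proof -
    have "p \<in> ncone A" "F \<inter> G \<subseteq> A" using W_cone that FG by blast+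
    then show ?thesis using ncone_sub_iff FG by blast
  qed
  then show ?thesis unfolding rstr_def by (intro set_eqI) (simp, blast)
qed

lemma rstr_mono: "G \<subseteq> F \<Longrightarrow> F \<subseteq> A \<Longrightarrow> rstr G \<subseteq> rstr F"
  using ncone_mono[of F G] finA finite_subset[of F A] by (auto simp: rstr_def)

lemma rstr_W: "\<Union>(rstr F) \<subseteq> W"
  by (auto simp: rstr_def)

lemma rstr_down: "H \<in> rstr F \<Longrightarrow> G \<subseteq> H \<Longrightarrow> G \<in> rstr F"
  using down by (auto simp: rstr_def)

text \<open>At a point of the face, a coordinate outside \<open>F\<close> is a sum of non-negative
  contributions of the vertices used and equals zero. So every vertex used lies on the face, and the
  representation is one in the restriction.\<close>

lemma rstr_fan:
  assumes F: "F \<subseteq> A"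
  shows "fan F (rstr F)"
  unfolding fan_def
proof (intro conjI ballI)
  show fF: "finite F" using F finA finite_subset by blast
  show "independent F" using indA F by (rule real_vector.independent_mono)
  show "abstract_complex (rstr F)"
    using finD emptyD fin_face down by (auto simp: abstract_complex_def rstr_def)
  show "\<Union>(rstr F) \<subseteq> ncone F" by (auto simp: rstr_def)
  have fA: "ncone F \<subseteq> ncone A" by (rule ncone_mono[OF finA F])
  fix p assume p: "p \<in> ncone F"
  then have pA: "p \<in> ncone A" using fA by blast
  have sums: "(\<Sum>w\<in>\<Union>(rstr F). y w *\<^sub>R w) = (\<Sum>w\<in>W. y w *\<^sub>R w)" if "{w. y w \<noteq> 0} \<in> rstr F" for y
    by (rule sum_support[symmetric, OF finW rstr_W]) (use that in blast)
  obtain y where y: "repr \<Delta> y p" using ex_repr[OF pA] by blast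
  then have y': "\<And>w. 0 \<le> y w" "{w. y w \<noteq> 0} \<in> \<Delta>" "p = (\<Sum>w\<in>W. y w *\<^sub>R w)" by (auto simp: repr_def)
  have "{w. y w \<noteq> 0} \<subseteq> ncone F"
  proof
    fix w assume w: "w \<in> {w. y w \<noteq> 0}"
    then have wW: "w \<in> W" using y'(2) by blast
    have "dual A a w = 0" if a: "a \<in> A - F" for a
    proof -
      have nn: "0 \<le> y v * dual A a v" if "v \<in> W" for v
        using y'(1)[of v] ncone_iff_dual[OF indA finA, of v] W_cone that a by auto
      have "(\<Sum>v\<in>W. y v * dual A a v) = dual A a p"
        using dual_props(1)[OF indA, of a] by (simp add: y'(3) linear_sum linear_scale)
      also have "\<dots> = 0" using p ncone_sub_iff[OF F pA] a by blast
      finally have "(\<Sum>v\<in>W. y v * dual A a v) = 0" .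
      then have "\<forall>v\<in>W. y v * dual A a v = 0" by (simp only: sum_nonneg_eq_0_iff[OF finW nn])
      then have "y w * dual A a w = 0" using wW by (rule bspec)
      then show ?thesis using w by simp
    qed
    then show "w \<in> ncone F" using ncone_sub_iff[OF F, of w] W_cone wW by blast
  qed
  then have s: "{w. y w \<noteq> 0} \<in> rstr F" using y'(2) by (simp add: rstr_def)
  show "\<exists>!y. repr (rstr F) y p"
  proof (rule ex1I[of _ y])
    show "repr (rstr F) y p" using y' s sums[OF s] by (simp add: repr_def)
    fix x assume x: "repr (rstr F) x p"
    then have "{w. x w \<noteq> 0} \<in> rstr F" by (simp add: repr_def)
    then have "repr \<Delta> x p" using x sums[of x] by (auto simp: repr_def rstr_def)
    then show "x = y" using y repr_unique by blast
  qed
qed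

text \<open>Identifies the restricted parameters with those of the smaller fan, so that its freeness
  can be quoted, and supplies the vanishing of the parameters outside \<open>F\<close>.\<close>

lemma theta_rstr:
  assumes F: "F \<subseteq> A" and a: "a \<in> A" and y: "y \<in> pts (rstr F)"
  shows "lform W (dual A a) y = (if a \<in> F then lform (\<Union>(rstr F)) (dual F a) y else 0)"
proof -
  have "{w. y w \<noteq> 0} \<in> rstr F" using y by (simp add: pts_def)
  then have supp: "w \<in> \<Union>(rstr F)" if "y w \<noteq> 0" for w using that by blast
  have fF: "finite F" "independent F"
    using F finA finite_subset real_vector.independent_mono[OF indA F] by auto
  have d: "dual A a w = (if a \<in> F then dual F a w else 0)" if "w \<in> \<Union>(rstr F)" for w
  proof -
    have w: "w \<in> ncone F" "w \<in> ncone A" using that W_cone by (auto simp: rstr_def)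
    show ?thesis
    proof (cases "a \<in> F")
      case True
      have "w = (\<Sum>x\<in>F. dual F x w *\<^sub>R x)" using dual_sum[OF fF(2,1)] w(1) ncone_span by fastforce
      also have "\<dots> = (\<Sum>x\<in>A. (if x \<in> F then dual F x w else 0) *\<^sub>R x)"
        using F finA by (intro sum.mono_neutral_cong_left) auto
      finally show ?thesis using dual_comb[OF indA finA a, of "\<lambda>x. if x \<in> F then dual F x w else 0"] True by simp
    next
      case False
      then show ?thesis using ncone_sub_iff[OF F w(2)] w(1) a by simp
    qed
  qed
  have "lform W (dual A a) y = (\<Sum>w\<in>\<Union>(rstr F). dual A a w * y w)"
    unfolding lform_apply using supp finW rstr_W[of F] by (intro sum.mono_neutral_right) auto
  also have "\<dots> = (\<Sum>w\<in>\<Union>(rstr F). (if a \<in> F then dual F a w else 0) * y w)"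
    using d by (intro sum.cong) auto
  finally show ?thesis by (simp add: lform_apply)
qed

text \<open>A \<open>face_system\<close> with \<open>P\<close> the polynomials in all vertices of
  the fan; freeness over \<open>F\<close> is \<open>fan_cm_all\<close> for the restricted
  fan.\<close>

lemma fan_local_decomposition:
  "\<exists>l :: 'e set \<Rightarrow> nat \<Rightarrow> nat. \<forall>F\<subseteq>A. \<forall>i. coeff (hvec (rstr F) (card F)) i = (\<Sum>K\<in>Pow F. int (l K i))"
proof -
  let ?th = "\<lambda>a. lform W (dual A a)"
  let ?e = "\<lambda>F. ind (pts (rstr F))"
  let ?h = "\<lambda>F. coeff (hvec (rstr F) (card F))"
  have sr: "(\<lambda>j. (*) (?e F) ` hpolys W j) = srdeg (rstr F) W" for F
    by (simp add: srdeg_def[abs_def])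
  interpret face_system A ?th "hpolys W" ?e ?h
  proof
    show "finite A" by (rule finA)
    show "subspace (hpolys W j)" for j by (rule subspace_hpolys)
    show "?th v * m \<in> hpolys W (Suc j)" if "m \<in> hpolys W j" for v m j
      by (rule lform_mult_hpolys[OF finW that])
    show "\<exists>F. finite F \<and> hpolys W j \<subseteq> span F" for j by (rule hpolys_finite_span[OF finW])
    show "?e G * ?e F = ?e G" if "G \<subseteq> F" "F \<subseteq> A" for F G
      using rstr_mono[OF that] by (auto simp: fun_eq_iff ind_def pts_def)
    show "?e F * ?th v = 0" if "F \<subseteq> A" "v \<in> A - F" for F v
    proof
      fix y show "(?e F * ?th v) y = 0 y"
        using theta_rstr[OF that(1), of v y] that(2) by (simp add: ind_def)
    qed
    fix F assume F: "F \<subseteq> A"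
    interpret R: fan_loc F "rstr F" by standard (rule rstr_fan[OF F])
    have gm: "graded_module F ?th (srdeg (rstr F) W)" by (rule graded_srdeg[OF finW R.finA])
    show "graded_module.hilbert F (\<lambda>j. (*) (?e F) ` hpolys W j) (?h F)"
      unfolding sr by (rule hilbert_srdeg[OF finW rstr_W R.finA R.cpx R.face_card gm])
    have M: "srdeg (rstr F) W = srdeg (rstr F) (\<Union>(rstr F))"
      by (rule ext, rule srdeg_cong[OF finW R.finW rstr_W order_refl]) (rule rstr_down)
    have l: "low F ?th (srdeg (rstr F) W) j = low F (\<lambda>a. lform (\<Union>(rstr F)) (dual F a)) (srdeg (rstr F) W) j" for j
    proof (rule low_cong)
      fix v m j assume v: "v \<in> F" and m: "m \<in> srdeg (rstr F) W j"
      show "?th v * m = lform (\<Union>(rstr F)) (dual F v) * m"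
        by (rule srdeg_mult_cong[OF m]) (use theta_rstr[OF F, of v] v F in auto)
    qed
    show "graded_module.cm F ?th (\<lambda>j. (*) (?e F) ` hpolys W j) (?h F)"
      unfolding sr graded_module.cm_def[OF gm] l
      using R.fan_cm_all unfolding fan_cm_def graded_module.cm_def[OF R.graded_W] M by blast
  next
    fix G g j assume G: "G \<subseteq> A" and g: "g \<in> hpolys W j"
    have fI: "finite (multi_idx W j)" by (rule finite_multi_idx[OF finW])
    obtain c where c: "g = (\<Sum>\<alpha>\<in>multi_idx W j. c \<alpha> *\<^sub>R mpow var W \<alpha>)"
      using g in_span_image[OF fI, of g "mpow var W"] by (auto simp: hpolys_def)
    let ?I = "\<lambda>F. {\<alpha> \<in> multi_idx W j. {w. \<alpha> w \<noteq> 0} \<in> rstr F}"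
    have eg: "?e F * (\<Sum>\<alpha>\<in>J. c \<alpha> *\<^sub>R mpow var W \<alpha>) =
        (\<Sum>\<alpha>\<in>J \<inter> ?I F. c \<alpha> *\<^sub>R (?e F * mpow var W \<alpha>))" if J: "J \<subseteq> multi_idx W j" for F J
    proof -
      have "?e F * (\<Sum>\<alpha>\<in>J. c \<alpha> *\<^sub>R mpow var W \<alpha>) = (\<Sum>\<alpha>\<in>J. c \<alpha> *\<^sub>R (?e F * mpow var W \<alpha>))"
        by (simp only: sum_distrib_left mult_scaleR_right)
      also have "\<dots> = (\<Sum>\<alpha>\<in>J \<inter> ?I F. c \<alpha> *\<^sub>R (?e F * mpow var W \<alpha>))"
      proof (rule sum.mono_neutral_right)
        show "finite J" using J fI finite_subset by blast
        show "\<forall>\<alpha>\<in>J - J \<inter> ?I F. c \<alpha> *\<^sub>R (?e F * mpow var W \<alpha>) = 0"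
        proof
          fix \<alpha> assume "\<alpha> \<in> J - J \<inter> ?I F"
          then have \<alpha>: "\<alpha> \<in> multi_idx W j" "{w. \<alpha> w \<noteq> 0} \<notin> rstr F" using J by auto
          have "?e F * mpow var W \<alpha> = 0" by (rule monomial_vanish[OF finW _ \<alpha>]) (rule rstr_down)
          then show "c \<alpha> *\<^sub>R (?e F * mpow var W \<alpha>) = 0" by (simp only: scaleR_zero_right)
        qed
      qed blast
      finally show ?thesis .
    qed
    \<comment> \<open>Only the monomials supported on faces inside the cone of \<open>G\<close> are
      kept. On \<open>F\<close> just those supported over both \<open>F\<close> and \<open>G\<close>
      are visible, and their coefficients vanish by independence when \<open>g\<close> vanishes over
      the intersection.\<close>
    define g' where "g' = (\<Sum>\<alpha>\<in>?I G. c \<alpha> *\<^sub>R mpow var W \<alpha>)"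
    have "g' \<in> hpolys W j" unfolding g'_def
      using subspace_hpolys by (intro subspace_sum subspace_scale mpow_var_hpolys) auto
    moreover have "?e G * g' = ?e G * g"
    proof -
      have "?I G \<inter> ?I G = multi_idx W j \<inter> ?I G" by blast
      then show ?thesis unfolding g'_def c using eg[of "?I G" G] eg[of "multi_idx W j" G] by simp
    qed
    moreover have "?e F * g' = 0" if F: "F \<subseteq> A" and 0: "?e (F \<inter> G) * g = 0" for F
    proof -
      have "(\<Sum>\<alpha>\<in>multi_idx W j \<inter> ?I (F \<inter> G). c \<alpha> *\<^sub>R (?e (F \<inter> G) * mpow var W \<alpha>)) = 0"
        using 0 eg[of "multi_idx W j" "F \<inter> G"] unfolding c by simp
      moreover have "multi_idx W j \<inter> ?I (F \<inter> G) = ?I (F \<inter> G)" by blast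
      ultimately have s: "(\<Sum>\<alpha>\<in>?I (F \<inter> G). c \<alpha> *\<^sub>R (?e (F \<inter> G) * mpow var W \<alpha>)) \<in> {0}" by simp
      have "indep_mod {0} (?I (F \<inter> G)) (\<lambda>\<alpha>. ?e (F \<inter> G) * mpow var W \<alpha>)"
        by (rule monomials_indep[OF finW]) (use rstr_W in blast)
      from indep_modD[OF this s] have c0: "c \<alpha> = 0" if "\<alpha> \<in> ?I (F \<inter> G)" for \<alpha> using that by blast
      have "?I G \<inter> ?I F = ?I (F \<inter> G)" using rstr_Int[OF F G] by blast
      then have "?e F * g' = (\<Sum>\<alpha>\<in>?I (F \<inter> G). c \<alpha> *\<^sub>R (?e F * mpow var W \<alpha>))"
        unfolding g'_def using eg[of "?I G" F] by simp
      also have "\<dots> = 0"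
      proof (rule sum.neutral, rule ballI)
        fix \<alpha> assume "\<alpha> \<in> ?I (F \<inter> G)"
        then show "c \<alpha> *\<^sub>R (?e F * mpow var W \<alpha>) = 0" by (simp only: c0 scaleR_zero_left)
      qed
      finally show ?thesis .
    qed
    ultimately show "\<exists>g'\<in>hpolys W j. ?e G * g' = ?e G * g \<and> (\<forall>F\<subseteq>A. ?e (F \<inter> G) * g = 0 \<longrightarrow> ?e F * g' = 0)"
      by blast
  qed
  show ?thesis by (rule local_decomposition)
qed

end

section \<open>From triangulations to fans\<close>

lemma h_of_f_face_num:
  assumes "finite K" "\<And>G. G \<in> K \<Longrightarrow> card G \<le> d"
  shows "h_of_f d (face_num K) = hvec K d"
proof -
  have "hvec K d = (\<Sum>i\<le>d. \<Sum>G\<in>{G\<in>K. card G = i}. [:0, 1:] ^ card G * [:1, -1:] ^ (d - card G))"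
    unfolding hvec_def by (rule sum.group[symmetric]) (use assms in auto)
  also have "\<dots> = (\<Sum>i\<le>d. of_nat (face_num K i) * ([:0, 1:] ^ i * [:1, -1:] ^ (d - i)))"
    by (intro sum.cong refl) (simp add: face_num_def)
  finally show ?thesis by (simp add: h_of_f_def mult.assoc)
qed

lemma fanI:
  assumes A: "finite A" "independent A" and cpx: "abstract_complex \<Delta>" and W: "\<Union>\<Delta> \<subseteq> ncone A"
    and ex: "\<And>p. p \<in> ncone A \<Longrightarrow> \<exists>S\<in>\<Delta>. p \<in> ncone S"
    and uniq: "\<And>S T c d. S \<in> \<Delta> \<Longrightarrow> T \<in> \<Delta> \<Longrightarrow> (\<And>w. w \<in> S \<Longrightarrow> 0 < c w) \<Longrightarrow> (\<And>w. w \<in> T \<Longrightarrow> 0 < d w) \<Longrightarrow>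
        (\<Sum>w\<in>S. c w *\<^sub>R w) = (\<Sum>w\<in>T. d w *\<^sub>R w) \<Longrightarrow> S = T \<and> (\<forall>w\<in>S. c w = d w)"
  shows "fan A \<Delta>"
  unfolding fan_def
proof (intro conjI ballI)
  have finW: "finite (\<Union>\<Delta>)" using cpx by (auto simp: abstract_complex_def)
  fix p assume "p \<in> ncone A"
  then obtain S where "S \<in> \<Delta>" "p \<in> ncone S" using ex by blast
  then obtain c where S: "S \<in> \<Delta>" "\<forall>w\<in>S. 0 \<le> c w" "p = (\<Sum>w\<in>S. c w *\<^sub>R w)"
    by (auto simp: ncone_def)
  let ?y = "\<lambda>w. if w \<in> S then c w else 0"
  have "{w. ?y w \<noteq> 0} \<subseteq> S" by auto
  then have "{w. ?y w \<noteq> 0} \<in> \<Delta>" using cpx S(1) unfolding abstract_complex_def by blast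
  moreover have "p = (\<Sum>w\<in>\<Union>\<Delta>. ?y w *\<^sub>R w)"
    using sum_support[OF finW Union_upper[OF S(1)], of ?y "\<lambda>w. w"] S(3) by simp
  ultimately have y: "repr \<Delta> ?y p" using S(2) by (auto simp: repr_def)
  have "x = y" if x: "repr \<Delta> x p" and y: "repr \<Delta> y p" for x y
  proof -
    have sx: "(\<Sum>w\<in>{w. z w \<noteq> 0}. z w *\<^sub>R w) = p" if z: "repr \<Delta> z p" for z
    proof -
      have "{w. z w \<noteq> 0} \<in> \<Delta>" "p = (\<Sum>w\<in>\<Union>\<Delta>. z w *\<^sub>R w)" using z by (auto simp: repr_def)
      moreover have "(\<Sum>w\<in>\<Union>\<Delta>. z w *\<^sub>R w) = (\<Sum>w\<in>{w. z w \<noteq> 0}. z w *\<^sub>R w)"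
        by (rule sum_support[OF finW Union_upper]) (use \<open>{w. z w \<noteq> 0} \<in> \<Delta>\<close> in auto)
      ultimately show ?thesis by simp
    qed
    have "{w. x w \<noteq> 0} = {w. y w \<noteq> 0} \<and> (\<forall>w\<in>{w. x w \<noteq> 0}. x w = y w)"
    proof (rule uniq)
      show "{w. x w \<noteq> 0} \<in> \<Delta>" "{w. y w \<noteq> 0} \<in> \<Delta>" using x y by (auto simp: repr_def)
      show "0 < x w" if "w \<in> {w. x w \<noteq> 0}" for w
        using x that by (auto simp: repr_def order_less_le)
      show "0 < y w" if "w \<in> {w. y w \<noteq> 0}" for w
        using y that by (auto simp: repr_def order_less_le)
      show "(\<Sum>w\<in>{w. x w \<noteq> 0}. x w *\<^sub>R w) = (\<Sum>w\<in>{w. y w \<noteq> 0}. y w *\<^sub>R w)"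
        by (simp only: sx[OF x] sx[OF y])
    qed
    then have e: "{w. x w \<noteq> 0} = {w. y w \<noteq> 0}" "\<And>w. x w \<noteq> 0 \<Longrightarrow> x w = y w" by auto
    show "x = y"
    proof
      fix w show "x w = y w" using e(1)[unfolded set_eq_iff, rule_format, of w] e(2)[of w] by auto
    qed
  qed
  then show "\<exists>!y. repr \<Delta> y p" using y by blast
qed (use assms in auto)

text \<open>The last coordinate turns a linear relation into one with coefficient sum zero, that is,
  an affine relation.\<close>

lemma homogenize_indep:
  fixes \<rho> :: "'v \<Rightarrow> 'a::euclidean_space"
  assumes F: "finite F" "inj_on \<rho> F" "\<not> affine_dependent (\<rho> ` F)"
  shows "indep_mod {0} F (\<lambda>v. (\<rho> v, 1 :: real))"
proof (rule indep_modI)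
  fix c v assume s: "(\<Sum>v\<in>F. c v *\<^sub>R (\<rho> v, 1::real)) \<in> {0}" and v: "v \<in> F"
  have "(\<Sum>v\<in>F. c v *\<^sub>R \<rho> v) = fst (\<Sum>v\<in>F. c v *\<^sub>R (\<rho> v, 1::real))" "sum c F = snd (\<Sum>v\<in>F. c v *\<^sub>R (\<rho> v, 1::real))"
    by (simp_all add: fst_sum snd_sum)
  then have 0: "(\<Sum>v\<in>F. c v *\<^sub>R \<rho> v) = 0" "sum c F = 0" using s by auto
  let ?u = "\<lambda>x. c (the_inv_into F \<rho> x)"
  have inv: "the_inv_into F \<rho> (\<rho> w) = w" if "w \<in> F" for w using F(2) that by (rule the_inv_into_f_f)
  have "sum ?u (\<rho> ` F) = sum c F" "(\<Sum>x\<in>\<rho> ` F. ?u x *\<^sub>R x) = (\<Sum>v\<in>F. c v *\<^sub>R \<rho> v)"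
    using F(2) inv by (auto simp: sum.reindex intro!: sum.cong)
  then have "sum ?u (\<rho> ` F) = 0" "(\<Sum>x\<in>\<rho> ` F. ?u x *\<^sub>R x) = 0" using 0 by auto
  then have "\<forall>x\<in>\<rho> ` F. ?u x = 0"
    using F(1,3) affine_dependent_explicit_finite[of "\<rho> ` F"] by blast
  then show "c v = 0" using v inv by force
qed

lemma cell_explicit:
  assumes F: "finite F" "inj_on \<rho> F"
  shows "x \<in> cell \<rho> F \<longleftrightarrow> (\<exists>u. (\<forall>w\<in>F. 0 \<le> u w) \<and> sum u F = (1::real) \<and> x = (\<Sum>w\<in>F. u w *\<^sub>R \<rho> w))"
proof
  assume "x \<in> cell \<rho> F"
  then obtain u where u: "\<forall>x\<in>\<rho> ` F. 0 \<le> u x" "sum u (\<rho> ` F) = 1" "(\<Sum>x\<in>\<rho> ` F. u x *\<^sub>R x) = x"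
    using F(1) by (auto simp: cell_def convex_hull_finite)
  then show "\<exists>u. (\<forall>w\<in>F. 0 \<le> u w) \<and> sum u F = (1::real) \<and> x = (\<Sum>w\<in>F. u w *\<^sub>R \<rho> w)"
    using F(2) by (intro exI[of _ "u \<circ> \<rho>"]) (auto simp: sum.reindex)
next
  assume "\<exists>u. (\<forall>w\<in>F. 0 \<le> u w) \<and> sum u F = (1::real) \<and> x = (\<Sum>w\<in>F. u w *\<^sub>R \<rho> w)"
  then obtain u where u: "\<forall>w\<in>F. 0 \<le> u w" "sum u F = 1" "x = (\<Sum>w\<in>F. u w *\<^sub>R \<rho> w)" by blast
  show "x \<in> cell \<rho> F"
    unfolding cell_def u(3) using u(1,2) F(1)
    by (intro convex_sum convex_convex_hull) (auto intro: hull_inc)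
qed

lemma realization_inj: "geometric_realization K \<rho> \<Longrightarrow> G \<in> K \<Longrightarrow> inj_on \<rho> G"
  by (auto simp: geometric_realization_def intro: inj_on_subset)

lemma cell_mono: "G \<subseteq> F \<Longrightarrow> cell \<rho> G \<subseteq> cell \<rho> F"
  by (simp add: cell_def hull_mono image_mono)

lemma realization_subcomplex:
  assumes r: "geometric_realization K \<rho>" and cK: "abstract_complex K" and c: "abstract_complex L" "L \<subseteq> K"
  shows "geometric_realization L \<rho>"
  unfolding geometric_realization_def
proof (intro conjI ballI)
  have sc: "simplicial_complex (cell \<rho> ` K)" using r by (simp add: geometric_realization_def)
  show "inj_on \<rho> (\<Union>L)" using r c(2) by (auto simp: geometric_realization_def intro: inj_on_subset)
  show aff: "\<not> affine_dependent (\<rho> ` F)" if "F \<in> L" for F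
    using r c(2) that by (auto simp: geometric_realization_def)
  show "simplicial_complex (cell \<rho> ` L)"
    unfolding simplicial_complex_def
  proof (intro conjI allI impI ballI; (elim conjE)?)
    show "finite (cell \<rho> ` L)" using c(1) by (simp add: abstract_complex_def)
    have LK: "S \<in> cell \<rho> ` K" if "S \<in> cell \<rho> ` L" for S
      using that image_mono[OF c(2)] by (rule subsetD[rotated])
    show "\<exists>n. n simplex S" if "S \<in> cell \<rho> ` L" for S
      using sc LK[OF that] unfolding simplicial_complex_def by meson
    show "F \<in> cell \<rho> ` L" if S: "S \<in> cell \<rho> ` L" "F face_of S" for F S
    proof -
      obtain G where G: "G \<in> L" "S = cell \<rho> G" using S(1) by blast
      have fin: "finite (\<rho> ` G)" using aff[OF G(1)] by (rule aff_independent_finite)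
      obtain B where B: "B \<subseteq> \<rho> ` G" "F = convex hull B"
        using face_of_convex_hull_subset[OF finite_imp_compact[OF fin] S(2)[unfolded G(2) cell_def]] .
      then obtain H where "H \<subseteq> G" "B = \<rho> ` H" by (meson subset_imageE)
      then have "F = cell \<rho> H" "H \<in> L" using B(2) G(1) c(1) by (auto simp: cell_def abstract_complex_def)
      then show ?thesis by blast
    qed
    show "S \<inter> S' face_of S" if "S \<in> cell \<rho> ` L" "S' \<in> cell \<rho> ` L" for S S'
      using sc LK[OF that(1)] LK[OF that(2)] unfolding simplicial_complex_def by meson
  qed
qed

lemma carrier_le_iff:
  assumes t: "triangulates \<Delta> \<delta> \<Gamma> \<gamma>" and G: "G \<in> \<Delta>" and F: "F \<in> \<Gamma>"
  shows "carrier_face \<delta> \<Gamma> \<gamma> G \<subseteq> F \<longleftrightarrow> cell \<delta> G \<subseteq> cell \<gamma> F"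
proof
  assume "carrier_face \<delta> \<Gamma> \<gamma> G \<subseteq> F"
  then show "cell \<delta> G \<subseteq> cell \<gamma> F"
    using carrier_face_props(2)[OF t G] cell_mono by blast
next
  assume "cell \<delta> G \<subseteq> cell \<gamma> F"
  then show "carrier_face \<delta> \<Gamma> \<gamma> G \<subseteq> F" by (rule carrier_face_props(3)[OF t G F])
qed

lemma restriction_eq:
  assumes t: "triangulates \<Delta> \<delta> \<Gamma> \<gamma>" and F: "F \<in> \<Gamma>"
  shows "restriction \<Delta> (carrier_face \<delta> \<Gamma> \<gamma>) F = {G\<in>\<Delta>. cell \<delta> G \<subseteq> cell \<gamma> F}"
  using carrier_le_iff[OF t _ F] by (auto simp: restriction_def)

text \<open>The point is that the restriction covers the cell of \<open>H\<close>. A point there is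
  relatively interior to some cell of \<open>\<Delta>\<close>; the carrier of that cell meets the
  cell of \<open>H\<close> in a face, which contains an interior point and therefore the whole
  cell.\<close>

lemma restriction_triangulates:
  assumes t: "triangulates \<Delta> \<delta> \<Gamma> \<gamma>" and H: "H \<in> \<Gamma>"
  shows "triangulates (restriction \<Delta> (carrier_face \<delta> \<Gamma> \<gamma>) H) \<delta> (Pow H) \<gamma>"
proof -
  let ?R = "restriction \<Delta> (carrier_face \<delta> \<Gamma> \<gamma>) H"
  note R = restriction_eq[OF t H]
  have cD: "abstract_complex \<Delta>" and cG: "abstract_complex \<Gamma>"
    and rD: "geometric_realization \<Delta> \<delta>" and rG: "geometric_realization \<Gamma> \<gamma>"
    and un: "\<Union>(cell \<delta> ` \<Delta>) = \<Union>(cell \<gamma> ` \<Gamma>)"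
    using t unfolding triangulates_def by argo+
  have PG: "Pow H \<subseteq> \<Gamma>" using cG H by (auto simp: abstract_complex_def)
  have cR: "abstract_complex ?R"
    using cD cell_mono[of _ _ \<delta>] unfolding R abstract_complex_def by (auto simp: cell_def) blast+
  have fH: "finite H" using cG H by (simp add: abstract_complex_def)
  have cP: "abstract_complex (Pow H)"
    using fH by (auto simp: abstract_complex_def intro: finite_subset)
  have "cell \<gamma> H \<subseteq> \<Union>(cell \<delta> ` ?R)"
  proof
    fix x assume x: "x \<in> cell \<gamma> H"
    then have "x \<in> \<Union>(cell \<delta> ` \<Delta>)" using un H by blast
    then obtain G where G: "G \<in> \<Delta>" "x \<in> cell \<delta> G" by blast
    have "finite G" using G cD by (simp add: abstract_complex_def)
    then obtain u where u: "\<forall>w\<in>G. 0 \<le> u w" "sum u G = 1" "x = (\<Sum>w\<in>G. u w *\<^sub>R \<delta> w)"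
      using G(2) cell_explicit[OF _ realization_inj[OF rD G(1)]] by blast
    \<comment> \<open>Dropping the vertices of weight zero puts \<open>x\<close> into the relative
      interior.\<close>
    define G0 where "G0 = {w\<in>G. u w \<noteq> 0}"
    have G0: "G0 \<in> \<Delta>" "finite G0" using cD G(1) \<open>finite G\<close> by (auto simp: G0_def abstract_complex_def)
    have u0: "\<forall>w\<in>G0. 0 < u w" using u(1) by (auto simp: G0_def order_less_le)
    have "sum u G0 = sum u G"
      by (rule sum.mono_neutral_left) (use \<open>finite G\<close> in \<open>auto simp: G0_def\<close>)
    moreover have "(\<Sum>w\<in>G0. u w *\<^sub>R \<delta> w) = (\<Sum>w\<in>G. u w *\<^sub>R \<delta> w)"
      by (rule sum.mono_neutral_left) (use \<open>finite G\<close> in \<open>auto simp: G0_def\<close>)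
    ultimately have s0: "sum u G0 = 1" "x = (\<Sum>w\<in>G0. u w *\<^sub>R \<delta> w)" using u(2,3) by simp_all
    note inj = realization_inj[OF rD G0(1)]
    have aff: "\<not> affine_dependent (\<delta> ` G0)" using rD G0(1) by (simp add: geometric_realization_def)
    let ?v = "\<lambda>z. u (the_inv_into G0 \<delta> z)"
    have inv: "the_inv_into G0 \<delta> (\<delta> w) = w" if "w \<in> G0" for w using inj that by (rule the_inv_into_f_f)
    have "(\<forall>z\<in>\<delta> ` G0. 0 < ?v z) \<and> sum ?v (\<delta> ` G0) = 1 \<and> (\<Sum>z\<in>\<delta> ` G0. ?v z *\<^sub>R z) = x"
      using u0 s0 inv inj by (auto simp: sum.reindex intro!: sum.cong)
    then have ri: "x \<in> rel_interior (cell \<delta> G0)"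
      unfolding cell_def rel_interior_convex_hull_explicit[OF aff] mem_Collect_eq
      by (intro exI[of _ ?v])
    let ?K = "carrier_face \<delta> \<Gamma> \<gamma> G0"
    note K = carrier_face_props[OF t G0(1)]
    have xK: "x \<in> cell \<gamma> (?K \<inter> H)"
      using ri rel_interior_subset K(2) x cell_Int[OF rG K(1) H] by blast
    have "simplicial_complex (cell \<gamma> ` \<Gamma>)" using rG by (simp add: geometric_realization_def)
    then have "cell \<gamma> ?K \<inter> cell \<gamma> H face_of cell \<gamma> ?K"
      using K(1) H unfolding simplicial_complex_def by blast
    then have face: "cell \<gamma> (?K \<inter> H) face_of cell \<gamma> ?K" by (simp add: cell_Int[OF rG K(1) H])
    have "cell \<delta> G0 \<subseteq> cell \<gamma> (?K \<inter> H)"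
      by (rule subset_of_face_of[OF face K(2)]) (use xK ri in blast)
    then have "cell \<delta> G0 \<subseteq> cell \<gamma> H" using cell_mono[of "?K \<inter> H" H \<gamma>] by blast
    then have "G0 \<in> ?R" using R G0(1) by blast
    then show "x \<in> \<Union>(cell \<delta> ` ?R)" using ri rel_interior_subset by blast
  qed
  moreover have "\<Union>(cell \<delta> ` ?R) \<subseteq> cell \<gamma> H" unfolding R by blast
  moreover have "\<Union>(cell \<gamma> ` Pow H) = cell \<gamma> H" using cell_mono[of _ H \<gamma>] by blast
  ultimately have un': "\<Union>(cell \<delta> ` ?R) = \<Union>(cell \<gamma> ` Pow H)" by blast
  have sub: "?R \<subseteq> \<Delta>" by (auto simp: restriction_def)
  show ?thesis
    unfolding triangulates_def
  proof (intro conjI cR cP un')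
    show "geometric_realization ?R \<delta>" by (rule realization_subcomplex[OF rD cD cR sub])
    show "geometric_realization (Pow H) \<gamma>" by (rule realization_subcomplex[OF rG cG cP PG])
    show "\<forall>G\<in>?R. \<exists>F\<in>Pow H. cell \<delta> G \<subseteq> cell \<gamma> F" unfolding R by blast
  qed
qed

text \<open>Fixes the degree in the \<open>h\<close>-polynomial of the restriction as
  \<open>card H\<close>, which identifies it with \<open>hvec\<close>.\<close>

lemma rank_restriction:
  assumes t: "triangulates \<Delta> \<delta> \<Gamma> \<gamma>" and H: "H \<in> \<Gamma>"
  defines "R \<equiv> restriction \<Delta> (carrier_face \<delta> \<Gamma> \<gamma>) H"
  shows "\<And>G. G \<in> R \<Longrightarrow> card G \<le> card H" "\<exists>G\<in>R. card G = card H"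
proof -
  have t': "triangulates R \<delta> (Pow H) \<gamma>" unfolding R_def by (rule restriction_triangulates[OF t H])
  have rk: "rank_cpx R = card H" by (rule rank_triangulation_simplex[OF t'])
  have R: "finite R" "{} \<in> R" using t' by (auto simp: triangulates_def abstract_complex_def)
  show "card G \<le> card H" if "G \<in> R" for G
    using rk R that by (auto simp: rank_cpx_def[symmetric] simp flip: rk) (simp add: rank_cpx_def)
  have "Max (card ` R) \<in> card ` R" using R by (intro Max_in) auto
  then show "\<exists>G\<in>R. card G = card H" using rk by (auto simp: rank_cpx_def)
qed

lemma rank_eqI:
  assumes "finite K" "\<And>G. G \<in> K \<Longrightarrow> card G \<le> d" "\<exists>G\<in>K. card G = d"
  shows "rank_cpx K = d" "h_poly K = hvec K d"
proof -
  show r: "rank_cpx K = d"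
    unfolding rank_cpx_def using assms by (intro Max_eqI) auto
  show "h_poly K = hvec K d" by (simp add: h_poly_def r h_of_f_face_num[OF assms(1,2)])
qed

text \<open>The realization is placed at height one and coned from the origin. Points of positive
  height rescale to points of the cells, and only the origin has height zero, so covering and
  intersection properties carry over.\<close>

lemma fan_of_triangulation:
  fixes \<gamma> :: "'w \<Rightarrow> 'a::euclidean_space" and \<sigma> :: "'v \<Rightarrow> 'a"
  assumes t: "triangulates \<Gamma> \<gamma> (Pow V) \<sigma>"
  defines "i \<equiv> \<lambda>w. (\<gamma> w, 1::real)" and "j \<equiv> \<lambda>v. (\<sigma> v, 1::real)"
  shows "fan (j ` V) ((`) i ` \<Gamma>)" "inj_on j V" "inj_on i (\<Union>\<Gamma>)"
    "\<And>F G. F \<subseteq> V \<Longrightarrow> G \<in> \<Gamma> \<Longrightarrow> i ` G \<subseteq> ncone (j ` F) \<longleftrightarrow> cell \<gamma> G \<subseteq> cell \<sigma> F"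
proof -
  have cG: "abstract_complex \<Gamma>" and cV: "abstract_complex (Pow V)"
    and rG: "geometric_realization \<Gamma> \<gamma>" and rV: "geometric_realization (Pow V) \<sigma>"
    and un: "\<Union>(cell \<gamma> ` \<Gamma>) = \<Union>(cell \<sigma> ` Pow V)"
    using t unfolding triangulates_def by argo+
  have fV: "finite V" using cV by (auto simp: abstract_complex_def)
  have fG: "finite G" if "G \<in> \<Gamma>" for G using cG that by (simp add: abstract_complex_def)
  have injV: "inj_on \<sigma> V" using realization_inj[OF rV] by blast
  have indV: "indep_mod {0} V j"
    unfolding j_def using rV by (intro homogenize_indep fV injV) (auto simp: geometric_realization_def)
  then show injj: "inj_on j V" using fV by (simp add: indep_mod_0_iff)
  have A: "independent (j ` V)" "finite (j ` V)" using indV fV by (auto simp: indep_mod_0_iff)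
  have indG: "indep_mod {0} G i" if "G \<in> \<Gamma>" for G
    unfolding i_def using rG that
    by (intro homogenize_indep fG realization_inj[OF rG]) (auto simp: geometric_realization_def)
  have "inj_on \<gamma> (\<Union>\<Gamma>)" using rG by (simp add: geometric_realization_def)
  then show inji: "inj_on i (\<Union>\<Gamma>)" by (auto simp: inj_on_def i_def)
  have injiG: "inj_on i G" if "G \<in> \<Gamma>" for G using inji that by (auto intro: inj_on_subset)
  have fs: "fst (\<Sum>w\<in>F. c w *\<^sub>R (\<rho> w, 1::real)) = (\<Sum>w\<in>F. c w *\<^sub>R \<rho> w)"
      "snd (\<Sum>w\<in>F. c w *\<^sub>R (\<rho> w, 1::real)) = sum c F" for F :: "'z set" and c and \<rho> :: "'z \<Rightarrow> 'a"
    by (simp_all add: fst_sum snd_sum)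
  have ncone_im: "p \<in> ncone ((\<lambda>w. (\<rho> w, 1::real)) ` F) \<longleftrightarrow>
      (\<exists>c. (\<forall>w\<in>F. 0 \<le> c w) \<and> p = (\<Sum>w\<in>F. c w *\<^sub>R (\<rho> w, 1)))"
    if inj: "inj_on (\<lambda>w. (\<rho> w, 1::real)) F" for F :: "'z set" and \<rho> :: "'z \<Rightarrow> 'a" and p
  proof
    assume "p \<in> ncone ((\<lambda>w. (\<rho> w, 1::real)) ` F)"
    then obtain c where "\<forall>x\<in>(\<lambda>w. (\<rho> w, 1::real)) ` F. 0 \<le> c x" "p = (\<Sum>x\<in>(\<lambda>w. (\<rho> w, 1::real)) ` F. c x *\<^sub>R x)"
      by (auto simp: ncone_def)
    then show "\<exists>c. (\<forall>w\<in>F. 0 \<le> c w) \<and> p = (\<Sum>w\<in>F. c w *\<^sub>R (\<rho> w, 1))"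
      using inj by (intro exI[of _ "\<lambda>w. c (\<rho> w, 1)"]) (auto simp: sum.reindex)
  next
    assume "\<exists>c. (\<forall>w\<in>F. 0 \<le> c w) \<and> p = (\<Sum>w\<in>F. c w *\<^sub>R (\<rho> w, 1))"
    then obtain c where c: "\<forall>w\<in>F. 0 \<le> c w" "p = (\<Sum>w\<in>F. c w *\<^sub>R (\<rho> w, 1))" by blast
    let ?c = "\<lambda>x. c (the_inv_into F (\<lambda>w. (\<rho> w, 1::real)) x)"
    have inv: "the_inv_into F (\<lambda>w. (\<rho> w, 1::real)) (\<rho> w, 1) = w" if "w \<in> F" for w
      using the_inv_into_f_f[OF inj that] by simp
    show "p \<in> ncone ((\<lambda>w. (\<rho> w, 1::real)) ` F)"
      unfolding ncone_def mem_Collect_eq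
      by (intro exI[of _ ?c]) (use c inv inj in \<open>auto simp: sum.reindex intro!: sum.cong\<close>)
  qed
  have point: "(x, s) \<in> ncone ((\<lambda>w. (\<rho> w, 1::real)) ` F) \<longleftrightarrow> (1 / s) *\<^sub>R x \<in> cell \<rho> F"
    if s: "0 < s" and F: "finite F" "inj_on \<rho> F" for x s and F :: "'z set" and \<rho> :: "'z \<Rightarrow> 'a"
  proof -
    have inj: "inj_on (\<lambda>w. (\<rho> w, 1::real)) F" using F(2) by (auto simp: inj_on_def)
    show ?thesis
      unfolding ncone_im[OF inj] cell_explicit[OF F]
    proof
      assume "\<exists>c. (\<forall>w\<in>F. 0 \<le> c w) \<and> (x, s) = (\<Sum>w\<in>F. c w *\<^sub>R (\<rho> w, 1))"
      then obtain c where c: "\<forall>w\<in>F. 0 \<le> c w" "(x, s) = (\<Sum>w\<in>F. c w *\<^sub>R (\<rho> w, 1))" by blast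
      have "fst (x, s) = (\<Sum>w\<in>F. c w *\<^sub>R \<rho> w)" "snd (x, s) = sum c F"
        unfolding c(2) by (simp_all only: fs)
      then have "x = (\<Sum>w\<in>F. c w *\<^sub>R \<rho> w)" "s = sum c F" by simp_all
      then show "\<exists>u. (\<forall>w\<in>F. 0 \<le> u w) \<and> sum u F = 1 \<and> (1 / s) *\<^sub>R x = (\<Sum>w\<in>F. u w *\<^sub>R \<rho> w)"
        using s c(1) by (intro exI[of _ "\<lambda>w. c w / s"]) (auto simp: scaleR_sum_right sum_divide_distrib[symmetric])
    next
      assume "\<exists>u. (\<forall>w\<in>F. 0 \<le> u w) \<and> sum u F = 1 \<and> (1 / s) *\<^sub>R x = (\<Sum>w\<in>F. u w *\<^sub>R \<rho> w)"
      then obtain u where u: "\<forall>w\<in>F. 0 \<le> u w" "sum u F = 1" "(1 / s) *\<^sub>R x = (\<Sum>w\<in>F. u w *\<^sub>R \<rho> w)" by blast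
      have "s *\<^sub>R ((1 / s) *\<^sub>R x) = x" using s by simp
      then have "x = (\<Sum>w\<in>F. (s * u w) *\<^sub>R \<rho> w)" unfolding u(3) by (simp add: scaleR_sum_right)
      moreover have "s = (\<Sum>w\<in>F. s * u w)" using u(2) by (simp flip: sum_distrib_left)
      ultimately have "(x, s) = (\<Sum>w\<in>F. (s * u w) *\<^sub>R (\<rho> w, 1))"
        by (simp only: prod_eq_iff fs fst_conv snd_conv)
      then show "\<exists>c. (\<forall>w\<in>F. 0 \<le> c w) \<and> (x, s) = (\<Sum>w\<in>F. c w *\<^sub>R (\<rho> w, 1))"
        using s u(1) by (intro exI[of _ "\<lambda>w. s * u w"]) auto
    qed
  qed
  have vert: "i w \<in> ncone (j ` F) \<longleftrightarrow> \<gamma> w \<in> cell \<sigma> F" if "F \<subseteq> V" for w F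
    unfolding i_def j_def using point[of 1 F \<sigma> "\<gamma> w"] that fV injV
    by (simp add: finite_subset inj_on_subset)
  show carr: "i ` G \<subseteq> ncone (j ` F) \<longleftrightarrow> cell \<gamma> G \<subseteq> cell \<sigma> F" if "F \<subseteq> V" "G \<in> \<Gamma>" for F G
  proof -
    have "i ` G \<subseteq> ncone (j ` F) \<longleftrightarrow> \<gamma> ` G \<subseteq> cell \<sigma> F" using vert[OF that(1)] by blast
    also have "\<dots> \<longleftrightarrow> cell \<gamma> G \<subseteq> cell \<sigma> F"
    proof
      assume "\<gamma> ` G \<subseteq> cell \<sigma> F"
      then show "cell \<gamma> G \<subseteq> cell \<sigma> F" unfolding cell_def[of \<gamma>] by (rule hull_minimal) (simp add: cell_def)
    qed (auto simp: cell_def intro: hull_inc)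
    finally show ?thesis .
  qed
  have cells: "cell \<gamma> G \<subseteq> cell \<sigma> V" if "G \<in> \<Gamma>" for G
  proof -
    have "\<Union>(cell \<sigma> ` Pow V) \<subseteq> cell \<sigma> V" using cell_mono[of _ V \<sigma>] by blast
    then show ?thesis using un that by blast
  qed
  show "fan (j ` V) ((`) i ` \<Gamma>)"
  proof (rule fanI[OF A(2,1)])
    show "abstract_complex ((`) i ` \<Gamma>)"
      unfolding abstract_complex_def
    proof (intro conjI ballI allI impI)
      show "finite ((`) i ` \<Gamma>)" "{} \<in> (`) i ` \<Gamma>" using cG by (auto simp: abstract_complex_def)
      show "finite F" if "F \<in> (`) i ` \<Gamma>" for F using that fG by auto
      show "G \<in> (`) i ` \<Gamma>" if "F \<in> (`) i ` \<Gamma>" "G \<subseteq> F" for F G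
      proof -
        obtain F' where F': "F' \<in> \<Gamma>" "F = i ` F'" using \<open>F \<in> (`) i ` \<Gamma>\<close> by blast
        obtain G' where G': "G' \<subseteq> F'" "G = i ` G'" using \<open>G \<subseteq> F\<close> F'(2) by (meson subset_imageE)
        have "G' \<in> \<Gamma>" using cG F'(1) G'(1) by (auto simp: abstract_complex_def)
        then show ?thesis using G'(2) by blast
      qed
    qed
    show "\<Union>((`) i ` \<Gamma>) \<subseteq> ncone (j ` V)" using carr[OF order_refl] cells by blast
    show "\<exists>S\<in>(`) i ` \<Gamma>. p \<in> ncone S" if p: "p \<in> ncone (j ` V)" for p
    proof -
      obtain c where c: "\<forall>v\<in>V. 0 \<le> c v" "p = (\<Sum>v\<in>V. c v *\<^sub>R j v)"
        using p ncone_im[of \<sigma> V] injj unfolding j_def by blast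
      obtain x s where xs: "p = (x, s)" by (cases p)
      have "snd (x, s) = sum c V" unfolding xs[symmetric] c(2) j_def by (simp only: fs)
      then have s: "s = sum c V" by simp
      show ?thesis
      proof (cases "s = 0")
        case True
        then have "\<forall>v\<in>V. c v = 0" using c(1) s sum_nonneg_eq_0_iff[OF fV, of c] by auto
        then have "p = 0" using c(2) by simp
        then have "p \<in> ncone (i ` {})" using ncone_0 by blast
        moreover have "{} \<in> \<Gamma>" using cG by (simp add: abstract_complex_def)
        ultimately show ?thesis by blast
      next
        case False
        then have s0: "0 < s" using sum_nonneg[of V c] c(1) s by auto
        then have "(1 / s) *\<^sub>R x \<in> cell \<sigma> V" using point[OF s0 fV injV] p xs by (simp add: j_def)
        then have "(1 / s) *\<^sub>R x \<in> \<Union>(cell \<gamma> ` \<Gamma>)" using un by blast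
        then obtain G where G: "G \<in> \<Gamma>" "(1 / s) *\<^sub>R x \<in> cell \<gamma> G" by blast
        then have "p \<in> ncone (i ` G)"
          using point[OF s0 fG[OF G(1)] realization_inj[OF rG G(1)]] xs by (simp add: i_def)
        then show ?thesis using G(1) by blast
      qed
    qed
    fix S T c d
    assume S: "S \<in> (`) i ` \<Gamma>" and T: "T \<in> (`) i ` \<Gamma>" and c: "\<And>w. w \<in> S \<Longrightarrow> 0 < c w" and d: "\<And>w. w \<in> T \<Longrightarrow> 0 < d w"
      and eq: "(\<Sum>w\<in>S. c w *\<^sub>R w) = (\<Sum>w\<in>T. d w *\<^sub>R w)"
    \<comment> \<open>A common point of two cones rescales into the cell of
      \<open>G \<inter> H\<close>. Independence over \<open>G\<close> then forces zero coefficients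
      outside \<open>H\<close>, while those of \<open>c\<close> are positive.\<close>
    have sub: "G \<subseteq> H" if G: "G \<in> \<Gamma>" and H: "H \<in> \<Gamma>" and c: "\<And>w. w \<in> G \<Longrightarrow> 0 < c w" and d: "\<And>w. w \<in> H \<Longrightarrow> 0 < d w"
      and eq: "(\<Sum>w\<in>G. c w *\<^sub>R i w) = (\<Sum>w\<in>H. d w *\<^sub>R i w)" for G H :: "'w set" and c d :: "'w \<Rightarrow> real"
    proof (cases "G = {}")
      case False
      define s where "s = sum c G"
      have s0: "0 < s" unfolding s_def using False fG[OF G] c by (intro sum_pos) auto
      define x where "x = (\<Sum>w\<in>G. c w *\<^sub>R \<gamma> w)"
      have pG: "(x, s) = (\<Sum>w\<in>G. c w *\<^sub>R i w)"
        unfolding i_def x_def s_def prod_eq_iff by (simp add: fst_sum snd_sum)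
      have gi: "inj_on (\<lambda>w. (\<gamma> w, 1::real)) G'" if "G' \<in> \<Gamma>" for G' using injiG[OF that] by (simp add: i_def)
      have "(x, s) \<in> ncone (i ` G)"
        unfolding i_def ncone_im[OF gi[OF G]]
        by (intro exI[of _ c] conjI ballI less_imp_le c pG[unfolded i_def])
      moreover have "(x, s) \<in> ncone (i ` H)"
        unfolding i_def ncone_im[OF gi[OF H]]
        by (intro exI[of _ d] conjI ballI less_imp_le d trans[OF pG eq, unfolded i_def])
      ultimately have "(1 / s) *\<^sub>R x \<in> cell \<gamma> G \<inter> cell \<gamma> H"
        using point[OF s0 fG[OF G] realization_inj[OF rG G]] point[OF s0 fG[OF H] realization_inj[OF rG H]]
        by (simp add: i_def)
      then have GH: "(1 / s) *\<^sub>R x \<in> cell \<gamma> (G \<inter> H)" using cell_Int[OF rG G H] by simp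
      have GHG: "G \<inter> H \<in> \<Gamma>" using cG G by (auto simp: abstract_complex_def)
      have "(x, s) \<in> ncone (i ` (G \<inter> H))"
        using point[OF s0 fG[OF GHG] realization_inj[OF rG GHG]] GH by (simp add: i_def)
      then obtain e where e: "(x, s) = (\<Sum>w\<in>G \<inter> H. e w *\<^sub>R i w)"
        unfolding i_def ncone_im[OF gi[OF GHG]] by blast
      let ?e = "\<lambda>w. if w \<in> H then e w else 0"
      have "(\<Sum>w\<in>G \<inter> H. e w *\<^sub>R i w) = (\<Sum>w\<in>G. ?e w *\<^sub>R i w)"
        using fG[OF G] by (intro sum.mono_neutral_cong_left) auto
      then have "(\<Sum>w\<in>G. (c w - ?e w) *\<^sub>R i w) \<in> {0}"
        using pG e by (simp add: scaleR_diff_left sum_subtractf)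
      then have "c w - ?e w = 0" if "w \<in> G" for w using indep_modD[OF indG[OF G], of "\<lambda>w. c w - ?e w"] that by blast
      then show ?thesis using c by (metis diff_zero less_irrefl subsetI)
    qed simp
    obtain G where G: "G \<in> \<Gamma>" "S = i ` G" using S by blast
    obtain H where H: "H \<in> \<Gamma>" "T = i ` H" using T by blast
    have eq': "(\<Sum>w\<in>G. c (i w) *\<^sub>R i w) = (\<Sum>w\<in>H. d (i w) *\<^sub>R i w)"
      using eq injiG[OF G(1)] injiG[OF H(1)] by (simp add: G(2) H(2) sum.reindex)
    have "G \<subseteq> H" by (rule sub[OF G(1) H(1) _ _ eq']) (use c d G(2) H(2) in auto)
    moreover have "H \<subseteq> G" by (rule sub[OF H(1) G(1) _ _ eq'[symmetric]]) (use c d G(2) H(2) in auto)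
    ultimately have GH: "G = H" by blast
    have "(\<Sum>w\<in>G. (c (i w) - d (i w)) *\<^sub>R i w) \<in> {0}"
      using eq' GH by (simp add: scaleR_diff_left sum_subtractf)
    then have "c (i w) - d (i w) = 0" if "w \<in> G" for w
      using indep_modD[OF indG[OF G(1)], of "\<lambda>w. c (i w) - d (i w)"] that by blast
    then show "S = T \<and> (\<forall>w\<in>S. c w = d w)" using G(2) H(2) GH by auto
  qed
qed

lemma triangulation_decomposition:
  fixes \<gamma> :: "'w \<Rightarrow> 'a::euclidean_space" and \<sigma> :: "'v \<Rightarrow> 'a"
  assumes t: "triangulates \<Gamma> \<gamma> (Pow V) \<sigma>"
  shows "\<exists>l :: 'v set \<Rightarrow> nat \<Rightarrow> nat. \<forall>F\<subseteq>V. \<forall>k.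
    coeff (hvec (restriction \<Gamma> (carrier_face \<gamma> (Pow V) \<sigma>) F) (card F)) k = (\<Sum>K\<in>Pow F. int (l K k))"
proof -
  let ?i = "\<lambda>w. (\<gamma> w, 1::real)" and ?j = "\<lambda>v. (\<sigma> v, 1::real)"
  note fn = fan_of_triangulation[OF t]
  interpret fan_loc "?j ` V" "(`) ?i ` \<Gamma>" by standard (rule fn(1))
  obtain l :: "('a \<times> real) set \<Rightarrow> nat \<Rightarrow> nat" where
    l: "\<And>F k. F \<subseteq> ?j ` V \<Longrightarrow> coeff (hvec (rstr F) (card F)) k = (\<Sum>K\<in>Pow F. int (l K k))"
    using fan_local_decomposition by blast
  show ?thesis
  proof (intro exI[of _ "\<lambda>K. l (?j ` K)"] allI impI)
    fix F k assume F: "F \<subseteq> V"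
    let ?R = "restriction \<Gamma> (carrier_face \<gamma> (Pow V) \<sigma>) F"
    have R: "?R = {G\<in>\<Gamma>. ?i ` G \<subseteq> ncone (?j ` F)}"
    proof -
      have "?R = {G\<in>\<Gamma>. cell \<gamma> G \<subseteq> cell \<sigma> F}" using F by (intro restriction_eq[OF t]) simp
      also have "\<dots> = {G\<in>\<Gamma>. ?i ` G \<subseteq> ncone (?j ` F)}"
        by (intro Collect_cong conj_cong refl) (rule fn(4)[OF F, symmetric])
      finally show ?thesis .
    qed
    have rs: "rstr (?j ` F) = (`) ?i ` ?R" unfolding R rstr_def by blast
    have inj: "inj_on ((`) ?i) ?R"
    proof (rule inj_onI)
      fix G H assume "G \<in> ?R" "H \<in> ?R" "?i ` G = ?i ` H"
      then show "G = H"
        using inj_on_image_eq_iff[OF fn(3), of G H] by (auto simp: restriction_def)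
    qed
    have cG: "card (?i ` G) = card G" if "G \<in> ?R" for G
    proof -
      have "inj_on ?i G" using fn(3) by (rule inj_on_subset) (use that in \<open>auto simp: restriction_def\<close>)
      then show ?thesis by (rule card_image)
    qed
    have jF: "inj_on ?j F" using fn(2) F by (rule inj_on_subset)
    have "hvec (rstr (?j ` F)) (card (?j ` F)) = hvec ?R (card F)"
      unfolding hvec_def rs sum.reindex[OF inj] card_image[OF jF] o_def using cG by (intro sum.cong) auto
    then have "coeff (hvec ?R (card F)) k = (\<Sum>K\<in>Pow (?j ` F). int (l K k))"
      using l[of "?j ` F" k] F by auto
    also have "\<dots> = (\<Sum>K\<in>Pow F. int (l (?j ` K) k))"
    proof -
      have "inj_on ((`) ?j) (Pow F)" using jF by (rule inj_on_image_Pow)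
      then show ?thesis unfolding image_Pow_surj[OF refl, of ?j F, symmetric] by (subst sum.reindex) auto
    qed
    finally show "coeff (hvec ?R (card F)) k = (\<Sum>K\<in>Pow F. int (l (?j ` K) k))" .
  qed
qed

section \<open>The expansion of the local h-polynomial\<close>

lemma sum_interval:
  assumes "finite H" "L \<subseteq> H"
  shows "(\<Sum>K\<in>{K. K \<subseteq> H \<and> L \<subseteq> K}. f K) = (\<Sum>D\<in>Pow (H - L). f (L \<union> D))"
proof -
  have "bij_betw ((\<union>) L) (Pow (H - L)) {K. K \<subseteq> H \<and> L \<subseteq> K}"
    by (rule bij_betw_byWitness[where f' = "\<lambda>K. K - L"]) (use assms(2) in auto)
  from sum.reindex_bij_betw[OF this, of f] show ?thesis by simp
qed

lemma sum_Pow_swap: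
  fixes f :: "'a set \<Rightarrow> 'a set \<Rightarrow> 'r::comm_monoid_add"
  assumes "finite H"
  shows "(\<Sum>K\<in>Pow H. \<Sum>L\<in>Pow K. f K L) = (\<Sum>L\<in>Pow H. \<Sum>K\<in>{K. K \<subseteq> H \<and> L \<subseteq> K}. f K L)"
proof -
  have "(\<Sum>K\<in>Pow H. \<Sum>L\<in>Pow K. f K L) = (\<Sum>K\<in>Pow H. \<Sum>L\<in>{L. L \<in> Pow H \<and> L \<subseteq> K}. f K L)"
    by (intro sum.cong) auto
  also have "\<dots> = (\<Sum>L\<in>Pow H. \<Sum>K\<in>{K. K \<in> Pow H \<and> L \<subseteq> K}. f K L)"
    using assms by (intro sum.swap_restrict) auto
  finally show ?thesis by simp
qed

text \<open>The inner sum over an interval is a power of \<open>y + - y\<close>, which survives only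
  for \<open>L = H\<close>. With \<open>y = 1\<close> it yields local \<open>h\<close>-polynomials,
  with \<open>y = [:1, -1:]\<close> the contribution of the faces with a given carrier.\<close>

lemma weighted_moebius:
  fixes g :: "'a set \<Rightarrow> 'r::comm_ring_1"
  assumes H: "finite H" and a: "\<And>K. K \<subseteq> H \<Longrightarrow> a K = (\<Sum>L\<in>Pow K. y ^ (card K - card L) * g L)"
  shows "(\<Sum>K\<in>Pow H. (- y) ^ (card H - card K) * a K) = g H"
proof -
  have "(\<Sum>K\<in>Pow H. (- y) ^ (card H - card K) * a K) =
      (\<Sum>K\<in>Pow H. \<Sum>L\<in>Pow K. (- y) ^ (card H - card K) * (y ^ (card K - card L) * g L))"
    using a by (intro sum.cong) (auto simp: sum_distrib_left)
  also have "\<dots> = (\<Sum>L\<in>Pow H. \<Sum>K\<in>{K. K \<subseteq> H \<and> L \<subseteq> K}. (- y) ^ (card H - card K) * (y ^ (card K - card L) * g L))"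
    by (rule sum_Pow_swap[OF H])
  also have "\<dots> = (\<Sum>L\<in>Pow H. if L = H then g L else 0)"
  proof (rule sum.cong[OF refl])
    fix L assume "L \<in> Pow H"
    then have L: "L \<subseteq> H" "finite L" using H finite_subset by auto
    have cH: "card H = card L + card (H - L)" using L H by (metis card_Diff_subset card_mono le_add_diff_inverse)
    have "(\<Sum>K\<in>{K. K \<subseteq> H \<and> L \<subseteq> K}. (- y) ^ (card H - card K) * (y ^ (card K - card L) * g L)) =
        (\<Sum>D\<in>Pow (H - L). (- y) ^ (card H - card (L \<union> D)) * (y ^ (card (L \<union> D) - card L) * g L))"
      by (rule sum_interval[OF H L(1)])
    also have "\<dots> = (\<Sum>D\<in>Pow (H - L). y ^ card D * (- y) ^ (card (H - L) - card D) * g L)"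
    proof (rule sum.cong[OF refl])
      fix D assume D: "D \<in> Pow (H - L)"
      then have "finite D" using H finite_subset by blast
      then have "card (L \<union> D) = card L + card D" using D L(2) by (intro card_Un_disjoint) auto
      then show "(- y) ^ (card H - card (L \<union> D)) * (y ^ (card (L \<union> D) - card L) * g L) =
          y ^ card D * (- y) ^ (card (H - L) - card D) * g L" using cH by (simp add: ac_simps)
    qed
    also have "\<dots> = (y + - y) ^ card (H - L) * g L"
      by (simp only: sum_Pow_binomial[OF finite_Diff[OF H], symmetric] sum_distrib_right)
    also have "\<dots> = (if L = H then g L else 0)"
    proof (cases "L = H")
      case False
      then have "H - L \<noteq> {}" using L(1) by blast
      then have "card (H - L) \<noteq> 0" using H by simp
      then show ?thesis using False by (simp add: zero_power)
    qed simp
    finally show "(\<Sum>K\<in>{K. K \<subseteq> H \<and> L \<subseteq> K}. (- y) ^ (card H - card K) * (y ^ (card K - card L) * g L)) =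
        (if L = H then g L else 0)" .
  qed
  also have "\<dots> = g H" using H by simp
  finally show ?thesis .
qed

lemma sum_Pow_card:
  fixes g :: "nat \<Rightarrow> 'r::comm_ring_1"
  assumes "finite D"
  shows "(\<Sum>I\<in>Pow D. g (card I)) = (\<Sum>i\<le>card D. of_nat (card D choose i) * g i)"
proof -
  have "(\<Sum>I\<in>Pow D. g (card I)) = (\<Sum>i\<le>card D. \<Sum>I\<in>{I\<in>Pow D. card I = i}. g (card I))"
    by (rule sum.group[symmetric]) (use assms in \<open>auto simp: card_mono\<close>)
  also have "\<dots> = (\<Sum>i\<le>card D. of_nat (card D choose i) * g i)"
    using n_subsets[OF assms] by (intro sum.cong) (auto simp: Pow_def)
  finally show ?thesis .
qed

section \<open>Umbral evaluation and homogenized h-polynomials\<close>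

definition umbral :: "(nat \<Rightarrow> 'r) \<Rightarrow> nat \<Rightarrow> 'r poly \<Rightarrow> 'r::comm_ring_1" where
  "umbral s N P = (\<Sum>k\<le>N. coeff P k * s k)"

lemma umbral_sum: "umbral s N (sum f I) = (\<Sum>i\<in>I. umbral s N (f i))"
  by (simp add: umbral_def coeff_sum sum_distrib_right) (rule sum.swap)

lemma umbral_const_mult: "umbral s N ([:c:] * P) = c * umbral s N P"
  by (simp add: umbral_def sum_distrib_left mult.assoc)

lemma umbral_X: "k \<le> N \<Longrightarrow> umbral s N ([:0, 1:] ^ k) = s k"
  by (simp add: umbral_def monom_altdef[of 1, simplified, symmetric] if_distrib[of "\<lambda>r. r * _"] cong: if_cong)

definition homogenize :: "nat \<Rightarrow> int poly \<Rightarrow> 'r \<Rightarrow> 'r \<Rightarrow> 'r::comm_ring_1" where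
  "homogenize m q Y Z = (\<Sum>j\<le>m. of_int (coeff q j) * Y ^ j * Z ^ (m - j))"

lemma homogenize_sum: "homogenize m (sum f I) Y Z = (\<Sum>i\<in>I. homogenize m (f i) Y Z)"
  by (simp add: homogenize_def coeff_sum sum_distrib_right) (rule sum.swap)

lemma homogenize_X: "homogenize (Suc m) ([:0, 1:] * q) Y Z = Y * homogenize m q Y Z"
  by (simp add: homogenize_def sum.atMost_Suc_shift sum_distrib_left ac_simps del: sum.atMost_Suc)

lemma homogenize_Suc:
  assumes "degree q \<le> m"
  shows "homogenize (Suc m) q Y Z = Z * homogenize m q Y Z"
proof -
  have "coeff q (Suc m) = 0" using assms by (simp add: coeff_eq_0)
  then show ?thesis
    by (simp add: homogenize_def sum_distrib_left Suc_diff_le ac_simps)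
qed

lemma homogenize_1X:
  assumes "degree q \<le> m"
  shows "homogenize (Suc m) ([:1, -1:] * q) Y Z = (Z - Y) * homogenize m q Y Z"
proof -
  have "[:1, -1:] * q = q - [:0, 1:] * q" by (simp add: algebra_simps)
  then have "homogenize (Suc m) ([:1, -1:] * q) Y Z = homogenize (Suc m) q Y Z - homogenize (Suc m) ([:0, 1:] * q) Y Z"
    by (simp only: homogenize_def coeff_diff of_int_diff left_diff_distrib sum_subtractf)
  then show ?thesis by (simp only: homogenize_X homogenize_Suc[OF assms] left_diff_distrib)
qed

text \<open>Homogenization is multiplicative on these factors, so that of an
  \<open>h\<close>-polynomial is a sum over faces of \<open>Y^|G| (Z-Y)^(m-|G|)\<close>: an
  \<open>f\<close>-polynomial in \<open>Y\<close> and \<open>Z - Y\<close>.\<close>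

lemma homogenize_basis: "homogenize (i + k) ([:0, 1:] ^ i * [:1, -1:] ^ k) Y Z = Y ^ i * (Z - Y) ^ k"
proof (induction i)
  case 0
  show ?case
  proof (induction k)
    case 0
    show ?case by (simp add: homogenize_def)
  next
    case (Suc k)
    have "degree ([:1, -1 :: int:] ^ k) \<le> k" using degree_power_le[of "[:1, -1 :: int:]" k] by simp
    from homogenize_1X[OF this, of Y Z] Suc show ?case by simp
  qed
next
  case (Suc i)
  then show ?case using homogenize_X[of "i + k" "[:0, 1:] ^ i * [:1, -1:] ^ k" Y Z] by (simp add: mult.assoc)
qed

lemma p_poly_umbral:
  assumes "j \<le> m" "m \<le> N"
  shows "p_poly f m j = umbral (h_simplex f) N (([:0, 1:] + [:[:-1, 1:]:]) ^ j * [:0, 1:] ^ (m - j))"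
proof -
  have "([:0, 1:] + [:[:-1, 1:]:]) ^ j * [:0, 1:] ^ (m - j) =
      (\<Sum>i\<le>j. [:of_nat (j choose i) * [:-1, 1:] ^ i:] * [:0, 1:] ^ (m - i) :: int poly poly)"
    unfolding add.commute[of "[:0, 1:]"] binomial_ring sum_distrib_right
  proof (rule sum.cong[OF refl])
    fix i assume "i \<in> {..j}"
    then have e: "m - i = (j - i) + (m - j)" using assms by simp
    have c: "of_nat (j choose i) * [:[:-1, 1:]:] ^ i = [:of_nat (j choose i) * [:-1, 1 :: int:] ^ i:]"
      by (simp add: of_nat_poly poly_const_pow)
    show "of_nat (j choose i) * [:[:-1, 1:]:] ^ i * [:0, 1:] ^ (j - i) * [:0, 1:] ^ (m - j) =
        [:of_nat (j choose i) * [:-1, 1 :: int:] ^ i:] * [:0, 1:] ^ (m - i)"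
      unfolding c e power_add by (simp only: mult.assoc)
  qed
  then show ?thesis
    using assms by (simp only: umbral_sum umbral_const_mult) (auto simp: p_poly_def umbral_X intro!: sum.cong)
qed

text \<open>In the homogenized \<open>h\<close>-polynomial put \<open>Y = S + x - 1\<close> and
  \<open>Z = S\<close>. Then \<open>Z - Y = 1 - x\<close> is a scalar for the umbra, and expanding
  the powers of \<open>Y\<close> over subsets of \<open>H\<close> produces the left-hand
  side.\<close>

lemma h_expansion:
  assumes K: "finite K" "\<And>H. H \<in> K \<Longrightarrow> finite H" "\<And>H. H \<in> K \<Longrightarrow> card H \<le> m"
  shows "(\<Sum>H\<in>K. [:1, -1:] ^ (m - card H) * (\<Sum>L\<in>Pow H. [:-1, 1:] ^ (card H - card L) * h_simplex f (card L))) =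
    (\<Sum>j\<le>m. smult (coeff (hvec K m) j) (p_poly f m j))"
proof -
  let ?S = "[:0, 1:] :: int poly poly" and ?C = "[:[:-1, 1:]:] :: int poly poly"
  let ?U = "umbral (h_simplex f) m"
  have pw: "[:x:] ^ k = [:x ^ k:]" for x :: "int poly" and k by (simp add: poly_const_pow)
  have "(\<Sum>j\<le>m. smult (coeff (hvec K m) j) (p_poly f m j)) =
      (\<Sum>j\<le>m. ?U ([:of_int (coeff (hvec K m) j):] * ((?S + ?C) ^ j * ?S ^ (m - j))))"
    by (intro sum.cong refl) (simp only: umbral_const_mult p_poly_umbral[symmetric] atMost_iff order_refl, simp add: of_int_poly)
  also have "\<dots> = ?U (homogenize m (hvec K m) (?S + ?C) ?S)"
    unfolding homogenize_def umbral_sum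
    by (intro sum.cong refl arg_cong[where f = ?U]) (simp add: of_int_poly mult.assoc)
  also have "homogenize m (hvec K m) (?S + ?C) ?S = (\<Sum>H\<in>K. (?S + ?C) ^ card H * [:[:1, -1:]:] ^ (m - card H))"
    unfolding hvec_def homogenize_sum
  proof (rule sum.cong[OF refl])
    fix H assume "H \<in> K"
    then have "card H + (m - card H) = m" using K(3) by simp
    moreover have "?S - (?S + ?C) = [:[:1, -1:]:]" by simp
    ultimately show "homogenize m ([:0, 1:] ^ card H * [:1, -1:] ^ (m - card H)) (?S + ?C) ?S =
        (?S + ?C) ^ card H * [:[:1, -1:]:] ^ (m - card H)"
      using homogenize_basis[of "card H" "m - card H" "?S + ?C" ?S] by simp
  qed
  also have "?U \<dots> = (\<Sum>H\<in>K. [:1, -1:] ^ (m - card H) * (\<Sum>L\<in>Pow H. [:-1, 1:] ^ (card H - card L) * h_simplex f (card L)))"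
    unfolding umbral_sum
  proof (rule sum.cong[OF refl])
    fix H assume H: "H \<in> K"
    have "(?S + ?C) ^ card H * [:[:1, -1:]:] ^ (m - card H) =
        [:[:1, -1:] ^ (m - card H):] * (\<Sum>L\<in>Pow H. [:[:-1, 1:] ^ (card H - card L):] * ?S ^ card L)"
      unfolding sum_Pow_binomial[OF K(2)[OF H], symmetric] pw by (simp only: mult.commute)
    moreover have "card L \<le> m" if "L \<in> Pow H" for L
      using that K(2,3)[OF H] card_mono[of H L] by auto
    ultimately show "?U ((?S + ?C) ^ card H * [:[:1, -1:]:] ^ (m - card H)) =
        [:1, -1:] ^ (m - card H) * (\<Sum>L\<in>Pow H. [:-1, 1:] ^ (card H - card L) * h_simplex f (card L))"
      by (simp only: umbral_const_mult umbral_sum) (simp add: umbral_X)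
  qed
  finally show ?thesis by simp
qed

lemma degree_hvec:
  assumes K: "finite K" "\<And>G. G \<in> K \<Longrightarrow> card G \<le> d"
  shows "degree (hvec K d) \<le> d"
  unfolding hvec_def
proof (rule degree_sum_le[OF K(1)])
  fix G assume "G \<in> K"
  then have "card G \<le> d" by (rule K(2))
  have "degree ([:0, 1 :: int:] ^ card G * [:1, -1:] ^ (d - card G)) \<le>
      degree ([:0, 1 :: int:] ^ card G) + degree ([:1, -1 :: int:] ^ (d - card G))" by (rule degree_mult_le)
  also have "\<dots> \<le> card G + (d - card G)"
    using degree_power_le[of "[:0, 1 :: int:]" "card G"] degree_power_le[of "[:1, -1 :: int:]" "d - card G"]
    by simp
  finally show "degree ([:0, 1 :: int:] ^ card G * [:1, -1:] ^ (d - card G)) \<le> d" using \<open>card G \<le> d\<close> by simp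
qed

text \<open>Faces of \<open>\<Delta>\<close> are sorted by their carrier in \<open>\<Gamma>\<close>.
  Uniformity fixes the weighted sums of these contributions over all faces of \<open>H\<close>, and
  inversion then expresses each contribution by \<open>h_simplex\<close>, so that
  \<open>h_expansion\<close> applies. The realizations \<open>\<gamma>\<close> and
  \<open>\<gamma>'\<close> meet only in the composition of carriers.\<close>

lemma h_uniform_over:
  fixes \<gamma>' :: "'w \<Rightarrow> 'c::euclidean_space" and \<gamma> :: "'w \<Rightarrow> 'a::euclidean_space"
  assumes u: "uniform_triangulation f \<Delta> \<delta> \<Gamma> \<gamma>'" and t: "triangulates \<Gamma> \<gamma> (Pow V) \<sigma>" and F: "F \<subseteq> V"
  defines "d \<equiv> carrier_face \<delta> \<Gamma> \<gamma>'" and "c \<equiv> carrier_face \<gamma> (Pow V) \<sigma>"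
  shows "h_poly (restriction \<Delta> (c \<circ> d) F) =
    (\<Sum>j\<le>card F. smult (coeff (hvec (restriction \<Gamma> c F) (card F)) j) (p_poly f (card F) j))"
proof -
  have t': "triangulates \<Delta> \<delta> \<Gamma> \<gamma>'" using u by (simp add: uniform_triangulation_def)
  have finD: "finite \<Delta>" and cG: "abstract_complex \<Gamma>"
    using t' by (auto simp: triangulates_def abstract_complex_def)
  have d: "d D \<in> \<Gamma>" if "D \<in> \<Delta>" for D unfolding d_def using carrier_face_props(1)[OF t' that] .
  have FP: "F \<in> Pow V" using F by simp
  note rkD = rank_restriction[OF t', folded d_def] and rkG = rank_restriction[OF t FP, folded c_def]
  have cd: "card D \<le> card H" if "D \<in> \<Delta>" "d D = H" for D H
    using rkD(1)[of H D] d[OF that(1)] that by (auto simp: restriction_def)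
  have fG: "finite H" "Pow H \<subseteq> \<Gamma>" if "H \<in> \<Gamma>" for H using cG that by (auto simp: abstract_complex_def)
  \<comment> \<open>The share of the faces with carrier exactly \<open>H\<close>, normalized to
    degree \<open>card H\<close>; a power of \<open>[:1, -1:]\<close> adjusts it to any larger
    degree.\<close>
  define g where "g H = (\<Sum>D\<in>{D\<in>\<Delta>. d D = H}. [:0, 1:] ^ card D * [:1, -1:] ^ (card H - card D) :: int poly)" for H
  have group: "hvec R m = (\<Sum>H\<in>K. [:1, -1:] ^ (m - card H) * g H)"
    if R: "R = {D\<in>\<Delta>. d D \<in> K}" and K: "finite K" "\<And>H. H \<in> K \<Longrightarrow> card H \<le> m" for R K m
  proof -
    have "hvec R m = (\<Sum>H\<in>K. \<Sum>D\<in>{D\<in>R. d D = H}. [:0, 1:] ^ card D * [:1, -1:] ^ (m - card D))"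
      unfolding hvec_def by (rule sum.group[symmetric]) (use finD R K in auto)
    also have "\<dots> = (\<Sum>H\<in>K. [:1, -1:] ^ (m - card H) * g H)"
    proof (rule sum.cong[OF refl])
      fix H assume H: "H \<in> K"
      have "{D\<in>R. d D = H} = {D\<in>\<Delta>. d D = H}" using R H by auto
      moreover have "[:0, 1:] ^ card D * [:1, -1:] ^ (m - card D) =
          [:1, -1:] ^ (m - card H) * ([:0, 1:] ^ card D * [:1, -1:] ^ (card H - card D) :: int poly)"
        if "D \<in> {D\<in>\<Delta>. d D = H}" for D
      proof -
        have "m - card D = (m - card H) + (card H - card D)" using cd[of D H] that K(2)[OF H] by auto
        then show ?thesis by (simp only: power_add ac_simps)
      qed
      ultimately show "(\<Sum>D\<in>{D\<in>R. d D = H}. [:0, 1:] ^ card D * [:1, -1:] ^ (m - card D)) =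
          [:1, -1:] ^ (m - card H) * g H"
        unfolding g_def sum_distrib_left by (intro sum.cong) auto
    qed
    finally show ?thesis .
  qed
  have hs: "h_simplex f (card H) = (\<Sum>L\<in>Pow H. [:1, -1:] ^ (card H - card L) * g L)" if H: "H \<in> \<Gamma>" for H
  proof -
    let ?R = "restriction \<Delta> d H"
    have "h_simplex f (card H) = h_of_f (card H) (face_num ?R)"
      unfolding h_simplex_def h_of_f_def
    proof (rule sum.cong[OF refl])
      fix i assume "i \<in> {..card H}"
      then have "face_num ?R i = f i (card H)"
        using u H by (simp add: uniform_triangulation_def d_def)
      then show "of_nat (f i (card H)) * [:0, 1:] ^ i * [:1, -1:] ^ (card H - i) =
          of_nat (face_num ?R i) * [:0, 1:] ^ i * [:1, -1 :: int:] ^ (card H - i)" by simp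
    qed
    also have "\<dots> = hvec ?R (card H)"
      using rkD(1)[OF H] finD by (intro h_of_f_face_num) (auto simp: restriction_def)
    also have "\<dots> = (\<Sum>L\<in>Pow H. [:1, -1:] ^ (card H - card L) * g L)"
      by (rule group) (use fG[OF H] in \<open>auto simp: restriction_def card_mono\<close>)
    finally show ?thesis .
  qed
  have gH: "g H = (\<Sum>L\<in>Pow H. [:-1, 1:] ^ (card H - card L) * h_simplex f (card L))" if H: "H \<in> \<Gamma>" for H
  proof -
    have "(\<Sum>L\<in>Pow H. (- [:1, -1:]) ^ (card H - card L) * h_simplex f (card L)) = g H"
      by (rule weighted_moebius[OF fG(1)[OF H]]) (use fG[OF H] hs in blast)
    then show ?thesis by simp
  qed
  let ?DF = "restriction \<Delta> (c \<circ> d) F" and ?GF = "restriction \<Gamma> c F"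
  have GF: "H \<in> \<Gamma>" if "H \<in> ?GF" for H using that by (simp add: restriction_def)
  have DF: "?DF = {D\<in>\<Delta>. d D \<in> ?GF}" using d by (auto simp: restriction_def)
  have finGF: "finite ?GF" using cG by (auto simp: restriction_def abstract_complex_def)
  have le: "card D \<le> card F" if "D \<in> ?DF" for D
    using cd[of D "d D"] rkG(1)[of "d D"] that DF by auto
  \<comment> \<open>A face of \<open>\<Delta>\<close> with \<open>card F\<close> vertices is
    exhibited to fix the degree of the \<open>h\<close>-polynomial: a largest face of the
    restriction of \<open>\<Gamma>\<close>, then a largest face of \<open>\<Delta>\<close> over
    it.\<close>
  obtain H where H: "H \<in> ?GF" "card H = card F" using rkG(2) by blast
  obtain D where D: "D \<in> restriction \<Delta> d H" "card D = card H" using rkD(2)[OF GF[OF H(1)]] by blast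
  have "d D \<in> ?GF"
  proof -
    have "D \<in> \<Delta>" "d D \<subseteq> H" using D(1) by (auto simp: restriction_def)
    then have "d D \<in> \<Gamma>" "cell \<gamma> (d D) \<subseteq> cell \<gamma> H" using d cell_mono by blast+
    moreover have "cell \<gamma> H \<subseteq> cell \<sigma> F"
      using H(1) carrier_le_iff[OF t GF[OF H(1)] FP] by (simp add: restriction_def c_def)
    ultimately show ?thesis
      using carrier_le_iff[OF t _ FP, of "d D"] by (auto simp: restriction_def c_def)
  qed
  then have "D \<in> ?DF" using D(1) by (simp add: DF restriction_def)
  then have "h_poly ?DF = hvec ?DF (card F)"
    using D(2) H(2) finD le by (intro rank_eqI(2)) (auto simp: DF)
  also have "\<dots> = (\<Sum>H\<in>?GF. [:1, -1:] ^ (card F - card H) * g H)"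
    by (rule group[OF DF finGF rkG(1)])
  also have "\<dots> = (\<Sum>H\<in>?GF. [:1, -1:] ^ (card F - card H) *
      (\<Sum>L\<in>Pow H. [:-1, 1:] ^ (card H - card L) * h_simplex f (card L)))"
    by (intro sum.cong refl) (simp add: gH GF)
  also have "\<dots> = (\<Sum>j\<le>card F. smult (coeff (hvec ?GF (card F)) j) (p_poly f (card F) j))"
    by (rule h_expansion[OF finGF fG(1)[OF GF] rkG(1)])
  finally show ?thesis .
qed

section \<open>Nonnegativity and the expansion over faces of the simplex\<close>

lemma smult_conv_of_int: "smult c P = of_int c * P" for P :: "int poly"
  by (simp add: of_int_poly)

lemma coeff_sign_mult: "coeff ((-1) ^ k * P) j = (-1) ^ k * coeff P j" for P :: "int poly"
  by (cases "even k") auto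

theorem theorem3p1:
  fixes f :: "nat \<Rightarrow> nat \<Rightarrow> nat" and n :: nat
    and V :: "'v set" and \<sigma> :: "'v \<Rightarrow> 'a::euclidean_space"
    and \<Gamma> :: "'w set set" and \<gamma> :: "'w \<Rightarrow> 'a"
    and \<Gamma>\<^sub>0 :: "'s set set" and \<gamma>\<^sub>0 :: "'s \<Rightarrow> 'b::euclidean_space"
    and \<Delta>\<^sub>0 :: "'t set set" and \<delta>\<^sub>0 :: "'t \<Rightarrow> 'b"
  assumes f_triangle: "uniform_triangulation f \<Delta>\<^sub>0 \<delta>\<^sub>0 \<Gamma>\<^sub>0 \<gamma>\<^sub>0" "rank_cpx \<Gamma>\<^sub>0 = n"
    and V: "finite V" "card V = n"
    and \<Gamma>: "triangulates \<Gamma> \<gamma> (Pow V) \<sigma>"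
  shows "(\<forall>k j. k + j \<le> n \<longrightarrow> 0 \<le> c_coeff V \<Gamma> (carrier_face \<gamma> (Pow V) \<sigma>) k j) \<and>
    (\<forall>(\<Delta> :: 'u set set) (\<delta> :: 'u \<Rightarrow> 'c::euclidean_space) (\<gamma>' :: 'w \<Rightarrow> 'c).
       uniform_triangulation f \<Delta> \<delta> \<Gamma> \<gamma>' \<longrightarrow>
       local_h V \<Delta> (carrier_face \<gamma> (Pow V) \<sigma> \<circ> carrier_face \<delta> \<Gamma> \<gamma>') =
         (\<Sum>k\<le>n. \<Sum>j\<le>n - k.
            smult (c_coeff V \<Gamma> (carrier_face \<gamma> (Pow V) \<sigma>) k j) (l_poly f n k j)))"
proof -
  let ?c = "carrier_face \<gamma> (Pow V) \<sigma>"
  let ?h = "\<lambda>F. hvec (restriction \<Gamma> ?c F) (card F)"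
  have finG: "finite \<Gamma>" using \<Gamma> by (auto simp: triangulates_def abstract_complex_def)
  have finR: "finite (restriction \<Gamma> ?c F)" for F using finG by (simp add: restriction_def)
  have finV: "finite F" if "F \<subseteq> V" for F using that V(1) finite_subset by blast
  obtain l :: "'v set \<Rightarrow> nat \<Rightarrow> nat" where
    l: "\<And>F k. F \<subseteq> V \<Longrightarrow> coeff (?h F) k = (\<Sum>K\<in>Pow F. int (l K k))"
    using triangulation_decomposition[OF \<Gamma>] by blast
  have rk: "\<And>G. G \<in> restriction \<Gamma> ?c F \<Longrightarrow> card G \<le> card F"
      "\<exists>G\<in>restriction \<Gamma> ?c F. card G = card F" if "F \<subseteq> V" for F
    using rank_restriction[OF \<Gamma>, of F] that by auto
  have hp: "h_poly (restriction \<Gamma> ?c F) = ?h F" if "F \<subseteq> V" for F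
    using rk[OF that] finG by (intro rank_eqI(2)) (auto simp: restriction_def)
  \<comment> \<open>The cardinalities \<open>l\<close> and the local \<open>h\<close>-polynomials
    solve the same system over the subsets of \<open>F\<close>, so inversion identifies them; this
    is where nonnegativity comes from.\<close>
  have loc: "coeff (local_h F (restriction \<Gamma> ?c F) ?c) j = int (l F j)" if F: "F \<subseteq> V" for F j
  proof -
    have "coeff (local_h F (restriction \<Gamma> ?c F) ?c) j =
        (\<Sum>G\<in>Pow F. (-1) ^ (card F - card G) * coeff (?h G) j)"
      unfolding local_h_def coeff_sum
    proof (rule sum.cong[OF refl])
      fix G assume G: "G \<in> Pow F"
      then have "restriction (restriction \<Gamma> ?c F) ?c G = restriction \<Gamma> ?c G"
        by (auto simp: restriction_def)
      then show "coeff ((-1) ^ (card F - card G) * h_poly (restriction (restriction \<Gamma> ?c F) ?c G)) j =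
          (-1) ^ (card F - card G) * coeff (?h G) j"
        using hp[of G] G F by (simp add: coeff_sign_mult)
    qed
    also have "\<dots> = int (l F j)"
      using weighted_moebius[OF finV[OF F], of "\<lambda>G. coeff (?h G) j" 1 "\<lambda>K. int (l K j)"] l F by auto
    finally show ?thesis .
  qed
  have cc: "c_coeff V \<Gamma> ?c k j = (\<Sum>F | F \<subseteq> V \<and> card F = n - k. int (l F j))" for k j
    unfolding c_coeff_def V(2) by (intro sum.cong) (auto simp: loc)
  \<comment> \<open>Beyond degree \<open>card K\<close> the coefficient of the
    \<open>h\<close>-polynomial is zero, and it is a sum of non-negative terms. Sums over
    \<open>j\<close> may therefore run to \<open>n\<close> throughout and be cut to
    \<open>n - k\<close> at the end.\<close>
  have l0: "l K j = 0" if K: "K \<subseteq> V" "card K < j" for K j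
  proof -
    have "degree (?h K) < j" using degree_hvec[OF finR rk(1)[OF K(1)]] K(2) by (meson le_less_trans)
    then have "(\<Sum>L\<in>Pow K. int (l L j)) = 0" using l[OF K(1), of j] by (simp add: coeff_eq_0)
    then have "\<forall>L\<in>Pow K. int (l L j) = 0" using finV[OF K(1)] by (subst (asm) sum_nonneg_eq_0_iff) auto
    then show ?thesis by simp
  qed
  have c0: "c_coeff V \<Gamma> ?c k j = 0" if "n - k < j" for k j
    unfolding cc using l0 that by (intro sum.neutral) auto
  have main: "local_h V \<Delta> (?c \<circ> carrier_face \<delta> \<Gamma> \<gamma>') =
      (\<Sum>k\<le>n. \<Sum>j\<le>n - k. smult (c_coeff V \<Gamma> ?c k j) (l_poly f n k j))"
    if u: "uniform_triangulation f \<Delta> \<delta> \<Gamma> \<gamma>'"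
    for \<Delta> :: "'u set set" and \<delta> :: "'u \<Rightarrow> 'c" and \<gamma>' :: "'w \<Rightarrow> 'c"
  proof -
    let ?p = "\<lambda>G j. p_poly f (card G) j"
    have hD: "h_poly (restriction \<Delta> (?c \<circ> carrier_face \<delta> \<Gamma> \<gamma>') G) =
        (\<Sum>L\<in>Pow G. \<Sum>j\<le>n. of_int (int (l L j)) * ?p G j)" if G: "G \<subseteq> V" for G
    proof -
      have cG: "card G \<le> n" using card_mono[OF V(1) G] V(2) by simp
      have "h_poly (restriction \<Delta> (?c \<circ> carrier_face \<delta> \<Gamma> \<gamma>') G) =
          (\<Sum>j\<le>card G. smult (coeff (?h G) j) (?p G j))"
        by (rule h_uniform_over[OF u \<Gamma> G])
      also have "\<dots> = (\<Sum>j\<le>n. smult (coeff (?h G) j) (?p G j))"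
      proof (rule sum.mono_neutral_left)
        show "\<forall>j\<in>{..n} - {..card G}. smult (coeff (?h G) j) (?p G j) = 0"
        proof
          fix j assume "j \<in> {..n} - {..card G}"
          moreover have "degree (?h G) \<le> card G" by (rule degree_hvec[OF finR rk(1)[OF G]])
          ultimately show "smult (coeff (?h G) j) (?p G j) = 0" by (simp add: coeff_eq_0)
        qed
      qed (use cG in auto)
      also have "\<dots> = (\<Sum>j\<le>n. \<Sum>L\<in>Pow G. of_int (int (l L j)) * ?p G j)"
        by (simp only: smult_conv_of_int l[OF G] of_int_sum sum_distrib_right)
      also have "\<dots> = (\<Sum>L\<in>Pow G. \<Sum>j\<le>n. of_int (int (l L j)) * ?p G j)" by (rule sum.swap)
      finally show ?thesis .
    qed
    \<comment> \<open>Indexed by the complement of \<open>G\<close>, a subset of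
      \<open>V - L\<close>, the signed sum depends on its size only and becomes the binomial sum of
      \<open>l_poly\<close> with \<open>k = n - card L\<close>.\<close>
    have inner: "(\<Sum>G\<in>{G. G \<subseteq> V \<and> L \<subseteq> G}. (-1) ^ (n - card G) * ?p G j) = l_poly f n (n - card L) j"
      if L: "L \<subseteq> V" for L j
    proof -
      have bij: "bij_betw (\<lambda>I. V - I) (Pow (V - L)) {G. G \<subseteq> V \<and> L \<subseteq> G}"
        by (rule bij_betw_byWitness[where f' = "\<lambda>G. V - G"]) (use L in auto)
      have "(\<Sum>G\<in>{G. G \<subseteq> V \<and> L \<subseteq> G}. (-1) ^ (n - card G) * ?p G j) =
          (\<Sum>I\<in>Pow (V - L). (-1) ^ (n - card (V - I)) * ?p (V - I) j)"
        by (rule sum.reindex_bij_betw[OF bij, symmetric])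
      also have "\<dots> = (\<Sum>I\<in>Pow (V - L). (\<lambda>i. (-1) ^ i * p_poly f (n - i) j) (card I))"
      proof (rule sum.cong[OF refl])
        fix I assume "I \<in> Pow (V - L)"
        then have "I \<subseteq> V" by blast
        then have "card (V - I) = n - card I" "card I \<le> n"
          using card_Diff_subset[OF finV] card_mono[OF V(1)] V(2) by auto
        then show "(-1) ^ (n - card (V - I)) * ?p (V - I) j = (\<lambda>i. (-1) ^ i * p_poly f (n - i) j) (card I)" by simp
      qed
      also have "\<dots> = (\<Sum>i\<le>card (V - L). of_nat (card (V - L) choose i) * ((-1) ^ i * p_poly f (n - i) j))"
        using V(1) by (intro sum_Pow_card) auto
      also have "card (V - L) = n - card L" using card_Diff_subset[OF finV[OF L] L] V(2) by simp
      finally show ?thesis by (simp add: l_poly_def ac_simps)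
    qed
    have "local_h V \<Delta> (?c \<circ> carrier_face \<delta> \<Gamma> \<gamma>') =
        (\<Sum>G\<in>Pow V. \<Sum>L\<in>Pow G. \<Sum>j\<le>n. of_int (int (l L j)) * ((-1) ^ (n - card G) * ?p G j))"
      unfolding local_h_def V(2)
    proof (rule sum.cong[OF refl])
      fix G assume "G \<in> Pow V"
      then show "(-1) ^ (n - card G) * h_poly (restriction \<Delta> (?c \<circ> carrier_face \<delta> \<Gamma> \<gamma>') G) =
          (\<Sum>L\<in>Pow G. \<Sum>j\<le>n. of_int (int (l L j)) * ((-1) ^ (n - card G) * ?p G j))"
        by (simp only: hD PowD sum_distrib_left mult.left_commute)
    qed
    also have "\<dots> = (\<Sum>L\<in>Pow V. \<Sum>G\<in>{G. G \<subseteq> V \<and> L \<subseteq> G}. \<Sum>j\<le>n. of_int (int (l L j)) * ((-1) ^ (n - card G) * ?p G j))"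
      by (rule sum_Pow_swap[OF V(1)])
    also have "\<dots> = (\<Sum>L\<in>Pow V. \<Sum>j\<le>n. of_int (int (l L j)) * l_poly f n (n - card L) j)"
    proof (rule sum.cong[OF refl])
      fix L assume "L \<in> Pow V"
      then have L: "L \<subseteq> V" by simp
      show "(\<Sum>G\<in>{G. G \<subseteq> V \<and> L \<subseteq> G}. \<Sum>j\<le>n. of_int (int (l L j)) * ((-1) ^ (n - card G) * ?p G j)) =
          (\<Sum>j\<le>n. of_int (int (l L j)) * l_poly f n (n - card L) j)"
        by (subst sum.swap) (simp only: sum_distrib_left[symmetric] inner[OF L])
    qed
    also have "\<dots> = (\<Sum>k\<le>n. \<Sum>L\<in>{L\<in>Pow V. n - card L = k}. \<Sum>j\<le>n. of_int (int (l L j)) * l_poly f n (n - card L) j)"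
      by (rule sum.group[symmetric]) (use V(1) in auto)
    also have "\<dots> = (\<Sum>k\<le>n. \<Sum>j\<le>n. smult (c_coeff V \<Gamma> ?c k j) (l_poly f n k j))"
    proof (rule sum.cong[OF refl])
      fix k assume k: "k \<in> {..n}"
      have "n - card L = k \<longleftrightarrow> card L = n - k" if "L \<subseteq> V" for L
        using card_mono[OF V(1) that] V(2) k by auto
      then have e: "{L\<in>Pow V. n - card L = k} = {L. L \<subseteq> V \<and> card L = n - k}" by auto
      have "(\<Sum>L\<in>{L\<in>Pow V. n - card L = k}. \<Sum>j\<le>n. of_int (int (l L j)) * l_poly f n (n - card L) j) =
          (\<Sum>L\<in>{L\<in>Pow V. n - card L = k}. \<Sum>j\<le>n. of_int (int (l L j)) * l_poly f n k j)"
        by (intro sum.cong) auto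
      also have "\<dots> = (\<Sum>j\<le>n. \<Sum>L\<in>{L\<in>Pow V. n - card L = k}. of_int (int (l L j)) * l_poly f n k j)"
        by (rule sum.swap)
      also have "\<dots> = (\<Sum>j\<le>n. smult (c_coeff V \<Gamma> ?c k j) (l_poly f n k j))"
        by (simp only: e smult_conv_of_int cc of_int_sum sum_distrib_right)
      finally show "(\<Sum>L\<in>{L\<in>Pow V. n - card L = k}. \<Sum>j\<le>n. of_int (int (l L j)) * l_poly f n (n - card L) j) =
          (\<Sum>j\<le>n. smult (c_coeff V \<Gamma> ?c k j) (l_poly f n k j))" .
    qed
    also have "\<dots> = (\<Sum>k\<le>n. \<Sum>j\<le>n - k. smult (c_coeff V \<Gamma> ?c k j) (l_poly f n k j))"
      by (intro sum.cong refl sum.mono_neutral_right) (auto simp: c0)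
    finally show ?thesis .
  qed
  have "0 \<le> c_coeff V \<Gamma> ?c k j" for k j unfolding cc by (intro sum_nonneg) simp
  then show ?thesis using main by blast
qed

end
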